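(* Let $r\ge1$ be an integer. There is a constant $c>0$ depending only on $r$ such that the following holds. Let $\beta>0$, $\gamma>0$, $\eta\in\mathbb{R}$, $f\in(H^1_0(\Lambda))'$. Let $u\in H^1(\Lambda)$ be the (weak) solution of $$-u''+\gamma u=f\ \text{ in }\Lambda,\qquad u(0)=\eta,\qquad \lim_{x\to+\infty}u(x)=0,$$ i.e. $u(0)=\eta$ and $(u',v')+\gamma(u,v)=(f,v)$ for all $v\in H^1_0(\Lambda)$, and let $u_N\in X^{\beta}_N$ be the solution of the spectral scheme $u_N(0)=\eta$ and $(u_N',v_N')+\gamma(u_N,v_N)=(f,v_N)$ for all $v_N\in X^{0,\beta}_N$. If $u\in H^r_{w^{r-1}}(\Lambda)$, then for all sufficiently large $N$, $$\|(u-u_N)'\|^2+\gamma\|u-u_N\|^2\le c\Big(1+\frac{4\gamma}{\beta^2}\Big)(\beta N)^{1-r}\,\|u\|^2_{r,-1,\beta}$$ and $$\|u-u_N\|_{w^{-1}}\le c\Big(1+\frac{\beta^2}{4\gamma}\Big)\Big(1+\frac{2\sqrt{\gamma}}{\beta}\Big)^2(\beta N)^{-\frac r2}\,\|u\|_{r,-1,\beta}.$$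
   Context: $\Lambda=(0,\infty)$; $(\cdot,\cdot)$ and $\|\cdot\|$ are the $L^2(\Lambda)$ inner product and norm, and $(f,v)$ also denotes the duality pairing. $w^{\alpha}(x)=x^{\alpha}$; $\|v\|_{w^{\alpha}}^2=\int_\Lambda v^2x^{\alpha}dx$; $H^r_{w^{r-1}}(\Lambda)=\{v:\partial_x^kv\in L^2_{w^{r-1}}(\Lambda),\ 0\le k\le r\}$. The norm is $$\|u\|_{r,-1,\beta}=\Big[\sum_{\nu=0}^{r}\binom r\nu\frac{\beta^{2r-2\nu}}{2^{2r-2\nu}}\|\partial_x^{\nu}u\|^2_{w^{r-1}}\Big]^{1/2}.$$ With $\mathbb{P}_N$ the real polynomials of degree $\le N$: $X^{\beta}_N=\{e^{-\frac12\beta x}p(x):p\in\mathbb{P}_N\}$ and $X^{0,\beta}_N=\{e^{-\frac12\beta x}p(x):p\in\mathbb{P}_N,\ p(0)=0\}$. *)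

theory Defs
  imports "HOL-Analysis.Analysis" "HOL-Computational_Algebra.Polynomial"
begin

text \<open>Functions on \<open>\<Lambda> = (0,\<infinity>)\<close> are represented by functions of type \<open>real \<Rightarrow> real\<close>, of which only
  the values on \<open>\<Lambda>\<close>, up to null sets, matter.\<close>

abbreviation halfline :: "real measure" where
  "halfline \<equiv> lebesgue_on {0<..}"

definition L2w :: "real \<Rightarrow> (real \<Rightarrow> real) set" where
  "L2w \<alpha> = {v. v \<in> borel_measurable halfline \<and> integrable halfline (\<lambda>x. (v x)\<^sup>2 * x powr \<alpha>)}"

text \<open>Meaningful for arguments in \<open>L2w \<alpha>\<close> only: the Bochner integral of a non-integrable function
  is \<open>0\<close>.\<close>

definition normw :: "real \<Rightarrow> (real \<Rightarrow> real) \<Rightarrow> real" where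
  "normw \<alpha> v = sqrt (LINT x|halfline. (v x)\<^sup>2 * x powr \<alpha>)"

definition inner_L2 :: "(real \<Rightarrow> real) \<Rightarrow> (real \<Rightarrow> real) \<Rightarrow> real" where
  "inner_L2 u v = (LINT x|halfline. u x * v x)"

definition test_function :: "(real \<Rightarrow> real) \<Rightarrow> bool" where
  "test_function \<phi> \<longleftrightarrow>
     (\<forall>k. (deriv ^^ k) \<phi> differentiable_on UNIV) \<and>
     (\<exists>a b. 0 < a \<and> (\<forall>x. x \<notin> {a..b} \<longrightarrow> \<phi> x = 0))"

definition locally_integrable :: "(real \<Rightarrow> real) \<Rightarrow> bool" where
  "locally_integrable v \<longleftrightarrow> (\<forall>a b. 0 < a \<longrightarrow> integrable (lebesgue_on {a..b}) v)"

definition has_weak_deriv :: "nat \<Rightarrow> (real \<Rightarrow> real) \<Rightarrow> (real \<Rightarrow> real) \<Rightarrow> bool" where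
  "has_weak_deriv k v g \<longleftrightarrow> locally_integrable v \<and> locally_integrable g \<and>
     (\<forall>\<phi>. test_function \<phi> \<longrightarrow> inner_L2 v ((deriv ^^ k) \<phi>) = (- 1) ^ k * inner_L2 g \<phi>)"

text \<open>A representative of the \<open>k\<close>-th distributional derivative, which is unique up to null sets.\<close>

definition weak_deriv :: "nat \<Rightarrow> (real \<Rightarrow> real) \<Rightarrow> (real \<Rightarrow> real)" where
  "weak_deriv k v = (SOME g. has_weak_deriv k v g)"

definition sobolev :: "nat \<Rightarrow> real \<Rightarrow> (real \<Rightarrow> real) set" where
  "sobolev r \<alpha> = {v. \<forall>k\<le>r. \<exists>g. has_weak_deriv k v g \<and> g \<in> L2w \<alpha>}"

abbreviation H1 :: "(real \<Rightarrow> real) set" where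
  "H1 \<equiv> sobolev 1 0"

definition norm_H1 :: "(real \<Rightarrow> real) \<Rightarrow> real" where
  "norm_H1 v = sqrt ((normw 0 v)\<^sup>2 + (normw 0 (weak_deriv 1 v))\<^sup>2)"

definition H10 :: "(real \<Rightarrow> real) set" where
  "H10 = {v \<in> H1. \<exists>\<phi>. (\<forall>n. test_function (\<phi> n)) \<and>
                      (\<lambda>n. norm_H1 (\<lambda>x. v x - \<phi> n x)) \<longlonglongrightarrow> 0}"

text \<open>The bound makes every functional in the dual respect equality almost everywhere on
  \<open>\<Lambda>\<close>.\<close>

definition H10_dual :: "((real \<Rightarrow> real) \<Rightarrow> real) set" where
  "H10_dual = {f.
     (\<forall>v\<in>H10. \<forall>w\<in>H10. f (\<lambda>x. v x + w x) = f v + f w) \<and>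
     (\<forall>a. \<forall>v\<in>H10. f (\<lambda>x. a * v x) = a * f v) \<and>
     (\<exists>C. \<forall>v\<in>H10. \<bar>f v\<bar> \<le> C * norm_H1 v)}"

text \<open>The boundary value at \<open>0\<close> of the continuous representative on \<open>[0,\<infinity>)\<close>.\<close>

definition has_trace_0 :: "(real \<Rightarrow> real) \<Rightarrow> real \<Rightarrow> bool" where
  "has_trace_0 v a \<longleftrightarrow>
     (\<exists>V. continuous_on {0..} V \<and> (AE x in halfline. V x = v x) \<and> V 0 = a)"

definition norm_r :: "nat \<Rightarrow> real \<Rightarrow> (real \<Rightarrow> real) \<Rightarrow> real" where
  "norm_r r \<beta> u = sqrt (\<Sum>\<nu>\<le>r. real (r choose \<nu>) *
      (\<beta> ^ (2 * r - 2 * \<nu>) / 2 ^ (2 * r - 2 * \<nu>)) * (normw (real r - 1) (weak_deriv \<nu> u))\<^sup>2)"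

definition X :: "real \<Rightarrow> nat \<Rightarrow> (real \<Rightarrow> real) set" where
  "X \<beta> N = {\<lambda>x. exp (- (1/2) * \<beta> * x) * poly p x | p. degree p \<le> N}"

definition X0 :: "real \<Rightarrow> nat \<Rightarrow> (real \<Rightarrow> real) set" where
  "X0 \<beta> N = {\<lambda>x. exp (- (1/2) * \<beta> * x) * poly p x | p. degree p \<le> N \<and> poly p 0 = 0}"

definition energy_form :: "real \<Rightarrow> (real \<Rightarrow> real) \<Rightarrow> (real \<Rightarrow> real) \<Rightarrow> real" where
  "energy_form \<gamma> u v = inner_L2 (weak_deriv 1 u) (weak_deriv 1 v) + \<gamma> * inner_L2 u v"

text \<open>The condition \<open>u(x) \<rightarrow> 0\<close> as \<open>x \<rightarrow> \<infinity>\<close> is carried by \<open>u \<in> H1\<close>.\<close>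

definition weak_solution ::
    "real \<Rightarrow> real \<Rightarrow> ((real \<Rightarrow> real) \<Rightarrow> real) \<Rightarrow> (real \<Rightarrow> real) \<Rightarrow> bool" where
  "weak_solution \<gamma> \<eta> f u \<longleftrightarrow>
     u \<in> H1 \<and> has_trace_0 u \<eta> \<and> (\<forall>v\<in>H10. energy_form \<gamma> u v = f v)"

definition scheme_solution ::
    "real \<Rightarrow> real \<Rightarrow> real \<Rightarrow> ((real \<Rightarrow> real) \<Rightarrow> real) \<Rightarrow> nat \<Rightarrow> (real \<Rightarrow> real) \<Rightarrow> bool" where
  "scheme_solution \<beta> \<gamma> \<eta> f N uN \<longleftrightarrow>
     uN \<in> X \<beta> N \<and> uN 0 = \<eta> \<and> (\<forall>v\<in>X0 \<beta> N. energy_form \<gamma> uN v = f v)"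

end

theory Submission
  imports Defs
begin

text \<open>Write \<open>b = \<beta>/2\<close> and \<open>D v = v' + b v\<close>. For \<open>E(0) = 0\<close> one has \<open>\<parallel>D E\<parallel>\<^sup>2 = \<parallel>E'\<parallel>\<^sup>2 + b\<^sup>2 \<parallel>E\<parallel>\<^sup>2\<close>, since
  \<open>2 b E E'\<close> integrates to a boundary value, and \<open>D\<close> maps \<open>exp (-b x) q\<close> to \<open>exp (-b x) q'\<close>. Approximating
  \<open>u\<close> in energy by elements of the trial space with the right boundary value is therefore the same as
  approximating \<open>D u\<close> in \<open>L\<^sup>2\<close> by a polynomial of degree \<open>< N\<close> times \<open>exp (-b x)\<close>, a problem without boundary
  condition (\<open>energy_approximation\<close>).

  The derivatives of order \<open>m\<close> of the Laguerre polynomials are orthogonal for the weight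
  \<open>x\<^sup>m exp (-\<beta>x)\<close>, and integration by parts turns the coefficients of \<open>h\<close> into those of its \<open>m\<close>-th derivative,
  gaining a factor \<open>\<beta> n\<close> for each derivative. With \<open>m = r - 1\<close> and \<open>h = exp (b x) D u\<close> this yields
  \<open>(\<beta> N)\<^bsup>1-r\<^esup> \<parallel>D\<^sup>r u\<parallel>\<^sup>2\<close> with weight \<open>x\<^bsup>r-1\<^esup>\<close>, up to a constant, as a bound for the square of the
  error (\<open>laguerre_approximation\<close>), and \<open>D\<^sup>r u\<close> is bounded by the norm in the theorem through the binomial
  formula (\<open>twist_square_le\<close>). Galerkin orthogonality (\<open>cea\<close>) gives the first estimate: the factor
  \<open>1 + 4\<gamma>/\<beta>\<^sup>2\<close> compares the energy for \<open>\<gamma>\<close> with the one for \<open>b\<^sup>2\<close>.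

  The second estimate is a duality argument. Let \<open>E\<close> be the error and \<open>- z'' + \<gamma> z = E/x\<close>, \<open>z(0) = 0\<close>. Testing
  with \<open>x z\<close> bounds \<open>z\<close> and \<open>z'\<close>, hence also \<open>D\<^sup>2 z\<close>, in \<open>L\<^sup>2\<close> with weight \<open>x\<close> by \<open>E\<close> in \<open>L\<^sup>2\<close> with weight
  \<open>1/x\<close>, so the approximation result with \<open>r = 2\<close> applies to \<open>z\<close> and gains the missing \<open>(\<beta> N)\<^bsup>-1/2\<^esup>\<close>. The
  right-hand side is first restricted to a compact interval: then \<open>z\<close> is given by variation of
  constants and decays exponentially, and the bound does not depend on the interval
  (\<open>dual_bound\<close>, \<open>weighted_bound\<close>).

  Weak derivatives enter only through the lemma of du Bois-Reymond (\<open>has_weak_deriv_imp_primitive\<close>),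
  which supplies absolutely continuous representatives. To use the weak formulation, the elements of the
  test space must be limits of test functions in the norm of \<open>H\<^sup>1\<close> (\<open>expoly_in_H10\<close>).\<close>

section \<open>Integrals on the half line and primitives\<close>

lemma halfline_sets [simp]: "{0::real<..} \<in> sets lebesgue"
  by (simp add: borel_open)

lemma lebesgue_on_subset:
  fixes f :: "real \<Rightarrow> real"
  assumes "S \<in> sets lebesgue" "T \<in> sets lebesgue" "S \<subseteq> T"
  shows "integrable (lebesgue_on S) f \<longleftrightarrow> integrable (lebesgue_on T) (\<lambda>x. indicator S x * f x)"
    and "(LINT x|lebesgue_on S. f x) = (LINT x|lebesgue_on T. indicator S x * f x)"
proof -
  have "indicator T x *\<^sub>R (indicator S x * f x) = indicator S x *\<^sub>R f x" for x
    using assms(3) by (auto simp: indicator_def)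
  then have eq: "(\<lambda>x. indicator T x *\<^sub>R (indicator S x * f x)) = (\<lambda>x. indicator S x *\<^sub>R f x)"
    by (rule ext)
  show "integrable (lebesgue_on S) f \<longleftrightarrow> integrable (lebesgue_on T) (\<lambda>x. indicator S x * f x)"
    using assms eq by (simp only: integrable_restrict_space sets.Int_space_eq2)
  show "(LINT x|lebesgue_on S. f x) = (LINT x|lebesgue_on T. indicator S x * f x)"
    using assms eq by (simp only: integral_restrict_space sets.Int_space_eq2)
qed

lemma integrable_lebesgue_on_subset:
  fixes f :: "real \<Rightarrow> real"
  assumes "integrable (lebesgue_on T) f" "S \<in> sets lebesgue" "T \<in> sets lebesgue" "S \<subseteq> T"
  shows "integrable (lebesgue_on S) f"
proof -
  have "S \<in> sets (lebesgue_on T)"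
    using assms by (auto simp: sets_restrict_space)
  then have "integrable (lebesgue_on T) (\<lambda>x. indicator S x *\<^sub>R f x)"
    using assms(1) by (rule integrable_mult_indicator)
  then show ?thesis
    using lebesgue_on_subset(1)[OF assms(2-4)] by simp
qed

lemma integrable_mult_bounded:
  fixes f g :: "'a \<Rightarrow> real"
  assumes "integrable M f" "g \<in> borel_measurable M" "\<And>x. x \<in> space M \<Longrightarrow> \<bar>g x\<bar> \<le> C"
  shows "integrable M (\<lambda>x. f x * g x)" "integrable M (\<lambda>x. g x * f x)"
proof -
  show "integrable M (\<lambda>x. f x * g x)"
  proof (rule Bochner_Integration.integrable_bound)
    show "integrable M (\<lambda>x. C * \<bar>f x\<bar>)" using assms(1) by simp
    show "(\<lambda>x. f x * g x) \<in> borel_measurable M"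
      using borel_measurable_integrable[OF assms(1)] assms(2) by simp
    show "AE x in M. norm (f x * g x) \<le> norm (C * \<bar>f x\<bar>)"
    proof (rule AE_I2)
      fix x assume "x \<in> space M"
      then have "\<bar>g x\<bar> * \<bar>f x\<bar> \<le> C * \<bar>f x\<bar>"
        using assms(3) by (intro mult_right_mono) auto
      also have "\<dots> \<le> \<bar>C\<bar> * \<bar>f x\<bar>" by (intro mult_right_mono) auto
      finally show "norm (f x * g x) \<le> norm (C * \<bar>f x\<bar>)"
        by (simp add: abs_mult mult.commute)
    qed
  qed
  then show "integrable M (\<lambda>x. g x * f x)" by (simp add: mult.commute)
qed

lemma integrable_product_of_squares:
  fixes u v :: "'a \<Rightarrow> real"
  assumes "u \<in> borel_measurable M" "v \<in> borel_measurable M"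
    "integrable M (\<lambda>x. (u x)\<^sup>2)" "integrable M (\<lambda>x. (v x)\<^sup>2)"
  shows "integrable M (\<lambda>x. u x * v x)"
proof (rule Bochner_Integration.integrable_bound)
  show "integrable M (\<lambda>x. (u x)\<^sup>2 + (v x)\<^sup>2)" using assms by simp
  show "(\<lambda>x. u x * v x) \<in> borel_measurable M" using assms by simp
  show "AE x in M. norm (u x * v x) \<le> norm ((u x)\<^sup>2 + (v x)\<^sup>2)"
  proof (rule AE_I2)
    fix x
    have "0 \<le> (\<bar>u x\<bar> - \<bar>v x\<bar>)\<^sup>2" by simp
    then have "2 * (\<bar>u x\<bar> * \<bar>v x\<bar>) \<le> (u x)\<^sup>2 + (v x)\<^sup>2"
      by (simp add: power2_eq_square algebra_simps)
    moreover have "0 \<le> \<bar>u x\<bar> * \<bar>v x\<bar>" by simp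
    ultimately have "\<bar>u x\<bar> * \<bar>v x\<bar> \<le> (u x)\<^sup>2 + (v x)\<^sup>2" by linarith
    then show "norm (u x * v x) \<le> norm ((u x)\<^sup>2 + (v x)\<^sup>2)"
      by (simp add: abs_mult)
  qed
qed

lemma integrable_square_add:
  fixes u v :: "'a \<Rightarrow> real"
  assumes "u \<in> borel_measurable M" "v \<in> borel_measurable M"
    "integrable M (\<lambda>x. (u x)\<^sup>2)" "integrable M (\<lambda>x. (v x)\<^sup>2)"
  shows "integrable M (\<lambda>x. (u x + v x)\<^sup>2)"
  using assms integrable_product_of_squares[OF assms]
  by (simp add: power2_sum mult.assoc)

lemma Cauchy_Schwarz_integral:
  fixes u v :: "'a \<Rightarrow> real"
  assumes "u \<in> borel_measurable M" "v \<in> borel_measurable M"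
    "integrable M (\<lambda>x. (u x)\<^sup>2)" "integrable M (\<lambda>x. (v x)\<^sup>2)"
  shows "(LINT x|M. u x * v x)\<^sup>2 \<le> (LINT x|M. (u x)\<^sup>2) * (LINT x|M. (v x)\<^sup>2)"
proof -
  define A B C where "A = (LINT x|M. (u x)\<^sup>2)" and "B = (LINT x|M. u x * v x)"
    and "C = (LINT x|M. (v x)\<^sup>2)"
  note uv = integrable_product_of_squares[OF assms]
  have quad: "0 \<le> s\<^sup>2 * A + 2 * s * t * B + t\<^sup>2 * C" for s t
  proof -
    have "(LINT x|M. (s * u x + t * v x)\<^sup>2)
        = (LINT x|M. s\<^sup>2 * (u x)\<^sup>2 + (2 * s * t) * (u x * v x) + t\<^sup>2 * (v x)\<^sup>2)"
      by (intro Bochner_Integration.integral_cong) (auto simp: power2_eq_square algebra_simps)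
    also have "\<dots> = s\<^sup>2 * A + 2 * s * t * B + t\<^sup>2 * C"
      using uv assms by (simp add: A_def B_def C_def)
    finally have eq: "(LINT x|M. (s * u x + t * v x)\<^sup>2) = s\<^sup>2 * A + 2 * s * t * B + t\<^sup>2 * C" .
    have "0 \<le> (LINT x|M. (s * u x + t * v x)\<^sup>2)" by simp
    then show ?thesis by (simp only: eq)
  qed
  have "C \<ge> 0" unfolding C_def by simp
  show ?thesis
  proof (cases "C = 0")
    case True
    have "B = 0"
    proof (rule ccontr)
      assume "B \<noteq> 0"
      have "0 \<le> A + 2 * (- (A + 1) / (2 * B)) * B"
        using quad[of 1 "- (A + 1) / (2 * B)"] True by simp
      then show False using \<open>B \<noteq> 0\<close> by (simp add: field_simps)
    qed
    then show ?thesis using True by (simp add: A_def B_def C_def)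
  next
    case False
    then have "C > 0" using \<open>C \<ge> 0\<close> by simp
    have "0 \<le> C * (C * A - B\<^sup>2)"
      using quad[of C "- B"] by (simp add: power2_eq_square algebra_simps)
    then have "B\<^sup>2 \<le> A * C" using \<open>C > 0\<close>
      by (simp add: zero_le_mult_iff mult.commute)
    then show ?thesis by (simp add: A_def B_def C_def)
  qed
qed

lemma continuous_on_Icc_bounded:
  fixes F :: "real \<Rightarrow> real"
  assumes "continuous_on {a..b} F"
  obtains C where "\<And>x. x \<in> {a..b} \<Longrightarrow> \<bar>F x\<bar> \<le> C"
proof -
  have "bounded (F ` {a..b})"
    by (intro compact_imp_bounded compact_continuous_image assms compact_Icc)
  then obtain C where "\<forall>y\<in>F ` {a..b}. norm y \<le> C" unfolding bounded_iff by blast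
  then show thesis using that[of C] by simp
qed

text \<open>Primitives are the functions that are absolutely continuous on compact subintervals of \<open>(0,\<infinity>)\<close>;
  treating the derivative as an integrand avoids derivatives that exist almost everywhere only.\<close>

definition primitive :: "(real \<Rightarrow> real) \<Rightarrow> (real \<Rightarrow> real) \<Rightarrow> bool" where
  "primitive F f \<longleftrightarrow> (\<forall>a b. 0 < a \<longrightarrow> a \<le> b \<longrightarrow>
     integrable (lebesgue_on {a..b}) f \<and> (LINT x|lebesgue_on {a..b}. f x) = F b - F a)"

lemma primitiveD:
  assumes "primitive F f" "0 < a" "a \<le> b"
  shows "integrable (lebesgue_on {a..b}) f" "(LINT x|lebesgue_on {a..b}. f x) = F b - F a"
  using assms unfolding primitive_def by blast+

lemma primitive_continuous:
  assumes "primitive F f"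
  shows "continuous_on {0<..} F"
proof -
  have "continuous (at x) F" if "x > 0" for x
  proof -
    let ?a = "x / 2" let ?b = "2 * x"
    have 1: "continuous_on {?a..?b} (\<lambda>y. LINT t|lebesgue_on {?a..y}. f t)"
      using primitiveD(1)[OF assms, of ?a ?b] that by (intro indefinite_integral_continuous_real) auto
    have "continuous_on {?a..?b} (\<lambda>y. F ?a + (LINT t|lebesgue_on {?a..y}. f t))"
      by (intro continuous_intros 1)
    moreover have "F ?a + (LINT t|lebesgue_on {?a..y}. f t) = F y" if "y \<in> {?a..?b}" for y
      using primitiveD(2)[OF assms, of ?a y] that \<open>x > 0\<close> by auto
    ultimately have "continuous_on {?a..?b} F"
      by (rule continuous_on_eq)
    then show ?thesis using that by (intro continuous_on_interior[of "{?a..?b}"]) auto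
  qed
  then show ?thesis by (simp add: continuous_at_imp_continuous_on)
qed

lemma measurable_lebesgue_on_continuous:
  fixes F :: "real \<Rightarrow> real"
  assumes "continuous_on S F" "S \<in> sets lebesgue"
  shows "F \<in> borel_measurable (lebesgue_on S)"
  using assms by (rule continuous_imp_measurable_on_sets_lebesgue)

lemma primitive_measurable:
  assumes "primitive F f"
  shows "F \<in> borel_measurable halfline"
  by (intro measurable_lebesgue_on_continuous primitive_continuous[OF assms] halfline_sets)

lemma primitive_cong:
  assumes "primitive F f" "\<And>x. x > 0 \<Longrightarrow> F x = G x" "\<And>x. x > 0 \<Longrightarrow> f x = g x"
  shows "primitive G g"
  unfolding primitive_def
proof (intro allI impI)
  fix a b :: real assume ab: "0 < a" "a \<le> b"
  have 1: "integrable (lebesgue_on {a..b}) f = integrable (lebesgue_on {a..b}) g"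
    using ab assms(3) by (intro Bochner_Integration.integrable_cong) auto
  have 2: "(LINT x|lebesgue_on {a..b}. f x) = (LINT x|lebesgue_on {a..b}. g x)"
    using ab assms(3) by (intro Bochner_Integration.integral_cong) auto
  show "integrable (lebesgue_on {a..b}) g \<and> (LINT x|lebesgue_on {a..b}. g x) = G b - G a"
    using primitiveD[OF assms(1) ab] 1 2 ab assms(2) by auto
qed

lemma primitive_add:
  assumes "primitive F f" "primitive G g"
  shows "primitive (\<lambda>x. F x + G x) (\<lambda>x. f x + g x)"
  using assms unfolding primitive_def by simp

lemma primitive_cmult:
  assumes "primitive F f"
  shows "primitive (\<lambda>x. c * F x) (\<lambda>x. c * f x)"
  unfolding primitive_def
proof (intro allI impI)
  fix a b :: real assume "0 < a" "a \<le> b"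
  from primitiveD[OF assms this]
  show "integrable (lebesgue_on {a..b}) (\<lambda>x. c * f x) \<and>
      (LINT x|lebesgue_on {a..b}. c * f x) = c * F b - c * F a"
    by (simp add: right_diff_distrib)
qed

lemma primitive_diff:
  assumes "primitive F f" "primitive G g"
  shows "primitive (\<lambda>x. F x - G x) (\<lambda>x. f x - g x)"
  using primitive_add[OF assms(1) primitive_cmult[OF assms(2), of "-1"]] by simp

lemma primitive_const: "primitive (\<lambda>x. c) (\<lambda>x. 0)"
  unfolding primitive_def by simp

lemma primitive_C1:
  assumes "\<And>x. x > 0 \<Longrightarrow> (F has_real_derivative f x) (at x)" "continuous_on {0<..} f"
  shows "primitive F f"
  unfolding primitive_def
proof (intro allI impI conjI)
  fix a b :: real assume ab: "0 < a" "a \<le> b"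
  have "continuous_on {a..b} f"
    using assms(2) by (rule continuous_on_subset) (use ab in auto)
  then show *: "integrable (lebesgue_on {a..b}) f"
    by (rule continuous_imp_integrable_real)
  have "(f has_integral (F b - F a)) {a..b}"
  proof (rule fundamental_theorem_of_calculus[OF ab(2)])
    fix x assume "x \<in> {a..b}"
    then have "(F has_real_derivative f x) (at x)" using assms(1) ab by simp
    then show "(F has_vector_derivative f x) (at x within {a..b})"
      unfolding has_real_derivative_iff_has_vector_derivative by (rule has_vector_derivative_at_within)
  qed
  then show "(LINT x|lebesgue_on {a..b}. f x) = F b - F a"
    using lebesgue_integral_eq_integral[OF *] by (simp add: integral_unique)
qed

text \<open>Integration by parts comes from integrating \<open>f x g y\<close> over the triangle \<open>y \<le> x\<close> in the two orders.\<close>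

lemma primitive_mult:
  assumes F: "primitive F f" and G: "primitive G g"
  shows "primitive (\<lambda>x. F x * G x) (\<lambda>x. f x * G x + F x * g x)"
  unfolding primitive_def
proof (intro allI impI)
  fix a b :: real assume ab: "0 < a" "a \<le> b"
  let ?M = "lebesgue_on {a..b}"
  interpret M: finite_measure ?M
    by (rule finite_measure_lebesgue_on) simp
  interpret P: pair_sigma_finite ?M ?M ..
  have fi [simp]: "integrable ?M f" and gi [simp]: "integrable ?M g"
    using primitiveD(1)[OF F ab] primitiveD(1)[OF G ab] by auto
  note [measurable] = borel_measurable_integrable[OF fi] borel_measurable_integrable[OF gi]
  have id [measurable]: "(\<lambda>x. x) \<in> borel_measurable ?M"
    by (rule measurable_lebesgue_on_continuous) auto
  have cont: "continuous_on {a..b} F" "continuous_on {a..b} G"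
    using primitive_continuous[OF F] primitive_continuous[OF G] ab
    by (auto elim!: continuous_on_subset)
  then have [measurable]: "F \<in> borel_measurable ?M" "G \<in> borel_measurable ?M"
    by (auto intro!: measurable_lebesgue_on_continuous)
  obtain CF where CF: "\<And>x. x \<in> {a..b} \<Longrightarrow> \<bar>F x\<bar> \<le> CF"
    using continuous_on_Icc_bounded[OF cont(1)] by blast
  obtain CG where CG: "\<And>x. x \<in> {a..b} \<Longrightarrow> \<bar>G x\<bar> \<le> CG"
    using continuous_on_Icc_bounded[OF cont(2)] by blast
  have fG [simp]: "integrable ?M (\<lambda>x. f x * G x)"
    by (rule integrable_mult_bounded(1)[where C = CG]) (use CG in auto)
  have Fg [simp]: "integrable ?M (\<lambda>x. F x * g x)"
    by (rule integrable_mult_bounded(2)[where C = CF]) (use CF in auto)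
  define k where "k = (\<lambda>x y. f x * (g y * indicator {a..x} y))"
  have k_meas: "case_prod k \<in> borel_measurable (?M \<Otimes>\<^sub>M ?M)"
  proof -
    have "(\<lambda>z. f (fst z) * (g (snd z) * (if a \<le> snd z \<and> snd z \<le> fst z then 1 else 0)))
        \<in> borel_measurable (?M \<Otimes>\<^sub>M ?M)" by measurable
    moreover have "case_prod k = (\<lambda>z. f (fst z) * (g (snd z) * (if a \<le> snd z \<and> snd z \<le> fst z then 1 else 0)))"
      by (auto simp: k_def fun_eq_iff)
    ultimately show ?thesis by simp
  qed
  have k_int: "integrable (?M \<Otimes>\<^sub>M ?M) (case_prod k)"
  proof (rule Bochner_Integration.integrable_bound)
    show "integrable (?M \<Otimes>\<^sub>M ?M) (\<lambda>z. f (fst z) * g (snd z))"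
    proof (rule P.Fubini_integrable)
      have "(\<lambda>x. LINT y|?M. norm (f (fst (x, y)) * g (snd (x, y))))
          = (\<lambda>x. \<bar>f x\<bar> * (LINT y|?M. \<bar>g y\<bar>))"
        by (simp add: abs_mult)
      then show "integrable ?M (\<lambda>x. LINT y|?M. norm (f (fst (x, y)) * g (snd (x, y))))"
        by simp
    qed auto
    show "AE z in ?M \<Otimes>\<^sub>M ?M. norm (case_prod k z) \<le> norm (f (fst z) * g (snd z))"
      by (intro AE_I2) (auto simp: k_def indicator_def split: prod.split)
  qed (rule k_meas)
  have in_y: "(LINT y|?M. k x y) = f x * (G x - G a)" if "x \<in> {a..b}" for x
  proof -
    have "(LINT y|?M. g y * indicator {a..x} y) = (LINT y|lebesgue_on {a..x}. g y)"
      using that by (subst lebesgue_on_subset(2)[of "{a..x}" "{a..b}"]) (auto simp: mult.commute)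
    also have "\<dots> = G x - G a" using primitiveD(2)[OF G] ab that by auto
    finally show ?thesis by (simp add: k_def)
  qed
  have in_x: "(LINT x|?M. k x y) = (F b - F y) * g y" if "y \<in> {a..b}" for y
  proof -
    have "(LINT x|?M. k x y) = (LINT x|?M. g y * (indicator {y..b} x * f x))"
      by (intro Bochner_Integration.integral_cong) (use that in \<open>auto simp: k_def indicator_def\<close>)
    also have "\<dots> = g y * (LINT x|?M. indicator {y..b} x * f x)" by simp
    also have "(LINT x|?M. indicator {y..b} x * f x) = (LINT x|lebesgue_on {y..b}. f x)"
      using that by (subst lebesgue_on_subset(2)[of "{y..b}" "{a..b}"]) auto
    also have "\<dots> = F b - F y" using primitiveD(2)[OF F] ab that by auto
    finally show ?thesis by simp
  qed
  have "(LINT y|?M. (F b - F y) * g y) = (LINT y|?M. (LINT x|?M. k x y))"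
    by (intro Bochner_Integration.integral_cong) (use in_x in auto)
  also have "\<dots> = (LINT x|?M. (LINT y|?M. k x y))"
    by (rule P.Fubini_integral[OF k_int])
  also have "\<dots> = (LINT x|?M. f x * (G x - G a))"
    by (intro Bochner_Integration.integral_cong) (use in_y in auto)
  finally have "(LINT y|?M. F b * g y - F y * g y) = (LINT x|?M. f x * G x - f x * G a)"
    by (simp add: algebra_simps)
  then have "F b * (LINT y|?M. g y) - (LINT y|?M. F y * g y) = (LINT x|?M. f x * G x) - (LINT x|?M. f x) * G a"
    by simp
  moreover have "(LINT y|?M. g y) = G b - G a" "(LINT y|?M. f y) = F b - F a"
    using primitiveD(2)[OF F ab] primitiveD(2)[OF G ab] by auto
  ultimately have "(LINT x|?M. f x * G x + F x * g x) = F b * G b - F a * G a"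
    using Bochner_Integration.integral_add[OF fG Fg] by (simp add: algebra_simps del: Bochner_Integration.integral_add)
  then show "integrable ?M (\<lambda>x. f x * G x + F x * g x) \<and>
      (LINT x|?M. f x * G x + F x * g x) = F b * G b - F a * G a"
    by simp
qed

lemma lebesgue_on_Icc_halfline:
  fixes f :: "real \<Rightarrow> real"
  assumes "0 < a"
  shows "integrable (lebesgue_on {a..b}) f \<longleftrightarrow> integrable halfline (\<lambda>x. indicator {a..b} x * f x)"
    and "(LINT x|lebesgue_on {a..b}. f x) = (LINT x|halfline. indicator {a..b} x * f x)"
proof -
  have *: "{a..b} \<in> sets lebesgue" "{a..b} \<subseteq> {0<..}" using assms by auto
  show "integrable (lebesgue_on {a..b}) f \<longleftrightarrow> integrable halfline (\<lambda>x. indicator {a..b} x * f x)"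
    "(LINT x|lebesgue_on {a..b}. f x) = (LINT x|halfline. indicator {a..b} x * f x)"
    using lebesgue_on_subset[OF *(1) halfline_sets *(2)] by blast+
qed

lemma sets_halfline:
  assumes "A \<in> sets lebesgue" "A \<subseteq> {0<..}"
  shows "A \<in> sets halfline"
  using assms by (simp add: sets_restrict_space_iff)

lemma integrable_halfline_Icc:
  fixes f :: "real \<Rightarrow> real"
  assumes "integrable halfline f" "0 < a"
  shows "integrable (lebesgue_on {a..b}) f"
  using assms(2) by (auto intro: integrable_lebesgue_on_subset[OF assms(1) _ halfline_sets])

lemma integral_indicator_tendsto:
  fixes f :: "'a \<Rightarrow> real"
  assumes f: "integrable M f" and A: "\<And>n. A n \<in> sets M"
    and ev: "\<And>x. x \<in> space M \<Longrightarrow> eventually (\<lambda>n. x \<in> A n) sequentially"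
  shows "(\<lambda>n. LINT x|M. indicator (A n) x * f x) \<longlonglongrightarrow> (LINT x|M. f x)"
proof (rule integral_dominated_convergence[where w = "\<lambda>x. \<bar>f x\<bar>"])
  note [measurable] = borel_measurable_integrable[OF f] A
  show "f \<in> borel_measurable M" by measurable
  show "(\<lambda>x. indicator (A n) x * f x) \<in> borel_measurable M" for n by measurable
  show "integrable M (\<lambda>x. \<bar>f x\<bar>)" using f by simp
  show "AE x in M. (\<lambda>n. indicator (A n) x * f x) \<longlonglongrightarrow> f x"
  proof (rule AE_I2)
    fix x assume "x \<in> space M"
    then have "eventually (\<lambda>n. x \<in> A n) sequentially" by (rule ev)
    then have "eventually (\<lambda>n. indicator (A n) x * f x = f x) sequentially"
      by eventually_elim simp
    then show "(\<lambda>n. indicator (A n) x * f x) \<longlonglongrightarrow> f x" by (rule tendsto_eventually)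
  qed
  show "AE x in M. norm (indicator (A n) x * f x) \<le> \<bar>f x\<bar>" for n
    by (intro AE_I2) (simp add: indicator_def abs_mult)
qed

lemma integral_primitive_halfline:
  assumes W: "primitive W w" and w: "integrable halfline w"
    and l0: "(W \<longlongrightarrow> l0) (at_right 0)" and l1: "(W \<longlongrightarrow> l1) at_top"
  shows "(LINT x|halfline. w x) = l1 - l0"
proof -
  let ?a = "\<lambda>n. 1 / real (Suc n)" let ?b = "\<lambda>n. real (Suc n)"
  have a: "filterlim ?a (at_right 0) sequentially"
    unfolding filterlim_at using LIMSEQ_inverse_real_of_nat
    by (auto simp: inverse_eq_divide)
  have b: "filterlim ?b at_top sequentially"
    using filterlim_real_sequentially filterlim_sequentially_Suc by blast
  have "(\<lambda>n. LINT x|halfline. indicator {?a n..?b n} x * w x) \<longlonglongrightarrow> (LINT x|halfline. w x)"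
  proof (rule integral_indicator_tendsto[OF w])
    show "{?a n..?b n} \<in> sets halfline" for n
      by (intro sets_halfline) (auto intro: less_le_trans[OF of_nat_0_less_iff[THEN iffD2]] less_le_trans[rotated])
    fix x :: real assume "x \<in> space halfline"
    then have x: "x > 0" by simp
    have "eventually (\<lambda>n. ?a n < x) sequentially"
      using a x unfolding filterlim_at by (auto intro: order_tendstoD)
    moreover have "eventually (\<lambda>n. x \<le> ?b n) sequentially"
      using b unfolding filterlim_at_top by blast
    ultimately show "eventually (\<lambda>n. x \<in> {?a n..?b n}) sequentially"
      by eventually_elim auto
  qed
  moreover have "(LINT x|halfline. indicator {?a n..?b n} x * w x) = W (?b n) - W (?a n)" for n
    using primitiveD(2)[OF W, of "?a n" "?b n"] lebesgue_on_Icc_halfline(2)[of "?a n" "?b n" w]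
    by (simp add: field_simps)
  ultimately have "(\<lambda>n. W (?b n) - W (?a n)) \<longlonglongrightarrow> (LINT x|halfline. w x)" by simp
  moreover have "(\<lambda>n. W (?b n) - W (?a n)) \<longlonglongrightarrow> l1 - l0"
    by (intro tendsto_diff filterlim_compose[OF l1 b] filterlim_compose[OF l0 a])
  ultimately show ?thesis by (rule LIMSEQ_unique)
qed

lemma log_lower_bound:
  assumes g: "integrable halfline g" and ab: "0 < a" "a \<le> b"
    and le: "\<And>x. a \<le> x \<Longrightarrow> x \<le> b \<Longrightarrow> c / x \<le> \<bar>g x\<bar>"
  shows "c * (ln b - ln a) \<le> (LINT x|halfline. \<bar>g x\<bar>)"
proof -
  have P: "primitive (\<lambda>x. c * ln x) (\<lambda>x. c * (1 / x))"
    by (intro primitive_cmult primitive_C1) (auto intro!: derivative_eq_intros continuous_intros)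
  have gi: "integrable (lebesgue_on {a..b}) (\<lambda>x. \<bar>g x\<bar>)"
    using integrable_halfline_Icc[OF g ab(1)] by simp
  have "c * (ln b - ln a) = (LINT x|lebesgue_on {a..b}. c * (1 / x))"
    using primitiveD(2)[OF P ab] by (simp add: algebra_simps)
  also have "\<dots> \<le> (LINT x|lebesgue_on {a..b}. \<bar>g x\<bar>)"
    using le by (intro integral_mono primitiveD(1)[OF P ab] gi) auto
  also have "\<dots> = (LINT x|halfline. indicator {a..b} x * \<bar>g x\<bar>)"
    using ab by (rule_tac lebesgue_on_Icc_halfline(2))
  also have "\<dots> \<le> (LINT x|halfline. \<bar>g x\<bar>)"
  proof (rule integral_mono)
    show "integrable halfline (\<lambda>x. indicator {a..b} x * \<bar>g x\<bar>)"
      by (rule lebesgue_on_Icc_halfline(1)[OF ab(1), THEN iffD1, OF gi])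
  qed (use g in \<open>auto simp: indicator_def\<close>)
  finally show ?thesis .
qed

lemma primitive_integral_tendsto:
  assumes W: "primitive W w" and w: "integrable halfline w"
  obtains l0 l1 where "(W \<longlongrightarrow> l0) (at_right 0)" "(W \<longlongrightarrow> l1) at_top"
proof -
  have S: "{1..} \<in> sets halfline" "{0<..1} \<in> sets halfline"
    by (auto intro!: sets_halfline)
  have i: "integrable halfline (\<lambda>x. indicator A x * w x)" if "A \<in> sets halfline" for A
    using integrable_mult_indicator[OF that w] by simp
  have piece: "(LINT x|halfline. indicator {a..b} x * w x) = W b - W a" if "0 < a" "a \<le> b" for a b
    using primitiveD(2)[OF W that] lebesgue_on_Icc_halfline(2)[OF that(1), of b w] by simp
  have "(W \<longlongrightarrow> W 1 + (LINT x|halfline. indicator {1..} x * w x)) at_top"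
  proof (rule tendsto_at_topI_sequentially)
    fix X :: "nat \<Rightarrow> real" assume X: "filterlim X at_top sequentially"
    have "(\<lambda>n. LINT x|halfline. indicator {0<..X n} x * (indicator {1..} x * w x)) \<longlonglongrightarrow>
        (LINT x|halfline. indicator {1..} x * w x)"
    proof (rule integral_indicator_tendsto[OF i[OF S(1)]])
      show "{0<..X n} \<in> sets halfline" for n by (intro sets_halfline) auto
      fix x :: real assume "x \<in> space halfline"
      moreover have "eventually (\<lambda>n. x \<le> X n) sequentially"
        using X unfolding filterlim_at_top by blast
      ultimately show "eventually (\<lambda>n. x \<in> {0<..X n}) sequentially" by simp
    qed
    then have "(\<lambda>n. W 1 + (LINT x|halfline. indicator {0<..X n} x * (indicator {1..} x * w x))) \<longlonglongrightarrow>
        W 1 + (LINT x|halfline. indicator {1..} x * w x)" by (intro tendsto_intros)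
    moreover have "eventually (\<lambda>n. W 1 + (LINT x|halfline. indicator {0<..X n} x * (indicator {1..} x * w x)) = W (X n)) sequentially"
    proof -
      have "eventually (\<lambda>n. 1 \<le> X n) sequentially" using X unfolding filterlim_at_top by blast
      then show ?thesis
      proof eventually_elim
        case (elim n)
        have "(\<lambda>x. indicator {0<..X n} x * (indicator {1..} x * w x)) = (\<lambda>x. indicator {1..X n} x * w x)"
          by (auto simp: indicator_def)
        then show ?case using piece[of 1 "X n"] elim by simp
      qed
    qed
    ultimately show "(\<lambda>n. W (X n)) \<longlonglongrightarrow> W 1 + (LINT x|halfline. indicator {1..} x * w x)"
      by (rule Lim_transform_eventually)
  qed
  moreover have "(W \<longlongrightarrow> W 1 - (LINT x|halfline. indicator {0<..1} x * w x)) (at_right 0)"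
  proof (rule tendsto_at_right_sequentially[of 0 1])
    fix X :: "nat \<Rightarrow> real"
    assume X0: "\<And>n. 0 < X n" "\<And>n. X n < 1" and X: "X \<longlonglongrightarrow> 0"
    have "(\<lambda>n. LINT x|halfline. indicator {X n..} x * (indicator {0<..1} x * w x)) \<longlonglongrightarrow>
        (LINT x|halfline. indicator {0<..1} x * w x)"
    proof (rule integral_indicator_tendsto[OF i[OF S(2)]])
      show "{X n..} \<in> sets halfline" for n using X0(1)[of n] by (intro sets_halfline) auto
      fix x :: real assume "x \<in> space halfline"
      then have "eventually (\<lambda>n. X n < x) sequentially"
        using X by (auto intro: order_tendstoD)
      then show "eventually (\<lambda>n. x \<in> {X n..}) sequentially" by eventually_elim simp
    qed
    then have "(\<lambda>n. W 1 - (LINT x|halfline. indicator {X n..} x * (indicator {0<..1} x * w x))) \<longlonglongrightarrow>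
        W 1 - (LINT x|halfline. indicator {0<..1} x * w x)" by (intro tendsto_intros)
    moreover have "W 1 - (LINT x|halfline. indicator {X n..} x * (indicator {0<..1} x * w x)) = W (X n)" for n
    proof -
      have "(\<lambda>x. indicator {X n..} x * (indicator {0<..1} x * w x)) = (\<lambda>x. indicator {X n..1} x * w x)"
        using X0(1)[of n] by (auto simp: indicator_def fun_eq_iff)
      then show ?thesis using piece[of "X n" 1] X0[of n] by simp
    qed
    ultimately show "(\<lambda>n. W (X n)) \<longlonglongrightarrow> W 1 - (LINT x|halfline. indicator {0<..1} x * w x)"
      by simp
  qed simp
  ultimately show thesis using that by blast
qed

text \<open>Neither end of \<open>(0,\<infinity>)\<close> can carry a nonzero limit of \<open>W\<close> when \<open>W(x)/x\<close> is integrable there,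
  since \<open>1/x\<close> is not.\<close>

lemma primitive_tendsto_0_at_right:
  assumes W: "primitive W w" and w: "integrable halfline w" and g: "integrable halfline g"
    and le: "\<And>x. 0 < x \<Longrightarrow> x \<le> 1 \<Longrightarrow> \<bar>W x\<bar> \<le> x * \<bar>g x\<bar>"
  shows "(W \<longlongrightarrow> 0) (at_right 0)"
proof -
  obtain l where l: "(W \<longlongrightarrow> l) (at_right 0)"
    using primitive_integral_tendsto[OF W w] by blast
  have "l = 0"
  proof (rule ccontr)
    assume "l \<noteq> 0"
    define c where "c = \<bar>l\<bar> / 2"
    have c: "c > 0" "c < \<bar>l\<bar>" using \<open>l \<noteq> 0\<close> by (auto simp: c_def)
    have "eventually (\<lambda>x. c < \<bar>W x\<bar>) (at_right 0)"
      using tendsto_rabs[OF l] c(2) by (rule order_tendstoD)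
    then obtain d where d: "d > 0" "\<And>x. 0 < x \<Longrightarrow> x < d \<Longrightarrow> c < \<bar>W x\<bar>"
      unfolding eventually_at_right[OF zero_less_one] by blast
    \<comment> \<open>Where \<open>\<bar>W\<bar> > c\<close> one has \<open>\<bar>g\<bar> \<ge> c/x\<close>; the point \<open>a\<close> makes the integral of \<open>c/x\<close> over \<open>[a,b]\<close> larger than \<open>K\<close>.\<close>
    define b where "b = min 1 (d / 2)"
    have b: "0 < b" "b \<le> 1" "b < d" using d(1) by (auto simp: b_def)
    define K where "K = (LINT x|halfline. \<bar>g x\<bar>)"
    have "K \<ge> 0" by (simp add: K_def)
    define a where "a = b * exp (- (K + 1) / c)"
    have "- (K + 1) / c \<le> 0" using c \<open>K \<ge> 0\<close> by (intro divide_nonpos_pos) auto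
    then have a: "0 < a" "a \<le> b" using b unfolding a_def by (simp, simp only: mult_le_cancel_left2 exp_le_one_iff) simp
    have "c * (ln b - ln a) \<le> K"
      unfolding K_def
    proof (rule log_lower_bound[OF g a])
      fix x assume x: "a \<le> x" "x \<le> b"
      then have "c < \<bar>W x\<bar>" "\<bar>W x\<bar> \<le> x * \<bar>g x\<bar>" using a b d(2)[of x] le[of x] by auto
      then have "c \<le> \<bar>g x\<bar> * x" by (simp add: mult.commute)
      then show "c / x \<le> \<bar>g x\<bar>" using x a by (simp add: pos_divide_le_eq)
    qed
    moreover have "c * (ln b - ln a) = K + 1" using b c by (simp add: a_def ln_mult)
    ultimately show False by simp
  qed
  then show ?thesis using l by simp
qed

lemma primitive_tendsto_0_at_top:
  assumes W: "primitive W w" and w: "integrable halfline w" and g: "integrable halfline g"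
    and le: "\<And>x. 1 \<le> x \<Longrightarrow> \<bar>W x\<bar> \<le> x * \<bar>g x\<bar>"
  shows "(W \<longlongrightarrow> 0) at_top"
proof -
  obtain l where l: "(W \<longlongrightarrow> l) at_top"
    using primitive_integral_tendsto[OF W w] by blast
  have "l = 0"
  proof (rule ccontr)
    assume "l \<noteq> 0"
    define c where "c = \<bar>l\<bar> / 2"
    have c: "c > 0" "c < \<bar>l\<bar>" using \<open>l \<noteq> 0\<close> by (auto simp: c_def)
    have "eventually (\<lambda>x. c < \<bar>W x\<bar>) at_top"
      using tendsto_rabs[OF l] c(2) by (rule order_tendstoD)
    then obtain d where d: "\<And>x. d \<le> x \<Longrightarrow> c < \<bar>W x\<bar>"
      unfolding eventually_at_top_linorder by blast
    define a where "a = max 1 d"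
    have a: "0 < a" "1 \<le> a" "d \<le> a" by (auto simp: a_def)
    define K where "K = (LINT x|halfline. \<bar>g x\<bar>)"
    have "K \<ge> 0" by (simp add: K_def)
    define b where "b = a * exp ((K + 1) / c)"
    have "0 \<le> (K + 1) / c" using c \<open>K \<ge> 0\<close> by (intro divide_nonneg_pos) auto
    then have b: "a \<le> b" using a unfolding b_def by (simp only: mult_le_cancel_left1 one_le_exp_iff) simp
    have "c * (ln b - ln a) \<le> K"
      unfolding K_def
    proof (rule log_lower_bound[OF g a(1) b])
      fix x assume x: "a \<le> x" "x \<le> b"
      then have "c < \<bar>W x\<bar>" "\<bar>W x\<bar> \<le> x * \<bar>g x\<bar>" using a d[of x] le[of x] by auto
      then have "c \<le> \<bar>g x\<bar> * x" by (simp add: mult.commute)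
      then show "c / x \<le> \<bar>g x\<bar>" using x a by (simp add: pos_divide_le_eq)
    qed
    moreover have "c * (ln b - ln a) = K + 1" using a c by (simp add: b_def ln_mult)
    ultimately show False by simp
  qed
  then show ?thesis using l by simp
qed

lemma integral_primitive_eq_0:
  assumes W: "primitive W w" and w: "integrable halfline w"
    and Wx: "integrable halfline (\<lambda>x. W x / x)"
  shows "(LINT x|halfline. w x) = 0"
proof -
  have le: "\<bar>W x\<bar> \<le> x * \<bar>W x / x\<bar>" if "x > 0" for x using that by simp
  have "(W \<longlongrightarrow> 0) (at_right 0)"
    by (rule primitive_tendsto_0_at_right[OF W w Wx]) (rule le)
  moreover have "(W \<longlongrightarrow> 0) at_top"
  proof (rule primitive_tendsto_0_at_top[OF W w Wx])
    fix x :: real assume "1 \<le> x"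
    then show "\<bar>W x\<bar> \<le> x * \<bar>W x / x\<bar>" by (intro le) simp
  qed
  ultimately show ?thesis
    using integral_primitive_halfline[OF W w] by fastforce
qed

lemma integral_primitive_eq_0_trace:
  assumes W: "primitive W w" and w: "integrable halfline w"
    and Wi: "integrable halfline W" and W0: "(W \<longlongrightarrow> 0) (at_right 0)"
  shows "(LINT x|halfline. w x) = 0"
proof -
  have "(W \<longlongrightarrow> 0) at_top"
  proof (rule primitive_tendsto_0_at_top[OF W w Wi])
    fix x :: real assume "1 \<le> x"
    then show "\<bar>W x\<bar> \<le> x * \<bar>W x\<bar>"
      using mult_right_mono[of 1 x "\<bar>W x\<bar>"] by simp
  qed
  then show ?thesis
    using integral_primitive_halfline[OF W w W0] by fastforce
qed

text \<open>The positive and the negative part of \<open>f\<close> on \<open>[c,d]\<close> are densities of two finite measures that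
  agree on all half lines \<open>(t,\<infinity>)\<close> and are therefore equal.\<close>

lemma AE_eq_0_if_integrals_eq_0:
  assumes int: "\<And>a b. 0 < a \<Longrightarrow> a \<le> b \<Longrightarrow> integrable (lebesgue_on {a..b}) f"
    and zero: "\<And>a b. 0 < a \<Longrightarrow> a \<le> b \<Longrightarrow> (LINT x|lebesgue_on {a..b}. f x) = 0"
  shows "AE x in halfline. f x = (0::real)"
proof -
  have piece: "AE x in lebesgue. x \<in> {c..d} \<longrightarrow> f x = 0" if cd: "0 < c" "c \<le> d" for c d
  proof -
    define h where "h = (\<lambda>x. indicator {c..d} x * f x)"
    have hi: "integrable lebesgue h"
      using int[OF cd] by (simp add: h_def integrable_restrict_space)
    obtain g where g [measurable]: "g \<in> borel_measurable lborel" and hg: "AE x in lborel. h x = g x"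
      using completion_ex_borel_measurable_real[OF borel_measurable_integrable[OF hi]] by blast
    have hg': "AE x in lebesgue. h x = g x" using hg by (rule AE_completion)
    have gi: "integrable lborel g"
    proof -
      have "integrable lebesgue g"
        using g by (intro integrable_cong_AE_imp[OF hi _ hg'] measurable_completion)
      then show ?thesis using g by (simp add: integrable_completion)
    qed
    have zero': "(LINT x|lborel. indicator {t<..} x * g x) = 0" for t
    proof -
      have "(LINT x|lborel. indicator {t<..} x * g x) = (LINT x|lebesgue. indicator {t<..} x * g x)"
        by (rule integral_completion[symmetric]) simp
      also have "\<dots> = (LINT x|lebesgue. indicator {max t c..d} x * f x)"
      proof (rule integral_cong_AE)
        have "AE x in lebesgue. x \<noteq> t" by (intro AE_completion AE_lborel_singleton)
        then show "AE x in lebesgue. indicator {t<..} x * g x = indicator {max t c..d} x * f x"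
          using hg' by eventually_elim (auto simp: h_def indicator_def split: if_splits)
        have eq: "(\<lambda>x. indicator {max t c..d} x * f x) = (\<lambda>x. indicator {max t c..d} x * h x)"
          by (auto simp: h_def indicator_def)
        show "(\<lambda>x. indicator {max t c..d} x * f x) \<in> borel_measurable lebesgue"
          unfolding eq by (intro borel_measurable_times borel_measurable_indicator
              borel_measurable_integrable[OF hi]) auto
        show "(\<lambda>x. indicator {t<..} x * g x) \<in> borel_measurable lebesgue"
          by (intro measurable_completion) simp
      qed
      also have "\<dots> = 0"
      proof (cases "max t c \<le> d")
        case True
        have "(LINT x|lebesgue. indicator {max t c..d} x * f x) = (LINT x|lebesgue_on {max t c..d}. f x)"
          by (simp add: integral_restrict_space)
        then show ?thesis using zero[of "max t c" d] True cd by simp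
      next
        case False
        then show ?thesis by simp
      qed
      finally show ?thesis .
    qed
    let ?M = "density lborel (\<lambda>x. ennreal (g x))" and ?N = "density lborel (\<lambda>x. ennreal (- g x))"
    have fin: "(\<integral>\<^sup>+x. ennreal (s * g x) \<partial>lborel) < \<infinity>" if "s = 1 \<or> s = -1" for s
    proof -
      have "(\<integral>\<^sup>+x. ennreal (s * g x) \<partial>lborel) \<le> (\<integral>\<^sup>+x. ennreal (norm (g x)) \<partial>lborel)"
        using that by (intro nn_integral_mono ennreal_leI) auto
      also have "\<dots> < \<infinity>" using gi unfolding integrable_iff_bounded by blast
      finally show ?thesis .
    qed
    have em: "emeasure (density lborel (\<lambda>x. ennreal (s * g x))) {t<..}
        = ennreal (LINT x|lborel. max 0 (s * (indicator {t<..} x * g x)))" for t s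
    proof -
      have "emeasure (density lborel (\<lambda>x. ennreal (s * g x))) {t<..}
          = (\<integral>\<^sup>+x. ennreal (s * g x) * indicator {t<..} x \<partial>lborel)"
        by (rule emeasure_density) auto
      also have "\<dots> = (\<integral>\<^sup>+x. ennreal (max 0 (s * (indicator {t<..} x * g x))) \<partial>lborel)"
        by (intro nn_integral_cong) (auto simp: indicator_def max_def ennreal_neg)
      also have "\<dots> = ennreal (LINT x|lborel. max 0 (s * (indicator {t<..} x * g x)))"
      proof (rule nn_integral_eq_integral)
        have "integrable lborel (\<lambda>x. indicator {t<..} x * g x)"
          using integrable_mult_indicator[OF _ gi, of "{t<..}"] by simp
        then show "integrable lborel (\<lambda>x. max 0 (s * (indicator {t<..} x * g x)))" by simp
      qed auto
      finally show ?thesis .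
    qed
    have "?M = ?N"
    proof (rule measure_eqI_lessThan)
      fix t :: real
      have i: "integrable lborel (\<lambda>x. indicator {t<..} x * g x)"
        using integrable_mult_indicator[OF _ gi, of "{t<..}"] by simp
      show "emeasure ?M {t<..} < \<infinity>" using em[of 1 t] by simp
      have "(LINT x|lborel. max 0 (indicator {t<..} x * g x)) - (LINT x|lborel. max 0 (- (indicator {t<..} x * g x)))
          = (LINT x|lborel. max 0 (indicator {t<..} x * g x) - max 0 (- (indicator {t<..} x * g x)))"
        using i by (intro Bochner_Integration.integral_diff[symmetric]) simp_all
      also have "\<dots> = (LINT x|lborel. indicator {t<..} x * g x)"
        by (intro Bochner_Integration.integral_cong) auto
      finally have "(LINT x|lborel. max 0 (indicator {t<..} x * g x)) = (LINT x|lborel. max 0 (- (indicator {t<..} x * g x)))"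
        using zero'[of t] by simp
      then show "emeasure ?M {t<..} = emeasure ?N {t<..}" using em[of 1 t] em[of "-1" t] by simp
    qed auto
    then have "AE x in lborel. ennreal (g x) = ennreal (- g x)"
      by (subst (asm) sigma_finite_measure.density_unique_iff[OF sigma_finite_lborel]) auto
    then have "AE x in lborel. g x = 0"
    proof eventually_elim
      case (elim x)
      then show ?case
        by (cases "g x \<le> 0") (auto simp: ennreal_neg ennreal_eq_0_iff dest: sym)
    qed
    then have "AE x in lebesgue. g x = 0" by (rule AE_completion)
    then show ?thesis
      using hg' by eventually_elim (auto simp: h_def)
  qed
  have "AE x in lebesgue. \<forall>n::nat. x \<in> {1 / real (Suc n)..real (Suc n)} \<longrightarrow> f x = 0"
    unfolding AE_all_countable by (intro allI piece) (auto simp: field_simps)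
  then have "AE x in lebesgue. x \<in> {0<..} \<longrightarrow> f x = 0"
  proof eventually_elim
    case (elim x)
    show ?case
    proof
      assume "x \<in> {0<..}"
      then have x: "x > 0" by simp
      obtain n where n: "real n > max x (1 / x)" using reals_Archimedean2 by blast
      have "x \<le> real (Suc n)" "1 / x < real (Suc n)" using n by auto
      moreover have "1 / real (Suc n) \<le> x"
      proof -
        have "1 < real (Suc n) * x" using \<open>1 / x < real (Suc n)\<close> x by (simp add: pos_divide_less_eq)
        then have "1 \<le> x * real (Suc n)" by (simp only: mult.commute less_imp_le)
        then show ?thesis by (simp add: pos_divide_le_eq del: of_nat_Suc)
      qed
      ultimately show "f x = 0" using elim by auto
    qed
  qed
  then show ?thesis by (simp add: AE_restrict_space_iff)
qed

section \<open>Smooth functions and test functions\<close>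

text \<open>The recursion passes to the derivative, as an induction for sums and products requires.\<close>

primrec n_times_differentiable :: "nat \<Rightarrow> (real \<Rightarrow> real) \<Rightarrow> bool" where
  "n_times_differentiable 0 f \<longleftrightarrow> True"
| "n_times_differentiable (Suc n) f \<longleftrightarrow>
     (\<exists>f'. (\<forall>x. (f has_real_derivative f' x) (at x)) \<and> n_times_differentiable n f')"

definition smooth :: "(real \<Rightarrow> real) \<Rightarrow> bool" where
  "smooth f \<longleftrightarrow> (\<forall>n. n_times_differentiable n f)"

lemma n_times_differentiable_iff:
  "n_times_differentiable n f \<longleftrightarrow> (\<forall>k<n. (deriv ^^ k) f differentiable_on UNIV)"
proof (induction n arbitrary: f)
  case (Suc n)
  have "n_times_differentiable (Suc n) f \<longleftrightarrow>
      f differentiable_on UNIV \<and> n_times_differentiable n (deriv f)"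
  proof
    assume "n_times_differentiable (Suc n) f"
    then obtain f' where f': "\<And>x. (f has_real_derivative f' x) (at x)" "n_times_differentiable n f'"
      by auto
    have "deriv f = f'" using f'(1) by (auto intro!: DERIV_imp_deriv)
    moreover have "f differentiable_on UNIV"
      using f'(1) unfolding differentiable_on_def by (auto simp: real_differentiable_def)
    ultimately show "f differentiable_on UNIV \<and> n_times_differentiable n (deriv f)"
      using f'(2) by simp
  next
    assume *: "f differentiable_on UNIV \<and> n_times_differentiable n (deriv f)"
    have "(f has_real_derivative deriv f x) (at x)" for x
    proof -
      have "f differentiable (at x)" using * unfolding differentiable_on_def by simp
      then obtain D where "(f has_real_derivative D) (at x)" unfolding real_differentiable_def by blast
      then show ?thesis using DERIV_imp_deriv by metis
    qed
    then show "n_times_differentiable (Suc n) f" using * by auto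
  qed
  also have "\<dots> \<longleftrightarrow> (deriv ^^ 0) f differentiable_on UNIV \<and>
      (\<forall>k<n. (deriv ^^ Suc k) f differentiable_on UNIV)"
    using Suc.IH[of "deriv f"] by (simp add: funpow_swap1)
  also have "\<dots> \<longleftrightarrow> (\<forall>k<Suc n. (deriv ^^ k) f differentiable_on UNIV)"
    unfolding All_less_Suc2 ..
  finally show ?case .
qed simp

lemma smooth_iff: "smooth f \<longleftrightarrow> (\<forall>k. (deriv ^^ k) f differentiable_on UNIV)"
  unfolding smooth_def n_times_differentiable_iff by blast

lemma test_function_iff:
  "test_function \<phi> \<longleftrightarrow> smooth \<phi> \<and> (\<exists>a b. 0 < a \<and> (\<forall>x. x \<notin> {a..b} \<longrightarrow> \<phi> x = 0))"
  unfolding test_function_def smooth_iff ..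

lemma n_times_differentiable_Suc_imp:
  "n_times_differentiable (Suc n) f \<Longrightarrow> n_times_differentiable n f"
  unfolding n_times_differentiable_iff by auto

lemma smooth_deriv:
  assumes "smooth f"
  shows "(f has_real_derivative deriv f x) (at x)" "smooth (deriv f)"
proof -
  have "n_times_differentiable 1 f" using assms unfolding smooth_def by blast
  then obtain f' where f': "\<And>x. (f has_real_derivative f' x) (at x)" by auto
  then have "deriv f = f'" by (auto intro!: DERIV_imp_deriv)
  then show "(f has_real_derivative deriv f x) (at x)" using f' by simp
  show "smooth (deriv f)" unfolding smooth_iff
  proof
    fix k
    have "(deriv ^^ Suc k) f differentiable_on UNIV" using assms unfolding smooth_iff by blast
    then show "(deriv ^^ k) (deriv f) differentiable_on UNIV" by (simp add: funpow_swap1)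
  qed
qed

lemma smooth_continuous: "smooth f \<Longrightarrow> continuous_on S f"
  using smooth_deriv(1) by (meson DERIV_isCont continuous_at_imp_continuous_on)

lemma smooth_derivI:
  assumes "\<And>x. (f has_real_derivative f' x) (at x)" "smooth f'"
  shows "smooth f"
  unfolding smooth_def
proof
  fix n show "n_times_differentiable n f"
    using assms unfolding smooth_def by (cases n) auto
qed

text \<open>Applied to families indexed by polynomials, where differentiation changes the polynomial only.\<close>

lemma smooth_family:
  assumes "\<And>i. i \<in> I \<Longrightarrow> \<exists>j\<in>I. \<forall>x. (F i has_real_derivative F j x) (at x)" "i \<in> I"
  shows "smooth (F i)"
proof -
  have "\<forall>i\<in>I. n_times_differentiable n (F i)" for n
  proof (induction n)
    case (Suc n)
    show ?case
    proof
      fix i assume "i \<in> I"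
      then obtain j where "j \<in> I" "\<forall>x. (F i has_real_derivative F j x) (at x)" using assms(1) by blast
      then show "n_times_differentiable (Suc n) (F i)" using Suc by auto
    qed
  qed simp
  then show ?thesis using assms(2) unfolding smooth_def by blast
qed

lemma n_times_differentiable_add:
  "n_times_differentiable n f \<Longrightarrow> n_times_differentiable n g \<Longrightarrow> n_times_differentiable n (\<lambda>x. f x + g x)"
proof (induction n arbitrary: f g)
  case (Suc n)
  then obtain f' g' where "\<forall>x. (f has_real_derivative f' x) (at x)" "n_times_differentiable n f'"
    "\<forall>x. (g has_real_derivative g' x) (at x)" "n_times_differentiable n g'" by auto
  then show ?case
    using Suc.IH[of f' g'] by (auto intro!: exI[of _ "\<lambda>x. f' x + g' x"] DERIV_add)
qed simp

lemma n_times_differentiable_mult: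
  "n_times_differentiable n f \<Longrightarrow> n_times_differentiable n g \<Longrightarrow> n_times_differentiable n (\<lambda>x. f x * g x)"
proof (induction n arbitrary: f g)
  case (Suc n)
  note lower = Suc.prems[THEN n_times_differentiable_Suc_imp]
  obtain f' g' where *: "\<forall>x. (f has_real_derivative f' x) (at x)" "n_times_differentiable n f'"
    "\<forall>x. (g has_real_derivative g' x) (at x)" "n_times_differentiable n g'" using Suc.prems by auto
  have "n_times_differentiable n (\<lambda>x. f' x * g x + g' x * f x)"
    by (intro n_times_differentiable_add Suc.IH * lower)
  then show ?case using *(1,3) by (auto intro!: exI[of _ "\<lambda>x. f' x * g x + g' x * f x"] DERIV_mult)
qed simp

lemma smooth_add: "smooth f \<Longrightarrow> smooth g \<Longrightarrow> smooth (\<lambda>x. f x + g x)"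
  and smooth_mult: "smooth f \<Longrightarrow> smooth g \<Longrightarrow> smooth (\<lambda>x. f x * g x)"
  by (auto simp: smooth_def n_times_differentiable_add n_times_differentiable_mult)

lemma smooth_const: "smooth (\<lambda>x. c)"
proof (rule smooth_family[where I = UNIV and F = "\<lambda>c x. c", OF _ UNIV_I])
  fix c :: real
  have "\<forall>x. ((\<lambda>x. c) has_real_derivative 0) (at x)" by simp
  then show "\<exists>d\<in>UNIV. \<forall>x. ((\<lambda>x. c) has_real_derivative d) (at x)" by blast
qed

lemma smooth_affine:
  assumes "smooth f"
  shows "smooth (\<lambda>x. f (c * x + d))"
proof -
  have "n_times_differentiable n f \<Longrightarrow> n_times_differentiable n (\<lambda>x. f (c * x + d))" for n
  proof (induction n arbitrary: f)
    case (Suc n)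
    then obtain f' where *: "\<And>x. (f has_real_derivative f' x) (at x)" "n_times_differentiable n f'" by auto
    have "((\<lambda>x. f (c * x + d)) has_real_derivative c * f' (c * x + d)) (at x)" for x
      by (rule DERIV_cong[OF DERIV_chain2[OF *(1)]]) (auto intro!: derivative_eq_intros)
    moreover have "n_times_differentiable n (\<lambda>x. c * f' (c * x + d))"
      using n_times_differentiable_mult[OF _ Suc.IH[OF *(2)]] smooth_const unfolding smooth_def by blast
    ultimately show ?case unfolding n_times_differentiable.simps
      by (intro exI[of _ "\<lambda>x. c * f' (c * x + d)"]) simp
  qed simp
  then show ?thesis using assms unfolding smooth_def by blast
qed

lemma smooth_exp_poly: "smooth (\<lambda>x. exp (- b * x) * poly p x)"
proof (rule smooth_family[where I = UNIV and F = "\<lambda>p x. exp (- b * x) * poly p x", OF _ UNIV_I])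
  fix p :: "real poly"
  have "((\<lambda>x. exp (- b * x) * poly p x) has_real_derivative
      exp (- b * x) * poly (pderiv p - smult b p) x) (at x)" for x
    by (auto intro!: derivative_eq_intros poly_DERIV simp: algebra_simps)
  then show "\<exists>q\<in>UNIV. \<forall>x. ((\<lambda>x. exp (- b * x) * poly p x) has_real_derivative exp (- b * x) * poly q x) (at x)"
    by blast
qed

text \<open>Functions that vanish to infinite order at \<open>0\<close>. Allowing a polynomial in \<open>1/x\<close> as a factor makes the
  family closed under differentiation.\<close>

definition flat_poly :: "real poly \<Rightarrow> real \<Rightarrow> real" where
  "flat_poly p x = (if x > 0 then poly p (1 / x) * exp (- (1 / x)) else 0)"

lemma poly_times_exp_tendsto_0: "((\<lambda>y. poly p y * exp (- y)) \<longlongrightarrow> (0::real)) at_top"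
proof -
  have "((\<lambda>y. \<Sum>i\<le>degree p. coeff p i * (y ^ i / exp y)) \<longlongrightarrow> (0::real)) at_top"
    by (intro tendsto_null_sum tendsto_mult_right_zero tendsto_power_div_exp_0)
  then show ?thesis
    by (simp add: poly_altdef sum_distrib_right exp_minus divide_inverse mult.assoc)
qed

lemma flat_poly_tendsto_0: "((\<lambda>x. poly p (1 / x) * exp (- (1 / x))) \<longlongrightarrow> 0) (at_right (0::real))"
  using filterlim_compose[OF poly_times_exp_tendsto_0[of p] filterlim_inverse_at_top_right]
  by (simp add: inverse_eq_divide)

lemma flat_poly_deriv:
  "(flat_poly p has_real_derivative flat_poly ([:0, 0, 1:] * (p - pderiv p)) x) (at x)"
proof -
  consider "x > 0" | "x < 0" | "x = 0" by linarith
  then show ?thesis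
  proof cases
    case 1
    have "((\<lambda>x. poly p (1 / x) * exp (- (1 / x))) has_real_derivative
        poly ([:0, 0, 1:] * (p - pderiv p)) (1 / x) * exp (- (1 / x))) (at x)"
      using 1 by (auto intro!: derivative_eq_intros DERIV_chain2[OF poly_DERIV] simp: field_simps power2_eq_square)
    then have "(flat_poly p has_real_derivative
        poly ([:0, 0, 1:] * (p - pderiv p)) (1 / x) * exp (- (1 / x))) (at x)"
      by (rule has_field_derivative_transform_within_open[of _ _ _ "{0<..}"])
        (use 1 in \<open>auto simp: flat_poly_def\<close>)
    then show ?thesis using 1 by (simp add: flat_poly_def)
  next
    case 2
    have "((\<lambda>x. 0) has_real_derivative 0) (at x)" by simp
    then have "(flat_poly p has_real_derivative 0) (at x)"
      by (rule has_field_derivative_transform_within_open[of _ _ _ "{..<0}"])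
        (use 2 in \<open>auto simp: flat_poly_def\<close>)
    then show ?thesis using 2 by (simp add: flat_poly_def)
  next
    case 3
    have "((\<lambda>h. flat_poly p h / h) \<longlongrightarrow> 0) (at 0)"
      unfolding filterlim_at_split
    proof
      have "eventually (\<lambda>h. flat_poly p h / h = 0) (at_left 0)"
        by (auto simp: flat_poly_def eventually_at_filter)
      then show "((\<lambda>h. flat_poly p h / h) \<longlongrightarrow> 0) (at_left 0)" by (rule tendsto_eventually)
      have "eventually (\<lambda>h. poly (pCons 0 p) (1 / h) * exp (- (1 / h)) = flat_poly p h / h) (at_right 0)"
        by (auto simp: flat_poly_def eventually_at_filter)
      then show "((\<lambda>h. flat_poly p h / h) \<longlongrightarrow> 0) (at_right 0)"
        by (rule Lim_transform_eventually[OF flat_poly_tendsto_0])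
    qed
    then have "(flat_poly p has_real_derivative 0) (at 0)"
      by (simp add: DERIV_def flat_poly_def)
    then show ?thesis using 3 by (simp add: flat_poly_def)
  qed
qed

lemma smooth_flat_poly: "smooth (flat_poly p)"
  by (rule smooth_family[of UNIV flat_poly, OF _ UNIV_I]) (blast intro: flat_poly_deriv)

text \<open>\<open>flat (n x)\<close> is the \<open>n\<close>-th root of \<open>exp (-1/x)\<close> for \<open>x > 0\<close> and increases to the indicator
  function of \<open>(0,\<infinity>)\<close>, so smooth products of such functions increase to the indicator functions of intervals.\<close>

abbreviation flat :: "real \<Rightarrow> real" where "flat \<equiv> flat_poly 1"

lemma flat_bounds: "0 \<le> flat x" "flat x \<le> 1"
  by (auto simp: flat_poly_def)

lemma flat_eq_0: "x \<le> 0 \<Longrightarrow> flat x = 0"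
  by (simp add: flat_poly_def)

lemma flat_pos: "x > 0 \<Longrightarrow> flat x > 0"
  by (simp add: flat_poly_def)

lemma flat_tendsto_1: "(flat \<longlongrightarrow> 1) at_top"
proof -
  have "((\<lambda>x::real. exp (- inverse x)) \<longlongrightarrow> exp (- 0)) at_top"
    by (intro tendsto_intros tendsto_inverse_0_at_top filterlim_ident)
  moreover have "eventually (\<lambda>x. exp (- inverse x) = flat x) at_top"
    using eventually_gt_at_top[of 0] by eventually_elim (simp add: flat_poly_def inverse_eq_divide)
  ultimately show ?thesis using Lim_transform_eventually by fastforce
qed

definition bump :: "real \<Rightarrow> real \<Rightarrow> nat \<Rightarrow> real \<Rightarrow> real" where
  "bump a b n x = flat (real n * (x - a)) * flat (real n * (b - x))"

lemma bump_bounds: "0 \<le> bump a b n x" "bump a b n x \<le> 1"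
  using flat_bounds by (auto simp: bump_def intro: mult_le_one)

lemma bump_eq_0: "x \<notin> {a<..<b} \<Longrightarrow> bump a b n x = 0"
  by (auto simp: bump_def not_less flat_eq_0 mult_nonneg_nonpos)

lemma bump_pos: "n > 0 \<Longrightarrow> a < x \<Longrightarrow> x < b \<Longrightarrow> bump a b n x > 0"
  by (auto simp: bump_def intro!: mult_pos_pos flat_pos)

lemma smooth_bump: "smooth (bump a b n)"
proof -
  have "smooth (\<lambda>x. flat (real n * x + (- real n * a)) * flat ((- real n) * x + real n * b))"
    by (intro smooth_mult smooth_affine smooth_flat_poly)
  moreover have "(\<lambda>x. flat (real n * x + (- real n * a)) * flat ((- real n) * x + real n * b)) = bump a b n"
    by (simp add: fun_eq_iff bump_def algebra_simps)
  ultimately show ?thesis by simp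
qed

lemma test_function_bump: "0 < a \<Longrightarrow> test_function (bump a b n)"
  unfolding test_function_iff using smooth_bump bump_eq_0 by (metis greaterThanLessThan_iff atLeastAtMost_iff less_imp_le)

lemma bump_tendsto: "(\<lambda>n. bump a b n x) \<longlonglongrightarrow> indicator {a<..<b} x"
proof (cases "x \<in> {a<..<b}")
  case True
  have lim: "(\<lambda>n. flat (real n * t)) \<longlonglongrightarrow> 1" if "t > 0" for t
  proof (rule filterlim_compose[OF flat_tendsto_1])
    show "filterlim (\<lambda>n. real n * t) at_top sequentially"
      using that by (intro filterlim_at_top_mult_tendsto_pos[OF tendsto_const _ filterlim_real_sequentially])
  qed
  have "(\<lambda>n. flat (real n * (x - a)) * flat (real n * (b - x))) \<longlonglongrightarrow> 1 * 1"
    by (intro tendsto_mult lim) (use True in auto)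
  then show ?thesis using True by (simp add: bump_def)
next
  case False
  then show ?thesis by (simp add: bump_eq_0)
qed

section \<open>Weak derivatives as primitives\<close>

lemma test_functionE:
  assumes "test_function \<phi>"
  obtains a b where "0 < a" "a \<le> b" "\<And>x. x \<notin> {a..b} \<Longrightarrow> \<phi> x = 0"
proof -
  obtain a b where ab: "0 < a" "\<And>x. x \<notin> {a..b} \<Longrightarrow> \<phi> x = 0"
    using assms unfolding test_function_def by blast
  have "\<phi> x = 0" if "x \<notin> {a..max a b}" for x by (rule ab(2)) (use that in auto)
  then show thesis using that[of a "max a b"] ab(1) by simp
qed

lemma test_function_deriv:
  assumes "test_function \<phi>"
  shows "test_function (deriv \<phi>)" "(\<phi> has_real_derivative deriv \<phi> x) (at x)"
    and "continuous_on S \<phi>"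
proof -
  have sm: "smooth \<phi>" using assms unfolding test_function_iff by blast
  obtain a b where ab: "0 < a" "\<And>x. x \<notin> {a..b} \<Longrightarrow> \<phi> x = 0"
    using assms unfolding test_function_def by blast
  have "deriv \<phi> x = 0" if "x \<notin> {a..b}" for x
  proof -
    have "((\<lambda>x. 0) has_real_derivative 0) (at x)" by simp
    then have "(\<phi> has_real_derivative 0) (at x)"
      by (rule has_field_derivative_transform_within_open[of _ _ _ "- {a..b}"])
        (use that ab in auto)
    then show ?thesis by (rule DERIV_imp_deriv)
  qed
  then show "test_function (deriv \<phi>)"
    using smooth_deriv(2)[OF sm] ab(1) unfolding test_function_iff by blast
  show "(\<phi> has_real_derivative deriv \<phi> x) (at x)" by (rule smooth_deriv(1)[OF sm])
  show "continuous_on S \<phi>" by (rule smooth_continuous[OF sm])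
qed

lemma integrable_times_supported:
  assumes v: "locally_integrable v" and \<phi>: "continuous_on {a..b} \<phi>"
    and ab: "0 < a" "\<And>x. x \<notin> {a..b} \<Longrightarrow> \<phi> x = 0"
  shows "integrable halfline (\<lambda>x. v x * \<phi> x)"
proof -
  obtain C where C: "\<And>x. x \<in> {a..b} \<Longrightarrow> \<bar>\<phi> x\<bar> \<le> C"
    using continuous_on_Icc_bounded[OF \<phi>] by blast
  have "integrable (lebesgue_on {a..b}) (\<lambda>x. v x * \<phi> x)"
  proof (rule integrable_mult_bounded(1))
    show "integrable (lebesgue_on {a..b}) v" using v ab(1) unfolding locally_integrable_def by blast
    show "\<phi> \<in> borel_measurable (lebesgue_on {a..b})"
      by (rule measurable_lebesgue_on_continuous[OF \<phi>]) simp
  qed (use C in simp)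
  then have "integrable halfline (\<lambda>x. indicator {a..b} x * (v x * \<phi> x))"
    by (rule lebesgue_on_Icc_halfline(1)[OF ab(1), THEN iffD1])
  moreover have "(\<lambda>x. indicator {a..b} x * (v x * \<phi> x)) = (\<lambda>x. v x * \<phi> x)"
    using ab(2) by (auto simp: indicator_def fun_eq_iff)
  ultimately show ?thesis by simp
qed

lemma integrable_times_test:
  assumes "locally_integrable v" "test_function \<phi>"
  shows "integrable halfline (\<lambda>x. v x * \<phi> x)"
proof -
  obtain a b where ab: "0 < a" "a \<le> b" "\<And>x. x \<notin> {a..b} \<Longrightarrow> \<phi> x = 0"
    using test_functionE[OF assms(2)] by blast
  show ?thesis
    by (rule integrable_times_supported[OF assms(1) test_function_deriv(3)[OF assms(2)] ab(1) ab(3)])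
qed

lemma locally_integrable_measurable:
  assumes "locally_integrable v"
  shows "v \<in> borel_measurable halfline"
proof (rule borel_measurable_LIMSEQ_real)
  let ?A = "\<lambda>n. {1 / real (Suc n)..real (Suc n)}"
  show "(\<lambda>x. indicator (?A n) x * v x) \<in> borel_measurable halfline" for n
  proof -
    have pos: "0 < 1 / real (Suc n)" by simp
    have "integrable (lebesgue_on (?A n)) v"
      using assms pos unfolding locally_integrable_def by blast
    then show ?thesis
      using lebesgue_on_Icc_halfline(1)[OF pos] borel_measurable_integrable by blast
  qed
  fix x :: real assume "x \<in> space halfline"
  then have x: "x > 0" by simp
  have "eventually (\<lambda>n. 1 / real (Suc n) < x) sequentially"
    using LIMSEQ_inverse_real_of_nat x by (intro order_tendstoD(2)[of _ 0]) (simp_all add: inverse_eq_divide)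
  moreover have "eventually (\<lambda>n. x \<le> real (Suc n)) sequentially"
  proof -
    have "eventually (\<lambda>n. x \<le> real n) sequentially"
      using filterlim_real_sequentially unfolding filterlim_at_top by blast
    then show ?thesis by eventually_elim simp
  qed
  ultimately have "eventually (\<lambda>n. indicator (?A n) x * v x = v x) sequentially"
    by eventually_elim simp
  then show "(\<lambda>n. indicator (?A n) x * v x) \<longlonglongrightarrow> v x" by (rule tendsto_eventually)
qed

lemma locally_integrable_cmult:
  "locally_integrable u \<Longrightarrow> locally_integrable (\<lambda>x. c * u x)"
  and locally_integrable_diff:
  "locally_integrable u \<Longrightarrow> locally_integrable v \<Longrightarrow> locally_integrable (\<lambda>x. u x - v x)"
  unfolding locally_integrable_def by simp_all

lemma locally_integrable_continuous:
  assumes "continuous_on {0<..} v"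
  shows "locally_integrable v"
  unfolding locally_integrable_def
proof (intro allI impI)
  fix a b :: real assume "0 < a"
  then have "continuous_on {a..b} v" using assms by (rule_tac continuous_on_subset) auto
  then show "integrable (lebesgue_on {a..b}) v" by (rule continuous_imp_integrable_real)
qed

lemma primitive_locally_integrable:
  assumes "primitive F f"
  shows "locally_integrable F" "locally_integrable f"
proof -
  show "locally_integrable F"
    by (rule locally_integrable_continuous[OF primitive_continuous[OF assms]])
  show "locally_integrable f"
    unfolding locally_integrable_def
  proof (intro allI impI)
    fix a b :: real assume "0 < a"
    then show "integrable (lebesgue_on {a..b}) f"
      using primitiveD(1)[OF assms, of a b] by (cases "a \<le> b") auto
  qed
qed

text \<open>The fundamental lemma of the calculus of variations: as the bumps over \<open>(a,b)\<close> increase to the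
  indicator function of \<open>(a,b)\<close>, all integrals of \<open>g\<close> over intervals vanish.\<close>

lemma AE_eq_0_if_bump_integrals_eq_0:
  assumes g: "locally_integrable g"
    and zero: "\<And>a b n. 0 < a \<Longrightarrow> (LINT x|halfline. g x * bump a b n x) = 0"
  shows "AE x in halfline. g x = 0"
proof (rule AE_eq_0_if_integrals_eq_0)
  fix a b :: real assume ab: "0 < a" "a \<le> b"
  show gi: "integrable (lebesgue_on {a..b}) g"
    using g ab(1) unfolding locally_integrable_def by blast
  have gh: "integrable halfline (\<lambda>x. indicator {a..b} x * g x)"
    by (rule lebesgue_on_Icc_halfline(1)[OF ab(1), THEN iffD1, OF gi])
  note [measurable] = locally_integrable_measurable[OF g]
  have bm [measurable]: "bump a b n \<in> borel_measurable halfline" for n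
    by (intro measurable_lebesgue_on_continuous smooth_continuous smooth_bump halfline_sets)
  have im [measurable]: "indicator {a<..<b} \<in> borel_measurable halfline"
    using ab by (intro borel_measurable_indicator sets_halfline) auto
  have "(\<lambda>n. LINT x|halfline. g x * bump a b n x) \<longlonglongrightarrow> (LINT x|halfline. g x * indicator {a<..<b} x)"
  proof (rule integral_dominated_convergence[where w = "\<lambda>x. \<bar>indicator {a..b} x * g x\<bar>"])
    show "integrable halfline (\<lambda>x. \<bar>indicator {a..b} x * g x\<bar>)" using gh by (rule integrable_abs)
    show "AE x in halfline. (\<lambda>n. g x * bump a b n x) \<longlonglongrightarrow> g x * indicator {a<..<b} x"
      by (intro AE_I2 tendsto_intros bump_tendsto)
    show "AE x in halfline. norm (g x * bump a b n x) \<le> \<bar>indicator {a..b} x * g x\<bar>" for n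
    proof (rule AE_I2)
      fix x
      show "norm (g x * bump a b n x) \<le> \<bar>indicator {a..b} x * g x\<bar>"
      proof (cases "x \<in> {a<..<b}")
        case True
        have "\<bar>g x\<bar> * bump a b n x \<le> \<bar>g x\<bar> * 1" by (intro mult_left_mono bump_bounds) auto
        then show ?thesis using True bump_bounds[of a b n x] by (auto simp: abs_mult)
      next
        case False
        then show ?thesis by (simp add: bump_eq_0)
      qed
    qed
  qed measurable
  then have "(LINT x|halfline. g x * indicator {a<..<b} x) = 0"
    using zero[OF ab(1)] by (simp add: LIMSEQ_const_iff)
  moreover have "(LINT x|halfline. g x * indicator {a<..<b} x) = (LINT x|halfline. indicator {a..b} x * g x)"
  proof (rule integral_cong_AE)
    have "AE x in lebesgue. x \<noteq> a \<and> x \<noteq> b"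
      using AE_completion[OF AE_lborel_singleton[of a]] AE_completion[OF AE_lborel_singleton[of b]]
      by eventually_elim simp
    then have "AE x in halfline. x \<noteq> a \<and> x \<noteq> b"
      by (simp add: AE_restrict_space_iff) (auto elim: eventually_mono)
    then show "AE x in halfline. g x * indicator {a<..<b} x = indicator {a..b} x * g x"
      by eventually_elim (auto simp: indicator_def)
    show "(\<lambda>x. g x * indicator {a<..<b} x) \<in> borel_measurable halfline" by measurable
    show "(\<lambda>x. indicator {a..b} x * g x) \<in> borel_measurable halfline"
      by (rule borel_measurable_integrable[OF gh])
  qed
  ultimately show "(LINT x|lebesgue_on {a..b}. g x) = 0"
    by (simp only: lebesgue_on_Icc_halfline(2)[OF ab(1)])
qed

lemma primitive_integral_test:
  assumes F: "primitive F f" and \<phi>: "test_function \<phi>"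
  shows "inner_L2 F (deriv \<phi>) = - inner_L2 f \<phi>"
proof -
  note d\<phi> = test_function_deriv[OF \<phi>]
  obtain a b where ab: "0 < a" "a \<le> b" "\<And>x. x \<notin> {a..b} \<Longrightarrow> \<phi> x = 0"
    using test_functionE[OF \<phi>] by blast
  have P: "primitive \<phi> (deriv \<phi>)"
    by (intro primitive_C1 d\<phi>(2) test_function_deriv(3)[OF d\<phi>(1)])
  have i: "integrable halfline (\<lambda>x. f x * \<phi> x)" "integrable halfline (\<lambda>x. F x * deriv \<phi> x)"
    by (intro integrable_times_test primitive_locally_integrable[OF F] \<phi> d\<phi>)+
  have "eventually (\<lambda>x. F x * \<phi> x = 0) (at_right 0)"
    using eventually_at_right_less[of "0::real"] ab(1) ab(3)
    by (auto simp: eventually_at_right[OF zero_less_one] intro!: exI[of _ a])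
  moreover have "eventually (\<lambda>x. F x * \<phi> x = 0) at_top"
    using eventually_gt_at_top[of b] by eventually_elim (use ab(3) in simp)
  ultimately have "(LINT x|halfline. f x * \<phi> x + F x * deriv \<phi> x) = 0 - 0"
    by (intro integral_primitive_halfline[OF primitive_mult[OF F P]] Bochner_Integration.integrable_add i
        tendsto_eventually)
  then show ?thesis using i by (simp add: inner_L2_def)
qed

lemma has_weak_deriv_primitive:
  assumes "primitive F f"
  shows "has_weak_deriv 1 F f"
  using primitive_locally_integrable[OF assms] primitive_integral_test[OF assms]
  unfolding has_weak_deriv_def by simp

lemma has_weak_deriv_unique:
  assumes "has_weak_deriv k v g" "has_weak_deriv k v h"
  shows "AE x in halfline. g x = h x"
proof -
  have gh: "locally_integrable g" "locally_integrable h" using assms unfolding has_weak_deriv_def by auto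
  have "AE x in halfline. g x - h x = 0"
  proof (rule AE_eq_0_if_bump_integrals_eq_0[OF locally_integrable_diff[OF gh]])
    fix a b :: real and n assume "0 < a"
    then have t: "test_function (bump a b n)" by (rule test_function_bump)
    have "(- 1) ^ k * inner_L2 g (bump a b n) = (- 1) ^ k * inner_L2 h (bump a b n)"
      using assms t unfolding has_weak_deriv_def by metis
    then have "inner_L2 g (bump a b n) = inner_L2 h (bump a b n)" by simp
    then show "(LINT x|halfline. (g x - h x) * bump a b n x) = 0"
      using integrable_times_test[OF gh(1) t] integrable_times_test[OF gh(2) t]
      by (simp add: inner_L2_def left_diff_distrib)
  qed
  then show ?thesis by simp
qed

lemma weak_deriv_AE:
  assumes "has_weak_deriv k v g"
  shows "has_weak_deriv k v (weak_deriv k v)" "AE x in halfline. weak_deriv k v x = g x"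
proof -
  show *: "has_weak_deriv k v (weak_deriv k v)"
    unfolding weak_deriv_def by (rule someI[of "has_weak_deriv k v", OF assms])
  show "AE x in halfline. weak_deriv k v x = g x" by (rule has_weak_deriv_unique[OF * assms])
qed

lemma has_weak_deriv_self: "locally_integrable v \<Longrightarrow> has_weak_deriv 0 v v"
  by (simp add: has_weak_deriv_def)

lemma has_weak_deriv_step:
  assumes "has_weak_deriv k v g" "has_weak_deriv (Suc k) v h"
  shows "has_weak_deriv 1 g h"
  unfolding has_weak_deriv_def
proof (intro conjI allI impI)
  fix \<phi> assume \<phi>: "test_function \<phi>"
  have "inner_L2 v ((deriv ^^ k) (deriv \<phi>)) = (- 1) ^ k * inner_L2 g (deriv \<phi>)"
    using assms(1) test_function_deriv(1)[OF \<phi>] unfolding has_weak_deriv_def by blast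
  moreover have "inner_L2 v ((deriv ^^ Suc k) \<phi>) = (- 1) ^ Suc k * inner_L2 h \<phi>"
    using assms(2) \<phi> unfolding has_weak_deriv_def by blast
  ultimately have "(- 1) ^ k * inner_L2 g (deriv \<phi>) = (- 1) ^ k * (- inner_L2 h \<phi>)"
    by (simp add: funpow_swap1)
  then have "inner_L2 g (deriv \<phi>) = - inner_L2 h \<phi>"
    by (subst (asm) mult_cancel_left) simp
  then show "inner_L2 g ((deriv ^^ 1) \<phi>) = (- 1) ^ 1 * inner_L2 h \<phi>" by simp
qed (use assms in \<open>auto simp: has_weak_deriv_def\<close>)

lemma exists_primitive:
  assumes "locally_integrable g"
  shows "\<exists>G. primitive G g"
proof -
  have gi: "integrable (lebesgue_on {a..b}) g" if "0 < a" for a b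
    using assms that unfolding locally_integrable_def by blast
  define G where "G x = (LINT t|lebesgue_on {1..x}. g t) - (LINT t|lebesgue_on {x..1}. g t)" for x
  have single: "(LINT t|lebesgue_on {y..x}. g t) = 0" if "x \<le> y" for x y
  proof (cases "x = y")
    case True
    have "{x} \<in> null_sets lebesgue" by simp
    from has_bochner_integral_integral_eq[OF has_bochner_integral_null[OF this, of g]]
    show ?thesis using True by simp
  next
    case False
    then have "{y..x} = {}" using that by simp
    then show ?thesis by simp
  qed
  have split: "(LINT t|lebesgue_on {a..b}. g t) = (LINT t|lebesgue_on {a..c}. g t) + (LINT t|lebesgue_on {c..b}. g t)"
    if "0 < a" "a \<le> c" "c \<le> b" for a b c
    by (rule Equivalence_Measurable_On_Borel.integral_combine[OF gi[OF that(1)] that(2,3)])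
  have "primitive G g"
    unfolding primitive_def
  proof (intro allI impI conjI gi)
    fix a b :: real assume ab: "0 < a" "a \<le> b"
    consider "b \<le> 1" | "a \<le> 1" "1 \<le> b" | "1 \<le> a" by linarith
    then show "(LINT x|lebesgue_on {a..b}. g x) = G b - G a"
    proof cases
      case 1 then show ?thesis using split[of a b 1] ab by (simp add: G_def single)
    next
      case 2 then show ?thesis using split[of a 1 b] ab by (simp add: G_def single)
    next
      case 3 then show ?thesis using split[of 1 a b] ab by (simp add: G_def single)
    qed
  qed
  then show ?thesis by blast
qed

text \<open>The antiderivative that vanishes to the left of the support of \<open>\<zeta>\<close> is constant to the right of it, and
  this constant is the integral of \<open>\<zeta>\<close>.\<close>

lemma test_function_antideriv:
  assumes \<zeta>: "test_function \<zeta>" and zero: "(LINT x|halfline. \<zeta> x) = 0"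
  shows "\<exists>\<phi>. test_function \<phi> \<and> deriv \<phi> = \<zeta>"
proof -
  obtain a b where ab: "0 < a" "a \<le> b" "\<And>x. x \<notin> {a..b} \<Longrightarrow> \<zeta> x = 0"
    using test_functionE[OF \<zeta>] by blast
  have "isCont \<zeta> x" for x using test_function_deriv(2)[OF \<zeta>] by (rule DERIV_isCont)
  then have "\<exists>F. \<forall>x::real. -\<infinity> < ereal x \<longrightarrow> ereal x < \<infinity> \<longrightarrow> (F has_vector_derivative \<zeta> x) (at x)"
    by (intro einterval_antiderivative) auto
  then obtain F where F: "\<And>x. (F has_real_derivative \<zeta> x) (at x)"
    by (auto simp: has_real_derivative_iff_has_vector_derivative)
  define \<phi> where "\<phi> x = F x - F a" for x
  have d: "(\<phi> has_real_derivative \<zeta> x) (at x)" for x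
    unfolding \<phi>_def by (auto intro!: derivative_eq_intros F)
  have const: "\<phi> x = \<phi> y" if "x \<le> y" "y \<le> a \<or> b \<le> x" for x y
  proof (cases "x = y")
    case False
    then have "x < y" using that(1) by simp
    from MVT2[OF this d]
    obtain z where "x < z" "z < y" "\<phi> y - \<phi> x = (y - x) * \<zeta> z" by blast
    then show ?thesis using ab(3)[of z] that by auto
  qed simp
  have "\<phi> a = 0" by (simp add: \<phi>_def)
  moreover have "\<phi> b = 0"
  proof -
    have P: "primitive \<phi> \<zeta>" by (intro primitive_C1 d test_function_deriv(3)[OF \<zeta>])
    have "\<phi> b - \<phi> a = (LINT x|lebesgue_on {a..b}. \<zeta> x)" using primitiveD(2)[OF P ab(1,2)] by simp
    also have "\<dots> = (LINT x|halfline. indicator {a..b} x * \<zeta> x)"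
      by (rule lebesgue_on_Icc_halfline(2)[OF ab(1)])
    also have "(\<lambda>x. indicator {a..b} x * \<zeta> x) = \<zeta>"
      using ab(3) by (auto simp: indicator_def fun_eq_iff)
    finally show ?thesis using zero \<open>\<phi> a = 0\<close> by simp
  qed
  ultimately have "\<phi> x = 0" if "x \<notin> {a..b}" for x
    using const[of x a] const[of b x] that by (cases "x \<le> a") auto
  moreover have "smooth \<phi>"
    using smooth_derivI[OF d] \<zeta> unfolding test_function_iff by blast
  ultimately have "test_function \<phi>" unfolding test_function_iff using ab(1) by blast
  moreover have "deriv \<phi> = \<zeta>" using d by (auto intro!: DERIV_imp_deriv)
  ultimately show ?thesis by blast
qed

lemma test_function_diff_scaled:
  assumes "test_function \<phi>" "test_function \<psi>"
  shows "test_function (\<lambda>x. \<phi> x - c * \<psi> x)"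
proof -
  obtain a b where ab: "0 < a" "a \<le> b" "\<And>x. x \<notin> {a..b} \<Longrightarrow> \<phi> x = 0"
    using test_functionE[OF assms(1)] by blast
  obtain a' b' where ab': "0 < a'" "a' \<le> b'" "\<And>x. x \<notin> {a'..b'} \<Longrightarrow> \<psi> x = 0"
    using test_functionE[OF assms(2)] by blast
  have "smooth (\<lambda>x. \<phi> x + (- c) * \<psi> x)"
    using assms unfolding test_function_iff by (intro smooth_add smooth_mult smooth_const) auto
  moreover have "\<phi> x - c * \<psi> x = 0" if "x \<notin> {min a a'..max b b'}" for x
  proof -
    have "x \<notin> {a..b}" "x \<notin> {a'..b'}" using that by auto
    then show ?thesis using ab(3) ab'(3) by simp
  qed
  moreover have "0 < min a a'" using ab(1) ab'(1) by simp
  ultimately have "0 < min a a' \<and> (\<forall>x. x \<notin> {min a a'..max b b'} \<longrightarrow> \<phi> x - c * \<psi> x = 0)"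
    "smooth (\<lambda>x. \<phi> x - c * \<psi> x)" by (blast, simp)
  then show ?thesis unfolding test_function_iff by blast
qed

text \<open>Every test function is a multiple of one fixed bump plus a test function of mean zero, that is,
  plus the derivative of a test function.\<close>

lemma AE_const_if_orthogonal_to_derivs:
  assumes w: "locally_integrable w"
    and zero: "\<And>\<phi>. test_function \<phi> \<Longrightarrow> inner_L2 w (deriv \<phi>) = 0"
  shows "\<exists>c. AE x in halfline. w x = c"
proof -
  define \<psi> where "\<psi> = bump 1 2 1"
  have t: "test_function \<psi>" unfolding \<psi>_def by (rule test_function_bump) simp
  have \<psi>_ge: "0 \<le> \<psi> x" for x by (simp add: \<psi>_def bump_bounds)
  have one: "locally_integrable (\<lambda>x. 1)" by (intro locally_integrable_continuous continuous_intros)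
  have i1: "integrable halfline \<phi>" if "test_function \<phi>" for \<phi>
    using integrable_times_test[OF one that] by simp
  define m where "m = (LINT x|halfline. \<psi> x)"
  have "m > 0"
  proof -
    have "m \<noteq> 0"
    proof
      assume "m = 0"
      then have "AE x in halfline. \<psi> x = 0"
        unfolding m_def using integral_nonneg_eq_0_iff_AE[OF i1[OF t]] \<psi>_ge by simp
      then have "AE x in lebesgue. 0 < x \<longrightarrow> \<psi> x = 0"
        by (simp add: AE_restrict_space_iff)
      then have ae: "AE x in lebesgue. x \<notin> {1<..<2::real}"
      proof eventually_elim
        case (elim x)
        show ?case using elim bump_pos[of 1 1 x 2] by (auto simp: \<psi>_def)
      qed
      have "{1<..<2::real} \<in> null_sets lebesgue"
        by (subst AE_iff_null_sets) (use ae in auto)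
      then have "emeasure lebesgue {1<..<2::real} = 0" by (rule null_setsD1)
      then show False by simp
    qed
    moreover have "m \<ge> 0" unfolding m_def using \<psi>_ge by simp
    ultimately show ?thesis by simp
  qed
  define c where "c = inner_L2 w \<psi> / m"
  have wc: "locally_integrable (\<lambda>x. w x - c * 1)"
    by (intro locally_integrable_diff w locally_integrable_cmult one)
  have "AE x in halfline. w x - c * 1 = 0"
  proof (rule AE_eq_0_if_bump_integrals_eq_0[OF wc])
    fix a b :: real and n assume "0 < a"
    then have tb: "test_function (bump a b n)" by (rule test_function_bump)
    define k where "k = (LINT x|halfline. bump a b n x) / m"
    let ?\<zeta> = "\<lambda>x. bump a b n x - k * \<psi> x"
    have "test_function ?\<zeta>" by (rule test_function_diff_scaled[OF tb t])
    moreover have "(LINT x|halfline. ?\<zeta> x) = 0"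
      using i1[OF t] i1[OF tb] \<open>m > 0\<close> by (simp add: m_def[symmetric] k_def)
    ultimately obtain \<phi> where \<phi>: "test_function \<phi>" "deriv \<phi> = ?\<zeta>"
      using test_function_antideriv by blast
    have "0 = (LINT x|halfline. w x * bump a b n x - k * (w x * \<psi> x))"
      using zero[OF \<phi>(1)] unfolding \<phi>(2) inner_L2_def by (simp add: algebra_simps)
    also have "\<dots> = (LINT x|halfline. w x * bump a b n x) - k * inner_L2 w \<psi>"
      using integrable_times_test[OF w t] integrable_times_test[OF w tb] by (simp add: inner_L2_def)
    also have "k * inner_L2 w \<psi> = c * (LINT x|halfline. bump a b n x)"
      by (simp add: k_def c_def)
    finally have "(LINT x|halfline. w x * bump a b n x - c * bump a b n x) = 0"
      using integrable_times_test[OF w tb] i1[OF tb] by simp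
    then show "(LINT x|halfline. (w x - c * 1) * bump a b n x) = 0"
      by (simp add: algebra_simps)
  qed
  then show ?thesis by (intro exI[of _ c]) simp
qed

text \<open>The lemma of du Bois-Reymond: subtracting from \<open>v\<close> a primitive of \<open>g\<close> leaves a function with weak
  derivative zero.\<close>

lemma has_weak_deriv_imp_primitive:
  assumes "has_weak_deriv 1 v g"
  shows "\<exists>V. primitive V g \<and> (AE x in halfline. V x = v x)"
proof -
  have vg: "locally_integrable v" "locally_integrable g"
    and weak: "\<And>\<phi>. test_function \<phi> \<Longrightarrow> inner_L2 v (deriv \<phi>) = - inner_L2 g \<phi>"
    using assms unfolding has_weak_deriv_def by auto
  obtain G where G: "primitive G g" using exists_primitive[OF vg(2)] by blast
  have Gl: "locally_integrable G" by (rule primitive_locally_integrable(1)[OF G])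
  have "\<exists>c. AE x in halfline. v x - G x = c"
  proof (rule AE_const_if_orthogonal_to_derivs[OF locally_integrable_diff[OF vg(1) Gl]])
    fix \<phi> assume \<phi>: "test_function \<phi>"
    note t = test_function_deriv(1)[OF \<phi>]
    show "inner_L2 (\<lambda>x. v x - G x) (deriv \<phi>) = 0"
      using weak[OF \<phi>] primitive_integral_test[OF G \<phi>] integrable_times_test[OF vg(1) t]
        integrable_times_test[OF Gl t] by (simp add: inner_L2_def left_diff_distrib)
  qed
  then obtain c where "AE x in halfline. v x - G x = c" by blast
  then have "AE x in halfline. G x + c = v x" by eventually_elim simp
  moreover have "primitive (\<lambda>x. G x + c) g"
    using primitive_add[OF G primitive_const[of c]] by simp
  ultimately show ?thesis by blast
qed

section \<open>Polynomials times a decaying exponential\<close>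

definition expoly :: "real \<Rightarrow> real poly \<Rightarrow> real \<Rightarrow> real" where
  "expoly b p x = exp (- b * x) * poly p x"

lemma expoly_deriv: "(expoly b p has_real_derivative expoly b (pderiv p - smult b p) x) (at x)"
  unfolding expoly_def by (auto intro!: derivative_eq_intros poly_DERIV simp: algebra_simps)

lemma expoly_continuous: "continuous_on S (expoly b p)"
  unfolding expoly_def by (intro continuous_intros)

lemma expoly_measurable [measurable]: "expoly b p \<in> borel_measurable halfline"
  by (intro measurable_lebesgue_on_continuous expoly_continuous halfline_sets)

lemma primitive_expoly: "primitive (expoly b p) (expoly b (pderiv p - smult b p))"
  by (intro primitive_C1 expoly_deriv expoly_continuous)

lemma expoly_mult: "expoly b p x * expoly c q x = expoly (b + c) (p * q) x"
  by (simp add: expoly_def algebra_simps flip: exp_add)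

lemma expoly_bounded:
  assumes "b > 0"
  shows "\<exists>C. \<forall>x\<ge>0. \<bar>expoly b p x\<bar> \<le> C"
proof -
  have scale: "poly (pcompose p [:0, 1 / b:]) (b * x) * exp (- (b * x)) = expoly b p x" for x
    using assms by (simp add: expoly_def poly_pcompose)
  have "filterlim (\<lambda>x. b * x) at_top at_top"
    using assms by (intro filterlim_tendsto_pos_mult_at_top[OF tendsto_const]) (auto intro: filterlim_ident)
  from filterlim_compose[OF poly_times_exp_tendsto_0[of "pcompose p [:0, 1 / b:]"] this]
  have "(expoly b p \<longlongrightarrow> 0) at_top" unfolding scale .
  then have "eventually (\<lambda>x. \<bar>expoly b p x\<bar> < 1) at_top"
    using order_tendstoD(2)[OF tendsto_rabs, of "expoly b p" 0 at_top 1] by simp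
  then obtain M where M: "\<And>x. x \<ge> M \<Longrightarrow> \<bar>expoly b p x\<bar> < 1"
    unfolding eventually_at_top_linorder by blast
  obtain C where C: "\<And>x. x \<in> {0..M} \<Longrightarrow> \<bar>expoly b p x\<bar> \<le> C"
    using continuous_on_Icc_bounded[OF expoly_continuous] by blast
  have "\<bar>expoly b p x\<bar> \<le> max C 1" if "x \<ge> 0" for x
    using M[of x] C[of x] that by (cases "x \<ge> M") auto
  then show ?thesis by blast
qed

lemma integrable_exp_halfline:
  assumes "c > 0"
  shows "integrable halfline (\<lambda>x. exp (- c * x))"
proof -
  have "(\<lambda>x. exp (- c * x)) absolutely_integrable_on {0..}"
    using has_integral_exp_minus_to_infinity[OF assms, of 0]
    by (intro nonnegative_absolutely_integrable_1) (auto simp: integrable_on_def)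
  then have "integrable (lebesgue_on {0..}) (\<lambda>x. exp (- c * x))"
    by (simp add: set_integrable_def integrable_restrict_space)
  then show ?thesis
    by (rule integrable_lebesgue_on_subset) auto
qed

lemma integrable_halfline_exp_bound:
  assumes "f \<in> borel_measurable halfline" "c > 0"
    and "\<And>x. x > 0 \<Longrightarrow> \<bar>f x\<bar> \<le> C * exp (- c * x)"
  shows "integrable halfline f"
proof (rule Bochner_Integration.integrable_bound[OF _ assms(1)])
  show "integrable halfline (\<lambda>x. C * exp (- c * x))"
    using integrable_exp_halfline[OF assms(2)] by simp
  show "AE x in halfline. norm (f x) \<le> norm (C * exp (- c * x))"
  proof (rule AE_I2)
    fix x assume "x \<in> space halfline"
    then have "\<bar>f x\<bar> \<le> C * exp (- c * x)" using assms(3) by simp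
    then show "norm (f x) \<le> norm (C * exp (- c * x))" by (simp only: real_norm_def)
  qed
qed

lemma integrable_expoly:
  assumes "b > 0"
  shows "integrable halfline (expoly b p)"
proof -
  obtain C where C: "\<And>x. x \<ge> 0 \<Longrightarrow> \<bar>expoly (b / 2) p x\<bar> \<le> C"
    using expoly_bounded[of "b / 2" p] assms by auto
  show ?thesis
  proof (rule integrable_halfline_exp_bound[where c = "b / 2" and C = C])
    fix x :: real assume "x > 0"
    have "expoly b p x = expoly (b / 2) p x * exp (- (b / 2) * x)"
      by (simp add: expoly_def flip: exp_add)
    then have "\<bar>expoly b p x\<bar> = \<bar>expoly (b / 2) p x\<bar> * exp (- (b / 2) * x)"
      by (simp add: abs_mult)
    also have "\<dots> \<le> C * exp (- (b / 2) * x)"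
      using C[of x] \<open>x > 0\<close> by (intro mult_right_mono) auto
    finally show "\<bar>expoly b p x\<bar> \<le> C * exp (- (b / 2) * x)" .
  qed (use assms in auto)
qed

lemma integrable_expoly_square:
  assumes "b > 0"
  shows "integrable halfline (\<lambda>x. (expoly b p x)\<^sup>2)"
  using integrable_expoly[of "b + b" "p * p"] assms by (simp add: power2_eq_square expoly_mult)

lemma X_eq: "X \<beta> N = {expoly (\<beta> / 2) p | p. degree p \<le> N}"
  and X0_eq: "X0 \<beta> N = {expoly (\<beta> / 2) p | p. degree p \<le> N \<and> poly p 0 = 0}"
proof -
  have "(\<lambda>x. exp (- (1 / 2) * \<beta> * x) * poly p x) = expoly (\<beta> / 2) p" for p
    by (simp add: expoly_def fun_eq_iff)
  then show "X \<beta> N = {expoly (\<beta> / 2) p | p. degree p \<le> N}"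
    "X0 \<beta> N = {expoly (\<beta> / 2) p | p. degree p \<le> N \<and> poly p 0 = 0}"
    unfolding X_def X0_def by simp_all
qed

section \<open>Norms and forms in terms of primitives\<close>

lemma normw_square: "(normw \<alpha> v)\<^sup>2 = (LINT x|halfline. (v x)\<^sup>2 * x powr \<alpha>)"
  unfolding normw_def by (simp add: integral_nonneg_AE)

lemma normw_0_square: "(normw 0 v)\<^sup>2 = (LINT x|halfline. (v x)\<^sup>2)"
  unfolding normw_square by (intro Bochner_Integration.integral_cong) auto

lemma powr_measurable_halfline [measurable]: "(\<lambda>x. x powr \<alpha>) \<in> borel_measurable halfline"
  by (rule measurable_lebesgue_on_continuous) (auto intro!: continuous_intros)

lemma id_measurable_halfline [measurable]: "(\<lambda>x. x) \<in> borel_measurable halfline"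
  by (rule measurable_lebesgue_on_continuous) (auto intro!: continuous_intros)

lemma normw_cong_AE:
  assumes "u \<in> borel_measurable halfline" "v \<in> borel_measurable halfline"
    "AE x in halfline. u x = v x"
  shows "normw \<alpha> u = normw \<alpha> v"
proof -
  note [measurable] = assms(1,2)
  have "(LINT x|halfline. (u x)\<^sup>2 * x powr \<alpha>) = (LINT x|halfline. (v x)\<^sup>2 * x powr \<alpha>)"
  proof (rule integral_cong_AE)
    show "AE x in halfline. (u x)\<^sup>2 * x powr \<alpha> = (v x)\<^sup>2 * x powr \<alpha>"
      using assms(3) by eventually_elim simp
  qed measurable
  then show ?thesis by (simp add: normw_def)
qed

lemma has_weak_deriv_measurable:
  assumes "has_weak_deriv k v g"
  shows "v \<in> borel_measurable halfline" "g \<in> borel_measurable halfline"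
  using assms locally_integrable_measurable unfolding has_weak_deriv_def by auto

lemma normw_weak_deriv:
  assumes "has_weak_deriv k v g"
  shows "normw \<alpha> (weak_deriv k v) = normw \<alpha> g"
  using weak_deriv_AE[OF assms] has_weak_deriv_measurable assms by (intro normw_cong_AE) blast+

lemma energy_form_eq:
  assumes u: "has_weak_deriv 1 u f" and v: "has_weak_deriv 1 v g"
  shows "energy_form \<gamma> u v = (LINT x|halfline. f x * g x) + \<gamma> * (LINT x|halfline. u x * v x)"
proof -
  note m = has_weak_deriv_measurable[OF weak_deriv_AE(1)]
  note [measurable] = m(2)[OF u] m(2)[OF v] has_weak_deriv_measurable[OF u] has_weak_deriv_measurable[OF v]
  have "(LINT x|halfline. weak_deriv 1 u x * weak_deriv 1 v x) = (LINT x|halfline. f x * g x)"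
  proof (rule integral_cong_AE)
    show "AE x in halfline. weak_deriv 1 u x * weak_deriv 1 v x = f x * g x"
      using weak_deriv_AE(2)[OF u] weak_deriv_AE(2)[OF v] by eventually_elim simp
  qed measurable
  then show ?thesis by (simp add: energy_form_def inner_L2_def)
qed

lemma L2w_0_iff:
  "v \<in> L2w 0 \<longleftrightarrow> v \<in> borel_measurable halfline \<and> integrable halfline (\<lambda>x. (v x)\<^sup>2)"
proof -
  have "integrable halfline (\<lambda>x. (v x)\<^sup>2 * x powr 0) \<longleftrightarrow> integrable halfline (\<lambda>x. (v x)\<^sup>2)"
    by (intro Bochner_Integration.integrable_cong) auto
  then show ?thesis by (simp add: L2w_def)
qed

lemma primitive_in_H1:
  assumes F: "primitive F f" and "integrable halfline (\<lambda>x. (F x)\<^sup>2)" "integrable halfline (\<lambda>x. (f x)\<^sup>2)"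
  shows "F \<in> H1"
proof -
  note l = primitive_locally_integrable[OF F]
  have L: "F \<in> L2w 0" "f \<in> L2w 0"
    using assms l locally_integrable_measurable unfolding L2w_0_iff by blast+
  have "\<exists>g. has_weak_deriv k F g \<and> g \<in> L2w 0" if "k \<le> 1" for k
  proof (cases "k = 0")
    case True then show ?thesis using has_weak_deriv_self[OF l(1)] L(1) by blast
  next
    case False then show ?thesis using has_weak_deriv_primitive[OF F] L(2) that by (intro exI[of _ f]) (simp add: le_Suc_eq)
  qed
  then show ?thesis unfolding sobolev_def by blast
qed

text \<open>At the left end the cut-off depends on \<open>n x\<close>, so that its derivative is of size \<open>1/x\<close> uniformly in \<open>n\<close>.\<close>

definition cutoff :: "nat \<Rightarrow> real \<Rightarrow> real" where
  "cutoff n x = flat (real n * x - 1) * flat (real n - x)"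

lemma filterlim_cutoff_arguments:
  "x > 0 \<Longrightarrow> filterlim (\<lambda>n. real n * x - 1) at_top sequentially"
  "filterlim (\<lambda>n. real n - x) at_top sequentially"
proof -
  show "filterlim (\<lambda>n. real n * x - 1) at_top sequentially" if "x > 0"
  proof -
    have "filterlim (\<lambda>n. real n * x) at_top sequentially"
      using that by (intro filterlim_at_top_mult_tendsto_pos[OF tendsto_const _ filterlim_real_sequentially])
    from filterlim_tendsto_add_at_top[OF tendsto_const[of "- 1"] this] show ?thesis by simp
  qed
  show "filterlim (\<lambda>n. real n - x) at_top sequentially"
    using filterlim_tendsto_add_at_top[OF tendsto_const[of "- x"] filterlim_real_sequentially] by simp
qed

lemma cutoff_tendsto: "x > 0 \<Longrightarrow> (\<lambda>n. cutoff n x) \<longlonglongrightarrow> 1"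
proof -
  assume "x > 0"
  then have "(\<lambda>n. cutoff n x) \<longlonglongrightarrow> 1 * 1"
    unfolding cutoff_def by (intro tendsto_mult filterlim_compose[OF flat_tendsto_1] filterlim_cutoff_arguments)
  then show ?thesis by simp
qed

lemma cutoff_bounds: "0 \<le> cutoff n x" "cutoff n x \<le> 1"
  unfolding cutoff_def using flat_bounds by (auto intro: mult_le_one)

lemma cutoff_eq_0: "x \<notin> {1 / real (Suc n)..real n} \<Longrightarrow> cutoff n x = 0"
proof -
  assume x: "x \<notin> {1 / real (Suc n)..real n}"
  have "real n * x - 1 \<le> 0 \<or> real n - x \<le> 0"
  proof (cases "x \<le> real n")
    case True
    then have "x < 1 / real (Suc n)" using x by auto
    then have "real (Suc n) * x < 1" by (simp add: pos_less_divide_eq mult.commute del: of_nat_Suc)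
    moreover have "real n * x \<le> real (Suc n) * x \<or> real n * x \<le> 0"
      by (cases "x \<ge> 0") (auto intro: mult_right_mono mult_nonneg_nonpos)
    ultimately show ?thesis by linarith
  qed simp
  then show ?thesis by (auto simp: cutoff_def flat_eq_0)
qed

lemma smooth_cutoff: "smooth (cutoff n)"
proof -
  have "smooth (\<lambda>x. flat (real n * x + (- 1)) * flat ((- 1) * x + real n))"
    by (intro smooth_mult smooth_affine smooth_flat_poly)
  then show ?thesis by (simp add: cutoff_def[abs_def])
qed

definition flat' :: "real \<Rightarrow> real" where "flat' = flat_poly [:0, 0, 1:]"

lemma flat_deriv: "(flat has_real_derivative flat' x) (at x)"
  using flat_poly_deriv[of 1 x] by (simp add: flat'_def)

lemma flat'_nonneg: "0 \<le> flat' s"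
  by (simp add: flat'_def flat_poly_def)

lemma flat'_bounds:
  shows "flat' s \<le> 2" "s * flat' s \<le> 1"
    and "s > 0 \<Longrightarrow> flat' s \<le> (1 / s)\<^sup>2" "s > 0 \<Longrightarrow> s * flat' s \<le> 1 / s"
proof -
  have eq: "flat' s = (1 / s)\<^sup>2 * exp (- (1 / s))" if "s > 0" for s
    using that by (simp add: flat'_def flat_poly_def power2_eq_square)
  have e1: "y\<^sup>2 * exp (- y) \<le> 2" "y * exp (- y) \<le> 1" if "y > 0" for y :: real
  proof -
    have "1 + y + y\<^sup>2 / 2 \<le> exp y" using that by (intro exp_lower_Taylor_quadratic) simp
    then have "y\<^sup>2 \<le> 2 * exp y" "y \<le> exp y" using that zero_le_power2[of y] by linarith+
    then show "y\<^sup>2 * exp (- y) \<le> 2" "y * exp (- y) \<le> 1"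
      by (simp_all add: exp_minus divide_inverse[symmetric] pos_divide_le_eq)
  qed
  show "flat' s \<le> 2" "s * flat' s \<le> 1"
    using eq[of s] e1[of "1 / s"] by (cases "s > 0"; simp add: flat'_def flat_poly_def power2_eq_square mult_ac)+
  assume s: "s > 0"
  then show "flat' s \<le> (1 / s)\<^sup>2" using eq[OF s] by (simp add: mult_le_cancel_left1 mult_left_le)
  then have "s * flat' s \<le> s * (1 / s)\<^sup>2" using s by (intro mult_left_mono) auto
  then show "s * flat' s \<le> 1 / s" using s by (simp add: power2_eq_square)
qed

text \<open>Cutting off gives test functions. The derivative of the cut-off is of size \<open>1/x\<close> near \<open>0\<close>, which
  \<open>v(0) = 0\<close> compensates, so that both \<open>v\<close> and \<open>v'\<close> converge by dominated convergence.\<close>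

lemma expoly_in_H10:
  assumes b: "b > 0" and p0: "poly p 0 = 0"
  shows "expoly b p \<in> H10"
proof -
  define v where "v = expoly b p"
  define v' where "v' = expoly b (pderiv p - smult b p)"
  obtain q where q: "p = [:0, 1:] * q" using p0 by (metis dvdE minus_zero poly_eq_0_iff_dvd)
  define w where "w = expoly b q"
  have vw: "v x = x * w x" for x by (simp add: v_def w_def q expoly_def algebra_simps)
  have dv: "(v has_real_derivative v' x) (at x)" for x unfolding v_def v'_def by (rule expoly_deriv)
  have [measurable]: "v \<in> borel_measurable halfline" "v' \<in> borel_measurable halfline"
    "w \<in> borel_measurable halfline" unfolding v_def v'_def w_def by measurable
  have sq: "integrable halfline (\<lambda>x. (v x)\<^sup>2)" "integrable halfline (\<lambda>x. (v' x)\<^sup>2)"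
    "integrable halfline (\<lambda>x. (w x)\<^sup>2)"
    unfolding v_def v'_def w_def by (rule integrable_expoly_square[OF b])+
  define cut' where "cut' n x = real n * flat' (real n * x - 1) * flat (real n - x)
      - flat (real n * x - 1) * flat' (real n - x)" for n x
  have dcut: "(cutoff n has_real_derivative cut' n x) (at x)" for n x
    unfolding cutoff_def[abs_def] cut'_def
    by (rule derivative_eq_intros DERIV_chain2[OF flat_deriv] refl)+ simp
  define \<phi> where "\<phi> n x = v x * cutoff n x" for n x
  have d\<phi>: "((\<lambda>x. v x - \<phi> n x) has_real_derivative (v' x * (1 - cutoff n x) - v x * cut' n x)) (at x)" for n x
    unfolding \<phi>_def by (rule derivative_eq_intros dv dcut refl)+ (simp add: algebra_simps)
  have test: "test_function (\<phi> n)" for n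
  proof -
    have "smooth (\<phi> n)"
      unfolding \<phi>_def v_def expoly_def by (intro smooth_mult smooth_exp_poly smooth_cutoff)
    moreover have "\<phi> n x = 0" if "x \<notin> {1 / real (Suc n)..real n}" for x
      using cutoff_eq_0[OF that] by (simp add: \<phi>_def)
    moreover have "0 < 1 / real (Suc n)" by simp
    ultimately show ?thesis unfolding test_function_iff by blast
  qed
  have cont: "continuous_on S (cutoff n)" "continuous_on S (cut' n)" for S n
  proof -
    show "continuous_on S (cutoff n)" by (rule smooth_continuous[OF smooth_cutoff])
    have "continuous_on T (flat_poly r)" for T r by (rule smooth_continuous[OF smooth_flat_poly])
    note c = continuous_on_compose2[OF this[of UNIV]]
    show "continuous_on S (cut' n)" unfolding cut'_def[abs_def] flat'_def by (intro continuous_intros c) auto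
  qed
  have [measurable]: "cutoff n \<in> borel_measurable halfline" "cut' n \<in> borel_measurable halfline" for n
    by (intro measurable_lebesgue_on_continuous cont halfline_sets)+
  note lin = filterlim_cutoff_arguments
  have inv0: "((\<lambda>s::real. 1 / s) \<longlongrightarrow> 0) at_top"
    using tendsto_inverse_0_at_top[OF filterlim_ident] by (simp add: inverse_eq_divide)
  have f'0: "(flat' \<longlongrightarrow> 0) at_top"
  proof (rule tendsto_sandwich[OF _ _ tendsto_const])
    show "eventually (\<lambda>s. flat' s \<le> (1 / s)\<^sup>2) at_top"
      using eventually_gt_at_top[of 0] by eventually_elim (rule flat'_bounds(3))
    show "((\<lambda>s::real. (1 / s)\<^sup>2) \<longlongrightarrow> 0) at_top" using tendsto_power[OF inv0, of 2] by simp
  qed (simp add: flat'_nonneg)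
  have sf'0: "((\<lambda>s. s * flat' s) \<longlongrightarrow> 0) at_top"
  proof (rule tendsto_sandwich[OF _ _ tendsto_const inv0])
    show "eventually (\<lambda>s. s * flat' s \<le> 1 / s) at_top"
      using eventually_gt_at_top[of 0] by eventually_elim (rule flat'_bounds(4))
    show "eventually (\<lambda>s. 0 \<le> s * flat' s) at_top"
      using eventually_gt_at_top[of 0] by eventually_elim (simp add: flat'_nonneg)
  qed
  \<comment> \<open>The factor \<open>n x\<close> is written as \<open>s + 1\<close> with \<open>s = n x - 1\<close>, the argument of \<open>flat'\<close>.\<close>
  have vcut': "v x * cut' n x = w x * ((real n * x - 1) * flat' (real n * x - 1) + flat' (real n * x - 1)) * flat (real n - x)
      - v x * flat (real n * x - 1) * flat' (real n - x)" for n x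
    by (simp add: cut'_def vw algebra_simps)
  have vcut'lim: "(\<lambda>n. v x * cut' n x) \<longlonglongrightarrow> 0" if "x > 0" for x
  proof -
    have "(\<lambda>n. v x * cut' n x) \<longlonglongrightarrow> w x * (0 + 0) * 1 - v x * 1 * 0"
      unfolding vcut' by (intro tendsto_intros filterlim_compose[OF flat_tendsto_1] filterlim_compose[OF f'0]
          filterlim_compose[OF sf'0] lin that)
    then show ?thesis by simp
  qed
  have vcut'le: "\<bar>v x * cut' n x\<bar> \<le> 3 * \<bar>w x\<bar> + 2 * \<bar>v x\<bar>" if "x > 0" for n x
  proof -
    let ?s = "real n * x - 1"
    have "- 1 \<le> ?s" using that by simp
    have "\<bar>?s * flat' ?s\<bar> \<le> 1"
    proof (cases "?s \<ge> 0")
      case True then show ?thesis using flat'_bounds(2)[of ?s] flat'_nonneg[of ?s] by simp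
    qed (simp add: flat'_def flat_poly_def)
    then have "\<bar>?s * flat' ?s + flat' ?s\<bar> \<le> 3"
      using flat'_bounds(1)[of ?s] flat'_nonneg[of ?s] by linarith
    then have "\<bar>w x * (?s * flat' ?s + flat' ?s) * flat (real n - x)\<bar> \<le> \<bar>w x\<bar> * 3 * 1"
      unfolding abs_mult using flat_bounds[of "real n - x"] by (intro mult_mono) auto
    moreover have "\<bar>v x * flat ?s * flat' (real n - x)\<bar> \<le> \<bar>v x\<bar> * 1 * 2"
      unfolding abs_mult using flat_bounds[of ?s] flat'_bounds(1)[of "real n - x"] flat'_nonneg[of "real n - x"]
      by (intro mult_mono) auto
    ultimately show ?thesis unfolding vcut' by linarith
  qed
  have sq_add: "(s + t)\<^sup>2 \<le> 2 * s\<^sup>2 + 2 * t\<^sup>2" for s t :: real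
    using zero_le_power2[of "s - t"] by (simp add: power2_eq_square algebra_simps)
  have L0: "(\<lambda>n. LINT x|halfline. (v x - \<phi> n x)\<^sup>2) \<longlonglongrightarrow> (LINT x|halfline. 0)"
  proof (rule integral_dominated_convergence[where w = "\<lambda>x. (v x)\<^sup>2"])
    show "AE x in halfline. (\<lambda>n. (v x - \<phi> n x)\<^sup>2) \<longlonglongrightarrow> 0"
    proof (rule AE_I2)
      fix x assume "x \<in> space halfline"
      then have "(\<lambda>n. (v x - v x * cutoff n x)\<^sup>2) \<longlonglongrightarrow> (v x - v x * 1)\<^sup>2"
        by (intro tendsto_intros cutoff_tendsto) simp
      then show "(\<lambda>n. (v x - \<phi> n x)\<^sup>2) \<longlonglongrightarrow> 0" by (simp add: \<phi>_def)
    qed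
    show "AE x in halfline. norm ((v x - \<phi> n x)\<^sup>2) \<le> (v x)\<^sup>2" for n
    proof (rule AE_I2)
      fix x
      have "\<bar>v x - \<phi> n x\<bar> = \<bar>v x\<bar> * (1 - cutoff n x)"
        using cutoff_bounds[of n x] by (simp add: \<phi>_def abs_mult right_diff_distrib[symmetric] flip: abs_mult_pos)
          (metis abs_mult abs_of_nonneg diff_ge_0_iff_ge mult.right_neutral right_diff_distrib')
      also have "\<dots> \<le> \<bar>v x\<bar>" using cutoff_bounds[of n x] by (intro mult_left_le) auto
      finally show "norm ((v x - \<phi> n x)\<^sup>2) \<le> (v x)\<^sup>2" by (simp add: abs_le_square_iff)
    qed
  qed (use sq in \<open>auto simp: \<phi>_def[abs_def]\<close>)
  have L1: "(\<lambda>n. LINT x|halfline. (v' x * (1 - cutoff n x) - v x * cut' n x)\<^sup>2) \<longlonglongrightarrow> (LINT x|halfline. 0)"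
  proof (rule integral_dominated_convergence[where w = "\<lambda>x. 2 * (v' x)\<^sup>2 + 2 * (18 * (w x)\<^sup>2 + 8 * (v x)\<^sup>2)"])
    show "AE x in halfline. (\<lambda>n. (v' x * (1 - cutoff n x) - v x * cut' n x)\<^sup>2) \<longlonglongrightarrow> 0"
    proof (rule AE_I2)
      fix x assume "x \<in> space halfline"
      then have "(\<lambda>n. (v' x * (1 - cutoff n x) - v x * cut' n x)\<^sup>2) \<longlonglongrightarrow> (v' x * (1 - 1) - 0)\<^sup>2"
        by (intro tendsto_power tendsto_diff tendsto_mult tendsto_const cutoff_tendsto vcut'lim) simp_all
      then show "(\<lambda>n. (v' x * (1 - cutoff n x) - v x * cut' n x)\<^sup>2) \<longlonglongrightarrow> 0" by simp
    qed
    show "AE x in halfline. norm ((v' x * (1 - cutoff n x) - v x * cut' n x)\<^sup>2)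
        \<le> 2 * (v' x)\<^sup>2 + 2 * (18 * (w x)\<^sup>2 + 8 * (v x)\<^sup>2)" for n
    proof (rule AE_I2)
      fix x assume "x \<in> space halfline"
      then have x: "x > 0" by simp
      have "(v' x * (1 - cutoff n x) + - (v x * cut' n x))\<^sup>2 \<le> 2 * (v' x * (1 - cutoff n x))\<^sup>2 + 2 * (- (v x * cut' n x))\<^sup>2"
        by (rule sq_add)
      moreover have "(v' x * (1 - cutoff n x))\<^sup>2 \<le> (v' x)\<^sup>2"
      proof -
        have "(1 - cutoff n x)\<^sup>2 \<le> 1" using cutoff_bounds[of n x] by (intro power_le_one) auto
        then show ?thesis by (simp add: power_mult_distrib mult_left_le)
      qed
      moreover have "(v x * cut' n x)\<^sup>2 \<le> 18 * (w x)\<^sup>2 + 8 * (v x)\<^sup>2"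
      proof -
        have "\<bar>v x * cut' n x\<bar>\<^sup>2 \<le> (3 * \<bar>w x\<bar> + 2 * \<bar>v x\<bar>)\<^sup>2"
          by (intro power_mono vcut'le x) simp
        also have "\<dots> \<le> 2 * (3 * \<bar>w x\<bar>)\<^sup>2 + 2 * (2 * \<bar>v x\<bar>)\<^sup>2" by (rule sq_add)
        finally show ?thesis by (simp add: power_mult_distrib)
      qed
      ultimately show "norm ((v' x * (1 - cutoff n x) - v x * cut' n x)\<^sup>2)
        \<le> 2 * (v' x)\<^sup>2 + 2 * (18 * (w x)\<^sup>2 + 8 * (v x)\<^sup>2)" by simp
    qed
  qed (use sq in auto)
  have prim: "primitive (\<lambda>x. v x - \<phi> n x) (\<lambda>x. v' x * (1 - cutoff n x) - v x * cut' n x)" for n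
  proof (rule primitive_C1[OF d\<phi>])
    show "continuous_on {0<..} (\<lambda>x. v' x * (1 - cutoff n x) - v x * cut' n x)"
      unfolding v_def v'_def by (intro continuous_intros cont expoly_continuous)
  qed
  have "norm_H1 (\<lambda>x. v x - \<phi> n x) = sqrt ((LINT x|halfline. (v x - \<phi> n x)\<^sup>2)
      + (LINT x|halfline. (v' x * (1 - cutoff n x) - v x * cut' n x)\<^sup>2))" for n
    unfolding norm_H1_def normw_weak_deriv[OF has_weak_deriv_primitive[OF prim]] normw_0_square ..
  moreover have "(\<lambda>n. sqrt ((LINT x|halfline. (v x - \<phi> n x)\<^sup>2)
      + (LINT x|halfline. (v' x * (1 - cutoff n x) - v x * cut' n x)\<^sup>2))) \<longlonglongrightarrow> sqrt (0 + 0)"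
    using L0 L1 by (intro tendsto_intros) simp_all
  ultimately have "(\<lambda>n. norm_H1 (\<lambda>x. v x - \<phi> n x)) \<longlonglongrightarrow> 0" by simp
  moreover have "v \<in> H1"
    using primitive_in_H1[OF primitive_expoly, of b p] sq unfolding v_def v'_def by blast
  ultimately have "v \<in> H10" unfolding H10_def using test by blast
  then show ?thesis by (simp add: v_def)
qed

section \<open>Weighted inner products\<close>

lemma weighted_Cauchy_Schwarz:
  fixes u v \<omega> :: "'a \<Rightarrow> real"
  assumes m: "u \<in> borel_measurable M" "v \<in> borel_measurable M" "\<omega> \<in> borel_measurable M"
    and \<omega>: "\<And>x. x \<in> space M \<Longrightarrow> 0 \<le> \<omega> x"
    and i: "integrable M (\<lambda>x. (u x)\<^sup>2 * \<omega> x)" "integrable M (\<lambda>x. (v x)\<^sup>2 * \<omega> x)"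
  shows "integrable M (\<lambda>x. u x * v x * \<omega> x)"
    and "(LINT x|M. u x * v x * \<omega> x)\<^sup>2 \<le> (LINT x|M. (u x)\<^sup>2 * \<omega> x) * (LINT x|M. (v x)\<^sup>2 * \<omega> x)"
proof -
  have [measurable]: "u \<in> borel_measurable M" "v \<in> borel_measurable M" "\<omega> \<in> borel_measurable M" by fact+
  let ?u = "\<lambda>x. u x * sqrt (\<omega> x)" and ?v = "\<lambda>x. v x * sqrt (\<omega> x)"
  have eq: "(?u x)\<^sup>2 = (u x)\<^sup>2 * \<omega> x" "(?v x)\<^sup>2 = (v x)\<^sup>2 * \<omega> x" "?u x * ?v x = u x * v x * \<omega> x"
    if "x \<in> space M" for x
  proof -
    have "sqrt (\<omega> x) * sqrt (\<omega> x) = \<omega> x" using \<omega>[OF that] by simp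
    then show "?u x * ?v x = u x * v x * \<omega> x" by (simp add: mult_ac)
  qed (use \<omega>[OF that] in \<open>simp_all add: power_mult_distrib\<close>)
  have cong: "integrable M (\<lambda>x. (?u x)\<^sup>2) = integrable M (\<lambda>x. (u x)\<^sup>2 * \<omega> x)"
    "integrable M (\<lambda>x. (?v x)\<^sup>2) = integrable M (\<lambda>x. (v x)\<^sup>2 * \<omega> x)"
    "integrable M (\<lambda>x. ?u x * ?v x) = integrable M (\<lambda>x. u x * v x * \<omega> x)"
    "(LINT x|M. (?u x)\<^sup>2) = (LINT x|M. (u x)\<^sup>2 * \<omega> x)"
    "(LINT x|M. (?v x)\<^sup>2) = (LINT x|M. (v x)\<^sup>2 * \<omega> x)"
    "(LINT x|M. ?u x * ?v x) = (LINT x|M. u x * v x * \<omega> x)"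
    by (intro Bochner_Integration.integrable_cong Bochner_Integration.integral_cong refl eq; assumption)+
  have mm: "?u \<in> borel_measurable M" "?v \<in> borel_measurable M" by measurable
  have ii: "integrable M (\<lambda>x. (?u x)\<^sup>2)" "integrable M (\<lambda>x. (?v x)\<^sup>2)"
    unfolding cong by (rule i)+
  from integrable_product_of_squares[OF mm ii] show "integrable M (\<lambda>x. u x * v x * \<omega> x)"
    unfolding cong .
  from Cauchy_Schwarz_integral[OF mm ii]
  show "(LINT x|M. u x * v x * \<omega> x)\<^sup>2 \<le> (LINT x|M. (u x)\<^sup>2 * \<omega> x) * (LINT x|M. (v x)\<^sup>2 * \<omega> x)"
    unfolding cong .
qed

text \<open>The coefficients are left free: the expansion is needed for the orthogonal projection, for Bessel's
  inequality, and for an arbitrary polynomial expressed in the Laguerre basis.\<close>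

lemma orthogonal_expansion:
  fixes f \<omega> :: "'a \<Rightarrow> real" and g :: "nat \<Rightarrow> 'a \<Rightarrow> real"
  assumes "finite S"
    and m: "f \<in> borel_measurable M" "\<And>n. g n \<in> borel_measurable M" "\<omega> \<in> borel_measurable M"
    and \<omega>: "\<And>x. x \<in> space M \<Longrightarrow> 0 \<le> \<omega> x"
    and i: "integrable M (\<lambda>x. (f x)\<^sup>2 * \<omega> x)" "\<And>n. n \<in> S \<Longrightarrow> integrable M (\<lambda>x. (g n x)\<^sup>2 * \<omega> x)"
    and orth: "\<And>n k. n \<in> S \<Longrightarrow> k \<in> S \<Longrightarrow> n \<noteq> k \<Longrightarrow> (LINT x|M. g n x * g k x * \<omega> x) = 0"
  shows "integrable M (\<lambda>x. (f x - (\<Sum>n\<in>S. a n * g n x))\<^sup>2 * \<omega> x) \<and>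
    (LINT x|M. (f x - (\<Sum>n\<in>S. a n * g n x))\<^sup>2 * \<omega> x) = (LINT x|M. (f x)\<^sup>2 * \<omega> x)
      + (\<Sum>n\<in>S. (a n)\<^sup>2 * (LINT x|M. (g n x)\<^sup>2 * \<omega> x) - 2 * a n * (LINT x|M. f x * g n x * \<omega> x))"
  using assms(1) i(2) orth
proof (induction S rule: finite_induct)
  case empty
  then show ?case using i(1) by simp
next
  case (insert k S)
  define R where "R x = f x - (\<Sum>n\<in>S. a n * g n x)" for x
  have [measurable]: "f \<in> borel_measurable M" "\<And>n. g n \<in> borel_measurable M" "\<omega> \<in> borel_measurable M" by fact+
  have Rm [measurable]: "R \<in> borel_measurable M" unfolding R_def by measurable
  have IH: "integrable M (\<lambda>x. (R x)\<^sup>2 * \<omega> x)" "(LINT x|M. (R x)\<^sup>2 * \<omega> x) = (LINT x|M. (f x)\<^sup>2 * \<omega> x)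
      + (\<Sum>n\<in>S. (a n)\<^sup>2 * (LINT x|M. (g n x)\<^sup>2 * \<omega> x) - 2 * a n * (LINT x|M. f x * g n x * \<omega> x))"
    using insert.IH insert.prems unfolding R_def by blast+
  have gi: "integrable M (\<lambda>x. (g n x)\<^sup>2 * \<omega> x)" if "n \<in> insert k S" for n using insert.prems(1)[OF that] .
  note prod = weighted_Cauchy_Schwarz(1)[OF _ _ m(3) \<omega>]
  have Rg: "integrable M (\<lambda>x. R x * g k x * \<omega> x)" by (intro prod Rm m IH gi) auto
  have fg: "integrable M (\<lambda>x. f x * g k x * \<omega> x)" by (intro prod m i gi) auto
  have gg: "integrable M (\<lambda>x. g n x * g k x * \<omega> x)" if "n \<in> S" for n
    using that by (intro prod m gi) auto
  have "(LINT x|M. R x * g k x * \<omega> x) = (LINT x|M. f x * g k x * \<omega> x - (\<Sum>n\<in>S. a n * (g n x * g k x * \<omega> x)))"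
    by (intro Bochner_Integration.integral_cong refl)
      (simp add: R_def left_diff_distrib sum_distrib_right mult.assoc)
  also have "\<dots> = (LINT x|M. f x * g k x * \<omega> x) - (\<Sum>n\<in>S. a n * (LINT x|M. g n x * g k x * \<omega> x))"
    using fg gg by (subst Bochner_Integration.integral_diff) (auto simp: Bochner_Integration.integral_sum)
  also have "(\<Sum>n\<in>S. a n * (LINT x|M. g n x * g k x * \<omega> x)) = 0"
  proof (rule sum.neutral, rule ballI)
    fix n assume "n \<in> S"
    then have "n \<noteq> k" using insert.hyps by auto
    then show "a n * (LINT x|M. g n x * g k x * \<omega> x) = 0" using insert.prems(2)[of n k] \<open>n \<in> S\<close> by simp
  qed
  finally have Rf: "(LINT x|M. R x * g k x * \<omega> x) = (LINT x|M. f x * g k x * \<omega> x)" by simp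
  have eq: "(f x - (\<Sum>n\<in>insert k S. a n * g n x))\<^sup>2 * \<omega> x
      = (R x)\<^sup>2 * \<omega> x + (a k)\<^sup>2 * ((g k x)\<^sup>2 * \<omega> x) - 2 * a k * (R x * g k x * \<omega> x)" for x
  proof -
    have split: "f x - (\<Sum>n\<in>insert k S. a n * g n x) = R x - a k * g k x"
      using insert.hyps by (simp add: R_def)
    show ?thesis unfolding split by (simp add: power2_eq_square algebra_simps)
  qed
  show ?case
    unfolding eq using IH(1) Rg gi[of k]
    by (simp add: IH(2) Rf insert.hyps)
qed

section \<open>Laguerre polynomials\<close>

definition laguerre :: "real \<Rightarrow> nat \<Rightarrow> real poly" where
  "laguerre \<beta> n = (\<Sum>k\<le>n. monom ((- \<beta>) ^ k * real (n choose k) / fact k) k)"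

lemma coeff_laguerre: "coeff (laguerre \<beta> n) k = (- \<beta>) ^ k * real (n choose k) / fact k"
  by (simp add: laguerre_def coeff_sum)

lemma degree_laguerre: "degree (laguerre \<beta> n) \<le> n"
  by (intro degree_le) (simp add: coeff_laguerre)

text \<open>Differentiating Laguerre's equation raises the parameter of the weight: the derivative of order \<open>j\<close>
  is an eigenfunction of the operator that is symmetric for the weight \<open>x\<^sup>j exp (-\<beta>x)\<close>.\<close>

lemma laguerre_ode:
  fixes \<beta> :: real
  defines "d \<equiv> \<lambda>j n. (pderiv ^^ j) (laguerre \<beta> n)"
  shows "[:0, 1:] * pderiv (d (Suc j) n) + [:real j + 1, - \<beta>:] * d (Suc j) n
    = smult (- (\<beta> * (real n - real j))) (d j n)"
proof (induction j)
  case 0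
  have "coeff ([:0, 1:] * pderiv (d 1 n) + [:1, - \<beta>:] * d 1 n) k = coeff (smult (- (\<beta> * real n)) (d 0 n)) k" for k
  proof -
    define a where "a i = (- \<beta>) ^ i * real (n choose i) / fact i" for i
    have rec: "(real k + 1)\<^sup>2 * a (Suc k) = - \<beta> * (real n - real k) * a k"
    proof -
      have binom: "(real k + 1) * real (n choose Suc k) = (real n - real k) * real (n choose k)"
      proof (cases "k \<le> n")
        case True
        have "Suc k * (n choose Suc k) = (n - k) * (n choose k)"
          by (metis binomial_absorb_comp binomial_absorption mult.commute)
        then have "real (Suc k * (n choose Suc k)) = real ((n - k) * (n choose k))" by simp
        then show ?thesis using True by (simp add: of_nat_diff algebra_simps)
      qed (simp add: binomial_eq_0)
      have "(real k + 1)\<^sup>2 * a (Suc k) = (real k + 1)\<^sup>2 * ((- \<beta>) ^ Suc k * real (n choose Suc k) / ((real k + 1) * fact k))"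
        by (simp add: a_def add.commute del: power_Suc)
      also have "\<dots> = (- \<beta>) ^ Suc k * ((real k + 1) * real (n choose Suc k)) / fact k"
        by (simp add: power2_eq_square del: power_Suc)
      also have "\<dots> = - \<beta> * (real n - real k) * a k"
        unfolding binom by (simp add: a_def)
      finally show ?thesis .
    qed
    have c: "coeff (laguerre \<beta> n) i = a i" for i by (simp add: coeff_laguerre a_def)
    show ?thesis
    proof (cases k)
      case 0
      then show ?thesis using rec by (simp add: d_def coeff_pderiv c)
    next
      case (Suc i)
      have "coeff ([:0, 1:] * pderiv (d 1 n) + [:1, - \<beta>:] * d 1 n) k
          = (real k + 1)\<^sup>2 * a (Suc k) - \<beta> * real k * a k"
        using Suc by (simp add: d_def coeff_pderiv c power2_eq_square algebra_simps)
      then show ?thesis using rec by (simp add: d_def c algebra_simps)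
    qed
  qed
  then show ?case by (intro poly_eqI) (simp add: d_def)
next
  case (Suc j)
  have S: "d (Suc i) n = pderiv (d i n)" for i by (simp add: d_def)
  have L: "poly (pderiv ([:0, 1:] * A + [:c, - \<beta>:] * B)) x
      = poly A x + x * poly (pderiv A) x - \<beta> * poly B x + (c - \<beta> * x) * poly (pderiv B) x" for A B c x
    by (simp add: pderiv_add pderiv_mult pderiv_pCons pderiv_smult pderiv_minus algebra_simps)
  have R: "poly (pderiv (smult c A)) x = c * poly (pderiv A) x" for A c x
    by (simp only: pderiv_smult poly_smult)
  have "poly ([:0, 1:] * pderiv (d (Suc (Suc j)) n) + [:real (Suc j) + 1, - \<beta>:] * d (Suc (Suc j)) n) x
    = poly (smult (- (\<beta> * (real n - real (Suc j)))) (d (Suc j) n)) x" for x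
  proof -
    have "poly (pderiv ([:0, 1:] * pderiv (d (Suc j) n) + [:real j + 1, - \<beta>:] * d (Suc j) n)) x
      = poly (pderiv (smult (- (\<beta> * (real n - real j))) (d j n))) x" using Suc by simp
    then show ?thesis unfolding L R S[symmetric] by (simp add: algebra_simps)
  qed
  then show ?case by (simp add: poly_eq_poly_eq_iff[symmetric] fun_eq_iff)
qed

definition laguerre_weight :: "real \<Rightarrow> nat \<Rightarrow> real \<Rightarrow> real" where
  "laguerre_weight \<beta> j x = x ^ j * exp (- \<beta> * x)"

lemma laguerre_weight_measurable [measurable]: "laguerre_weight \<beta> j \<in> borel_measurable halfline"
  unfolding laguerre_weight_def
  by (rule measurable_lebesgue_on_continuous) (auto intro!: continuous_intros)

lemma laguerre_weight_nonneg: "x > 0 \<Longrightarrow> 0 \<le> laguerre_weight \<beta> j x"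
  by (simp add: laguerre_weight_def)

lemma poly_measurable_halfline [measurable]: "poly (p :: real poly) \<in> borel_measurable halfline"
  by (rule measurable_lebesgue_on_continuous) (auto intro!: continuous_intros)

lemma integrable_poly_weight:
  assumes "\<beta> > 0"
  shows "integrable halfline (\<lambda>x. poly p x * laguerre_weight \<beta> j x)"
    and "integrable halfline (\<lambda>x. (poly p x)\<^sup>2 * laguerre_weight \<beta> j x)"
proof -
  have "(\<lambda>x. poly q x * laguerre_weight \<beta> j x) = expoly \<beta> (monom 1 j * q)" for q
    by (simp add: fun_eq_iff expoly_def laguerre_weight_def poly_monom)
  then have *: "integrable halfline (\<lambda>x. poly q x * laguerre_weight \<beta> j x)" for q
    using integrable_expoly[OF assms] by simp
  show "integrable halfline (\<lambda>x. poly p x * laguerre_weight \<beta> j x)" by (rule *)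
  show "integrable halfline (\<lambda>x. (poly p x)\<^sup>2 * laguerre_weight \<beta> j x)"
    using *[of "p * p"] by (simp add: power2_eq_square)
qed

lemma weighted_poly_product:
  assumes "\<beta> > 0" "h \<in> borel_measurable halfline"
    "integrable halfline (\<lambda>x. (h x)\<^sup>2 * laguerre_weight \<beta> j x)"
  shows "integrable halfline (\<lambda>x. h x * poly q x * laguerre_weight \<beta> j x)"
  using assms by (intro weighted_Cauchy_Schwarz(1) integrable_poly_weight(2)) (auto simp: laguerre_weight_nonneg)

text \<open>The boundary terms vanish without any assumption on \<open>h\<close> at the ends: divided by \<open>x\<close>, the product
  \<open>W\<close> is again an inner product of \<open>h\<close> with a polynomial for the weight \<open>x\<^sup>j exp (-\<beta>x)\<close>.\<close>

lemma laguerre_parts: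
  fixes \<beta> :: real
  defines "d \<equiv> \<lambda>j n. (pderiv ^^ j) (laguerre \<beta> n)"
  assumes \<beta>: "\<beta> > 0" and h: "primitive h h'" "h' \<in> borel_measurable halfline"
    and i: "integrable halfline (\<lambda>x. (h x)\<^sup>2 * laguerre_weight \<beta> j x)"
    and i': "integrable halfline (\<lambda>x. (h' x)\<^sup>2 * laguerre_weight \<beta> (Suc j) x)"
  shows "(LINT x|halfline. h' x * poly (d (Suc j) n) x * laguerre_weight \<beta> (Suc j) x)
    = \<beta> * (real n - real j) * (LINT x|halfline. h x * poly (d j n) x * laguerre_weight \<beta> j x)"
proof -
  have hm: "h \<in> borel_measurable halfline" by (rule primitive_measurable[OF h(1)])
  define P where "P = monom 1 (Suc j) * d (Suc j) n"
  have P: "expoly \<beta> P x = poly (d (Suc j) n) x * laguerre_weight \<beta> (Suc j) x" for x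
    by (simp add: P_def expoly_def laguerre_weight_def poly_monom mult_ac)
  have P': "expoly \<beta> (pderiv P - smult \<beta> P) x
      = - (\<beta> * (real n - real j)) * (poly (d j n) x * laguerre_weight \<beta> j x)" for x
  proof -
    have "poly ([:0, 1:] * pderiv (d (Suc j) n) + [:real j + 1, - \<beta>:] * d (Suc j) n) x
      = poly (smult (- (\<beta> * (real n - real j))) (d j n)) x"
      unfolding d_def by (simp only: laguerre_ode)
    then have ode: "x * poly (pderiv (d (Suc j) n)) x + (real j + 1 - \<beta> * x) * poly (d (Suc j) n) x
        = - (\<beta> * (real n - real j)) * poly (d j n) x"
      by (simp add: algebra_simps)
    have "poly (pderiv P - smult \<beta> P) x = x ^ j * (x * poly (pderiv (d (Suc j) n)) x + (real j + 1 - \<beta> * x) * poly (d (Suc j) n) x)"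
      by (simp add: P_def pderiv_mult pderiv_monom poly_monom algebra_simps)
    then show ?thesis unfolding ode by (simp add: expoly_def laguerre_weight_def mult_ac)
  qed
  define W where "W x = h x * expoly \<beta> P x" for x
  have prim: "primitive W (\<lambda>x. h' x * expoly \<beta> P x + h x * expoly \<beta> (pderiv P - smult \<beta> P) x)"
    unfolding W_def by (rule primitive_mult[OF h(1) primitive_expoly])
  have i1: "integrable halfline (\<lambda>x. h' x * poly (d (Suc j) n) x * laguerre_weight \<beta> (Suc j) x)"
    by (rule weighted_poly_product[OF \<beta> h(2) i'])
  have i0: "integrable halfline (\<lambda>x. h x * poly q x * laguerre_weight \<beta> j x)" for q
    by (rule weighted_poly_product[OF \<beta> hm i])
  have "integrable halfline (\<lambda>x. W x / x) = integrable halfline (\<lambda>x. h x * poly (d (Suc j) n) x * laguerre_weight \<beta> j x)"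
    by (intro Bochner_Integration.integrable_cong) (auto simp: W_def P laguerre_weight_def)
  then have Wx: "integrable halfline (\<lambda>x. W x / x)" using i0 by simp
  have w_eq: "(\<lambda>x. h' x * expoly \<beta> P x + h x * expoly \<beta> (pderiv P - smult \<beta> P) x)
      = (\<lambda>x. h' x * poly (d (Suc j) n) x * laguerre_weight \<beta> (Suc j) x
          - \<beta> * (real n - real j) * (h x * poly (d j n) x * laguerre_weight \<beta> j x))"
    unfolding P P' by (simp add: fun_eq_iff algebra_simps)
  have "(LINT x|halfline. h' x * expoly \<beta> P x + h x * expoly \<beta> (pderiv P - smult \<beta> P) x) = 0"
    by (rule integral_primitive_eq_0[OF prim _ Wx]) (unfold w_eq, use i0 i1 in simp)
  then show ?thesis unfolding w_eq using i0 i1 by simp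
qed

lemma laguerre_span:
  assumes \<beta>: "\<beta> > 0" and "degree p \<le> M"
  shows "\<exists>a. p = (\<Sum>n\<le>M. smult (a n) (laguerre \<beta> n))"
  using assms(2)
proof (induction M arbitrary: p)
  case 0
  then obtain c where "p = [:c:]" by (metis degree_0_id le_zero_eq)
  moreover have "laguerre \<beta> 0 = [:1:]" by (simp add: laguerre_def monom_0)
  ultimately show ?case by (intro exI[of _ "\<lambda>_. c"]) simp
next
  case (Suc M)
  let ?L = "laguerre \<beta> (Suc M)"
  define c where "c = coeff p (Suc M) / coeff ?L (Suc M)"
  have nz: "coeff ?L (Suc M) \<noteq> 0" using \<beta> by (simp add: coeff_laguerre)
  have "degree (p - smult c ?L) \<le> M"
  proof (rule degree_le, intro allI impI)
    fix i assume "M < i"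
    show "coeff (p - smult c ?L) i = 0"
    proof (cases "i = Suc M")
      case True then show ?thesis using nz by (simp add: c_def)
    next
      case False
      then have "i > Suc M" using \<open>M < i\<close> by simp
      then show ?thesis using Suc.prems degree_laguerre[of \<beta> "Suc M"] by (simp add: coeff_eq_0)
    qed
  qed
  then obtain a where a: "p - smult c ?L = (\<Sum>n\<le>M. smult (a n) (laguerre \<beta> n))"
    using Suc.IH by blast
  have "p = (\<Sum>n\<le>Suc M. smult ((a(Suc M := c)) n) (laguerre \<beta> n))"
    using a by (simp add: algebra_simps)
  then show ?case by blast
qed

lemma poly_weight_pos:
  assumes \<beta>: "\<beta> > 0" and q: "q \<noteq> 0"
  shows "0 < (LINT x|halfline. (poly q x)\<^sup>2 * laguerre_weight \<beta> j x)"
proof (rule ccontr)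
  have nonneg: "AE x in halfline. 0 \<le> (poly q x)\<^sup>2 * laguerre_weight \<beta> j x"
    by (intro AE_I2) (simp add: laguerre_weight_nonneg)
  assume "\<not> 0 < (LINT x|halfline. (poly q x)\<^sup>2 * laguerre_weight \<beta> j x)"
  then have "(LINT x|halfline. (poly q x)\<^sup>2 * laguerre_weight \<beta> j x) = 0"
    using integral_nonneg_AE[OF nonneg] by linarith
  then have "AE x in halfline. (poly q x)\<^sup>2 * laguerre_weight \<beta> j x = 0"
    using integral_nonneg_eq_0_iff_AE[OF integrable_poly_weight(2)[OF \<beta>] nonneg] by blast
  then have 1: "AE x in lebesgue. x > 0 \<longrightarrow> (poly q x)\<^sup>2 * laguerre_weight \<beta> j x = 0"
    by (simp add: AE_restrict_space_iff)
  have "finite {x. poly q x = 0}" by (rule poly_roots_finite[OF q])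
  then have "{x. poly q x = 0} \<in> null_sets lebesgue"
    using finite_imp_null_set_lborel null_sets_completionI by blast
  then have "AE x in lebesgue. x \<notin> {x. poly q x = 0}" by (rule AE_not_in)
  with 1 have "AE x in lebesgue. x \<notin> {1..2::real}"
  proof eventually_elim
    case (elim x)
    then show ?case by (auto simp: laguerre_weight_def)
  qed
  then have "{1..2::real} \<in> null_sets lebesgue"
    by (subst AE_iff_null_sets) auto
  then have "emeasure lebesgue {1..2::real} = 0" by (rule null_setsD1)
  then show False by simp
qed

text \<open>The functions \<open>h j\<close> are the successive derivatives of \<open>h 0\<close>, each square integrable for the weight for
  which the \<open>j\<close>-th derivatives of the Laguerre polynomials are orthogonal.\<close>

locale laguerre_chain =
  fixes \<beta> :: real and m :: nat and h :: "nat \<Rightarrow> real \<Rightarrow> real"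
  assumes \<beta>: "\<beta> > 0"
    and h_measurable [measurable]: "\<And>j. j \<le> m \<Longrightarrow> h j \<in> borel_measurable halfline"
    and h_primitive: "\<And>j. j < m \<Longrightarrow> primitive (h j) (h (Suc j))"
    and h_integrable: "\<And>j. j \<le> m \<Longrightarrow> integrable halfline (\<lambda>x. (h j x)\<^sup>2 * laguerre_weight \<beta> j x)"
begin

lemma coefficient_shift:
  "j \<le> m \<Longrightarrow> (LINT x|halfline. h j x * poly ((pderiv ^^ j) (laguerre \<beta> n)) x * laguerre_weight \<beta> j x)
    = (\<Prod>i<j. \<beta> * (real n - real i)) * (LINT x|halfline. h 0 x * poly (laguerre \<beta> n) x * laguerre_weight \<beta> 0 x)"
proof (induction j)
  case (Suc j)
  have "(LINT x|halfline. h (Suc j) x * poly ((pderiv ^^ Suc j) (laguerre \<beta> n)) x * laguerre_weight \<beta> (Suc j) x)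
    = \<beta> * (real n - real j) * (LINT x|halfline. h j x * poly ((pderiv ^^ j) (laguerre \<beta> n)) x * laguerre_weight \<beta> j x)"
    using Suc.prems by (intro laguerre_parts \<beta> h_primitive h_measurable h_integrable) auto
  then show ?case using Suc by simp
qed simp

end

lemma laguerre_chain_laguerre:
  assumes "\<beta> > 0"
  shows "laguerre_chain \<beta> m (\<lambda>j. poly ((pderiv ^^ j) q))"
proof
  show "primitive (poly ((pderiv ^^ j) q)) (poly ((pderiv ^^ Suc j) q))" for j
    by (rule primitive_C1) (auto intro!: poly_DERIV continuous_intros)
qed (use assms integrable_poly_weight in auto)

lemma laguerre_inner_shift:
  assumes "\<beta> > 0"
  shows "(LINT x|halfline. poly ((pderiv ^^ j) (laguerre \<beta> k)) x * poly ((pderiv ^^ j) (laguerre \<beta> n)) x * laguerre_weight \<beta> j x)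
    = (\<Prod>i<j. \<beta> * (real n - real i)) * (LINT x|halfline. poly (laguerre \<beta> k) x * poly (laguerre \<beta> n) x * laguerre_weight \<beta> 0 x)"
  using laguerre_chain.coefficient_shift[OF laguerre_chain_laguerre[OF assms, of j "laguerre \<beta> k"], of j n] by simp

lemma laguerre_orthogonal:
  assumes "\<beta> > 0" "n \<noteq> k"
  shows "(LINT x|halfline. poly ((pderiv ^^ j) (laguerre \<beta> k)) x * poly ((pderiv ^^ j) (laguerre \<beta> n)) x * laguerre_weight \<beta> j x) = 0"
proof -
  define I where "I k n = (LINT x|halfline. poly (laguerre \<beta> k) x * poly (laguerre \<beta> n) x * laguerre_weight \<beta> 0 x)" for k n
  have sym: "I k n = I n k" by (simp add: I_def mult.commute)
  \<comment> \<open>The two ways of shifting one derivative differ by the factor \<open>n - k\<close>.\<close>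
  have "\<beta> * real n * I k n = \<beta> * real k * I n k"
    using laguerre_inner_shift[OF assms(1), of 1 k n] laguerre_inner_shift[OF assms(1), of 1 n k]
    by (simp add: I_def mult.commute)
  then have "(\<beta> * (real n - real k)) * I k n = 0" unfolding sym by (simp add: algebra_simps)
  then have "I k n = 0" using assms by simp
  then show ?thesis unfolding laguerre_inner_shift[OF assms(1)] by (simp add: I_def)
qed

section \<open>Density of the polynomials\<close>

text \<open>Membership in the \<open>L\<^sup>2\<close> closure of the polynomials for the weight \<open>exp (-\<beta>x)\<close>.\<close>

definition poly_approx :: "real \<Rightarrow> (real \<Rightarrow> real) \<Rightarrow> bool" where
  "poly_approx \<beta> f \<longleftrightarrow> f \<in> borel_measurable halfline \<and>
     (\<forall>\<epsilon>>0. \<exists>p. integrable halfline (\<lambda>x. (f x - poly p x)\<^sup>2 * laguerre_weight \<beta> 0 x) \<and>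
        (LINT x|halfline. (f x - poly p x)\<^sup>2 * laguerre_weight \<beta> 0 x) < \<epsilon>)"

lemma weighted_triangle:
  assumes m: "f \<in> borel_measurable halfline" "g \<in> borel_measurable halfline"
    and i: "integrable halfline (\<lambda>x. (f x)\<^sup>2 * laguerre_weight \<beta> j x)"
      "integrable halfline (\<lambda>x. (g x)\<^sup>2 * laguerre_weight \<beta> j x)"
  shows "integrable halfline (\<lambda>x. (f x + g x)\<^sup>2 * laguerre_weight \<beta> j x)"
    and "(LINT x|halfline. (f x + g x)\<^sup>2 * laguerre_weight \<beta> j x)
      \<le> 2 * (LINT x|halfline. (f x)\<^sup>2 * laguerre_weight \<beta> j x) + 2 * (LINT x|halfline. (g x)\<^sup>2 * laguerre_weight \<beta> j x)"
proof -
  let ?w = "laguerre_weight \<beta> j"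
  have le: "(f x + g x)\<^sup>2 * ?w x \<le> 2 * ((f x)\<^sup>2 * ?w x) + 2 * ((g x)\<^sup>2 * ?w x)" if "x \<in> space halfline" for x
  proof -
    have "0 \<le> (f x - g x)\<^sup>2 * ?w x" using that by (simp add: laguerre_weight_nonneg)
    then show ?thesis by (simp add: power2_eq_square algebra_simps)
  qed
  note [measurable] = m
  have b: "integrable halfline (\<lambda>x. 2 * ((f x)\<^sup>2 * ?w x) + 2 * ((g x)\<^sup>2 * ?w x))" using i by simp
  show *: "integrable halfline (\<lambda>x. (f x + g x)\<^sup>2 * ?w x)"
  proof (rule Bochner_Integration.integrable_bound[OF b])
    show "AE x in halfline. norm ((f x + g x)\<^sup>2 * ?w x) \<le> norm (2 * ((f x)\<^sup>2 * ?w x) + 2 * ((g x)\<^sup>2 * ?w x))"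
    proof (rule AE_I2)
      fix x assume x: "x \<in> space halfline"
      have "0 \<le> (f x + g x)\<^sup>2 * ?w x" using x by (simp add: laguerre_weight_nonneg)
      then show "norm ((f x + g x)\<^sup>2 * ?w x) \<le> norm (2 * ((f x)\<^sup>2 * ?w x) + 2 * ((g x)\<^sup>2 * ?w x))"
        using le[OF x] by simp
    qed
  qed measurable
  have "(LINT x|halfline. (f x + g x)\<^sup>2 * ?w x) \<le> (LINT x|halfline. 2 * ((f x)\<^sup>2 * ?w x) + 2 * ((g x)\<^sup>2 * ?w x))"
    by (rule integral_mono[OF * b le])
  then show "(LINT x|halfline. (f x + g x)\<^sup>2 * ?w x) \<le> 2 * (LINT x|halfline. (f x)\<^sup>2 * ?w x) + 2 * (LINT x|halfline. (g x)\<^sup>2 * ?w x)"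
    using i by simp
qed

lemma poly_approx_closed:
  assumes f: "f \<in> borel_measurable halfline"
    and g: "\<And>\<epsilon>. \<epsilon> > 0 \<Longrightarrow> \<exists>g. poly_approx \<beta> g \<and> integrable halfline (\<lambda>x. (f x - g x)\<^sup>2 * laguerre_weight \<beta> 0 x) \<and>
        (LINT x|halfline. (f x - g x)\<^sup>2 * laguerre_weight \<beta> 0 x) < \<epsilon>"
  shows "poly_approx \<beta> f"
  unfolding poly_approx_def
proof (intro conjI f allI impI)
  fix \<epsilon> :: real assume "\<epsilon> > 0"
  then have e: "\<epsilon> / 4 > 0" by simp
  obtain g where g: "poly_approx \<beta> g" "integrable halfline (\<lambda>x. (f x - g x)\<^sup>2 * laguerre_weight \<beta> 0 x)"
    "(LINT x|halfline. (f x - g x)\<^sup>2 * laguerre_weight \<beta> 0 x) < \<epsilon> / 4" using g[OF e] by blast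
  obtain p where p: "integrable halfline (\<lambda>x. (g x - poly p x)\<^sup>2 * laguerre_weight \<beta> 0 x)"
    "(LINT x|halfline. (g x - poly p x)\<^sup>2 * laguerre_weight \<beta> 0 x) < \<epsilon> / 4"
    using g(1) e unfolding poly_approx_def by blast
  have [measurable]: "g \<in> borel_measurable halfline" using g(1) unfolding poly_approx_def by blast
  have "(\<lambda>x. f x - g x) \<in> borel_measurable halfline" "(\<lambda>x. g x - poly p x) \<in> borel_measurable halfline"
    using f by measurable
  from weighted_triangle[OF this g(2) p(1)] g(3) p(2)
  show "\<exists>p. integrable halfline (\<lambda>x. (f x - poly p x)\<^sup>2 * laguerre_weight \<beta> 0 x) \<and>
        (LINT x|halfline. (f x - poly p x)\<^sup>2 * laguerre_weight \<beta> 0 x) < \<epsilon>"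
    by (intro exI[of _ p]) simp
qed

lemma poly_approx_poly: "poly_approx \<beta> (poly p)"
  unfolding poly_approx_def by (intro conjI allI impI exI[of _ p]) auto

lemma poly_approx_cmult:
  assumes "poly_approx \<beta> f"
  shows "poly_approx \<beta> (\<lambda>x. c * f x)"
  unfolding poly_approx_def
proof (intro conjI allI impI)
  have [measurable]: "f \<in> borel_measurable halfline" using assms unfolding poly_approx_def by blast
  show "(\<lambda>x. c * f x) \<in> borel_measurable halfline" by measurable
  fix \<epsilon> :: real assume "\<epsilon> > 0"
  then have "\<epsilon> / (c\<^sup>2 + 1) > 0" by (simp add: add_nonneg_pos)
  then obtain p where p: "integrable halfline (\<lambda>x. (f x - poly p x)\<^sup>2 * laguerre_weight \<beta> 0 x)"
    "(LINT x|halfline. (f x - poly p x)\<^sup>2 * laguerre_weight \<beta> 0 x) < \<epsilon> / (c\<^sup>2 + 1)"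
    using assms unfolding poly_approx_def by blast
  have eq: "(c * f x - poly (smult c p) x)\<^sup>2 * laguerre_weight \<beta> 0 x = c\<^sup>2 * ((f x - poly p x)\<^sup>2 * laguerre_weight \<beta> 0 x)" for x
    by (simp add: power2_eq_square algebra_simps)
  let ?I = "LINT x|halfline. (f x - poly p x)\<^sup>2 * laguerre_weight \<beta> 0 x"
  have "0 \<le> ?I" by (intro integral_nonneg_AE AE_I2) (simp add: laguerre_weight_nonneg)
  then have "c\<^sup>2 * ?I \<le> (c\<^sup>2 + 1) * ?I" by (simp add: distrib_right)
  also have "\<dots> < \<epsilon>" using p(2) by (simp add: pos_less_divide_eq add_nonneg_pos mult.commute)
  finally have "integrable halfline (\<lambda>x. (c * f x - poly (smult c p) x)\<^sup>2 * laguerre_weight \<beta> 0 x) \<and>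
        (LINT x|halfline. (c * f x - poly (smult c p) x)\<^sup>2 * laguerre_weight \<beta> 0 x) < \<epsilon>"
    unfolding eq using p(1) by simp
  then show "\<exists>p. integrable halfline (\<lambda>x. (c * f x - poly p x)\<^sup>2 * laguerre_weight \<beta> 0 x) \<and>
        (LINT x|halfline. (c * f x - poly p x)\<^sup>2 * laguerre_weight \<beta> 0 x) < \<epsilon>" by blast
qed

lemma poly_approx_add:
  assumes "poly_approx \<beta> f" "poly_approx \<beta> g"
  shows "poly_approx \<beta> (\<lambda>x. f x + g x)"
  unfolding poly_approx_def
proof (intro conjI allI impI)
  have [measurable]: "f \<in> borel_measurable halfline" "g \<in> borel_measurable halfline"
    using assms unfolding poly_approx_def by auto
  show "(\<lambda>x. f x + g x) \<in> borel_measurable halfline" by measurable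
  fix \<epsilon> :: real assume "\<epsilon> > 0"
  then have e: "\<epsilon> / 4 > 0" by simp
  obtain p where p: "integrable halfline (\<lambda>x. (f x - poly p x)\<^sup>2 * laguerre_weight \<beta> 0 x)"
    "(LINT x|halfline. (f x - poly p x)\<^sup>2 * laguerre_weight \<beta> 0 x) < \<epsilon> / 4"
    using assms(1) e unfolding poly_approx_def by blast
  obtain q where q: "integrable halfline (\<lambda>x. (g x - poly q x)\<^sup>2 * laguerre_weight \<beta> 0 x)"
    "(LINT x|halfline. (g x - poly q x)\<^sup>2 * laguerre_weight \<beta> 0 x) < \<epsilon> / 4"
    using assms(2) e unfolding poly_approx_def by blast
  have "(\<lambda>x. f x - poly p x) \<in> borel_measurable halfline" "(\<lambda>x. g x - poly q x) \<in> borel_measurable halfline"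
    by measurable
  note t = weighted_triangle[OF this p(1) q(1)]
  have eq: "f x - poly p x + (g x - poly q x) = f x + g x - poly (p + q) x" for x by simp
  show "\<exists>p. integrable halfline (\<lambda>x. (f x + g x - poly p x)\<^sup>2 * laguerre_weight \<beta> 0 x) \<and>
        (LINT x|halfline. (f x + g x - poly p x)\<^sup>2 * laguerre_weight \<beta> 0 x) < \<epsilon>"
    using t[unfolded eq] p(2) q(2) by (intro exI[of _ "p + q"]) simp
qed

lemma poly_approx_sum:
  assumes "finite S" "\<And>i. i \<in> S \<Longrightarrow> poly_approx \<beta> (f i)"
  shows "poly_approx \<beta> (\<lambda>x. \<Sum>i\<in>S. f i x)"
  using assms
proof (induction S rule: finite_induct)
  case empty
  have "poly_approx \<beta> (poly 0)" by (rule poly_approx_poly)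
  moreover have "poly 0 = (\<lambda>x. 0::real)" by (simp add: fun_eq_iff)
  ultimately show ?case by simp
qed (simp add: poly_approx_add)

text \<open>Dominated convergence of the exponential series in \<open>L\<^sup>2\<close> allows only small exponents. One
  small exponent at a time gives all multiples.\<close>

lemma poly_approx_exp:
  assumes \<beta>: "\<beta> > 0"
  shows "poly_approx \<beta> (\<lambda>x. x ^ n * exp (- (real j * (\<beta> / 4)) * x))"
proof (induction j arbitrary: n)
  case 0
  have "poly (monom 1 n) = (\<lambda>x. x ^ n * exp (- (real 0 * (\<beta> / 4)) * x))"
    by (simp add: poly_monom fun_eq_iff)
  then show ?case using poly_approx_poly[of \<beta> "monom 1 n"] by simp
next
  case (Suc j)
  define s where "s = \<beta> / 4"
  define T where "T k x = (\<Sum>i<k. (- s * x) ^ i / fact i)" for k x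
  define E where "E x = x ^ n * exp (- (real j * s) * x)" for x
  have approx: "poly_approx \<beta> (\<lambda>x. E x * T k x)" for k
  proof -
    have "poly_approx \<beta> (\<lambda>x. \<Sum>i<k. ((- s) ^ i / fact i) * (x ^ (n + i) * exp (- (real j * (\<beta> / 4)) * x)))"
      by (intro poly_approx_sum poly_approx_cmult Suc.IH) simp
    moreover have "(\<lambda>x. \<Sum>i<k. ((- s) ^ i / fact i) * (x ^ (n + i) * exp (- (real j * (\<beta> / 4)) * x))) = (\<lambda>x. E x * T k x)"
    proof
      fix x
      have "((- s) ^ i / fact i) * (x ^ (n + i) * exp (- (real j * (\<beta> / 4)) * x)) = E x * ((- s * x) ^ i / fact i)" for i
        by (simp only: E_def s_def power_mult_distrib power_add) (simp add: mult_ac)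
      then show "(\<Sum>i<k. ((- s) ^ i / fact i) * (x ^ (n + i) * exp (- (real j * (\<beta> / 4)) * x))) = E x * T k x"
        by (simp only: T_def sum_distrib_left)
    qed
    ultimately show ?thesis by simp
  qed
  have Econt: "continuous_on S E" for S unfolding E_def by (intro continuous_intros)
  have Tcont: "continuous_on S (T k)" for S k unfolding T_def by (intro continuous_intros) auto
  have [measurable]: "E \<in> borel_measurable halfline" "T k \<in> borel_measurable halfline" for k
    by (intro measurable_lebesgue_on_continuous Econt Tcont halfline_sets)+
  have em [measurable]: "(\<lambda>x. exp (c * x)) \<in> borel_measurable halfline" for c :: real
    by (intro measurable_lebesgue_on_continuous continuous_intros halfline_sets)
  have Tlim: "(\<lambda>k. T k x) \<longlonglongrightarrow> exp (- s * x)" for x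
    using exp_converges[of "- s * x"] unfolding sums_def T_def by (simp add: divide_inverse mult.commute)
  have Tle: "\<bar>T k x\<bar> \<le> exp (s * x)" if "x > 0" for k x
  proof -
    have "\<bar>T k x\<bar> \<le> (\<Sum>i<k. \<bar>(- s * x) ^ i / fact i\<bar>)" unfolding T_def by (rule sum_abs)
    also have "\<dots> = (\<Sum>i<k. (s * x) ^ i /\<^sub>R fact i)"
    proof (intro sum.cong refl)
      fix i
      have "\<bar>- s * x\<bar> = s * x" using \<beta> that by (simp add: s_def abs_mult)
      then have "\<bar>(- s * x) ^ i\<bar> = (s * x) ^ i" by (simp only: power_abs)
      moreover have "\<bar>fact i :: real\<bar> = fact i" by (rule abs_of_nonneg) simp
      ultimately show "\<bar>(- s * x) ^ i / fact i\<bar> = (s * x) ^ i /\<^sub>R fact i"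
        by (simp only: abs_divide) (simp only: divide_inverse real_scaleR_def mult.commute)
    qed
    also have "\<dots> \<le> (\<Sum>i. (s * x) ^ i /\<^sub>R fact i)"
      using \<beta> that by (intro sum_le_suminf[OF sums_summable[OF exp_converges]]) (auto simp: s_def)
    also have "\<dots> = exp (s * x)" by (rule sums_unique[OF exp_converges, symmetric])
    finally show ?thesis .
  qed
  define f where "f x = E x * exp (- s * x)" for x
  define D where "D k x = (f x - E x * T k x)\<^sup>2 * laguerre_weight \<beta> 0 x" for k x
  define G where "G x = 4 * expoly (\<beta> / 2) (monom 1 (2 * n)) x" for x
  have Dm: "D k \<in> borel_measurable halfline" for k unfolding D_def f_def by measurable
  have Gi: "integrable halfline G" unfolding G_def using integrable_expoly[of "\<beta> / 2"] \<beta> by simp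
  have DG: "\<bar>D k x\<bar> \<le> G x" if x: "x > 0" for k x
  proof -
    have "exp (- s * x) \<le> exp (s * x)" using x \<beta> by (simp add: s_def)
    moreover have "\<bar>exp (- s * x)\<bar> = exp (- s * x)" by simp
    ultimately have "\<bar>exp (- s * x) - T k x\<bar> \<le> 2 * exp (s * x)"
      using Tle[OF x, of k] abs_triangle_ineq4[of "exp (- s * x)" "T k x"] by linarith
    moreover have "\<bar>E x\<bar> \<le> x ^ n"
      using x \<beta> by (simp add: E_def abs_mult s_def mult_left_le)
    ultimately have "\<bar>E x\<bar> * \<bar>exp (- s * x) - T k x\<bar> \<le> x ^ n * (2 * exp (s * x))"
      using x by (intro mult_mono) auto
    then have "\<bar>f x - E x * T k x\<bar> \<le> x ^ n * (2 * exp (s * x))"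
      by (simp add: f_def abs_mult[symmetric] right_diff_distrib)
    then have "\<bar>f x - E x * T k x\<bar>\<^sup>2 \<le> (x ^ n * (2 * exp (s * x)))\<^sup>2" by (intro power_mono) auto
    then have "(f x - E x * T k x)\<^sup>2 * laguerre_weight \<beta> 0 x \<le> (x ^ n * (2 * exp (s * x)))\<^sup>2 * laguerre_weight \<beta> 0 x"
      using x by (intro mult_right_mono laguerre_weight_nonneg) simp_all
    also have "\<dots> = 4 * (x ^ (2 * n) * (exp (s * x) * exp (s * x) * exp (- \<beta> * x)))"
      by (simp add: laguerre_weight_def power2_eq_square power_mult_distrib mult_ac flip: power_add mult_2)
    also have "exp (s * x) * exp (s * x) * exp (- \<beta> * x) = exp (- (\<beta> / 2) * x)"
      by (simp add: s_def flip: exp_add)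
    finally show ?thesis
      using x unfolding D_def G_def by (simp add: expoly_def poly_monom mult_ac laguerre_weight_nonneg)
  qed
  have "(\<lambda>k. LINT x|halfline. D k x) \<longlonglongrightarrow> (LINT x|halfline. 0)"
  proof (rule integral_dominated_convergence[where w = G])
    show "AE x in halfline. (\<lambda>k. D k x) \<longlonglongrightarrow> 0"
    proof (rule AE_I2)
      fix x
      have "(\<lambda>k. D k x) \<longlonglongrightarrow> (f x - E x * exp (- s * x))\<^sup>2 * laguerre_weight \<beta> 0 x"
        unfolding D_def by (intro tendsto_intros Tlim)
      then show "(\<lambda>k. D k x) \<longlonglongrightarrow> 0" by (simp add: f_def)
    qed
  qed (use Dm Gi DG in auto)
  then have lim: "(\<lambda>k. LINT x|halfline. D k x) \<longlonglongrightarrow> 0" by simp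
  have "poly_approx \<beta> f"
  proof (rule poly_approx_closed)
    show "f \<in> borel_measurable halfline" unfolding f_def by measurable
    fix \<epsilon> :: real assume "\<epsilon> > 0"
    then have "eventually (\<lambda>k. (LINT x|halfline. D k x) < \<epsilon>) sequentially"
      using lim by (auto intro: order_tendstoD)
    then obtain k where k: "(LINT x|halfline. D k x) < \<epsilon>"
      by (auto simp: eventually_sequentially)
    have "integrable halfline (D k)"
    proof (rule Bochner_Integration.integrable_bound[OF Gi Dm])
      show "AE x in halfline. norm (D k x) \<le> norm (G x)"
      proof (rule AE_I2)
        fix x assume "x \<in> space halfline"
        then have "\<bar>D k x\<bar> \<le> G x" by (intro DG) simp
        then show "norm (D k x) \<le> norm (G x)" by simp
      qed
    qed
    then show "\<exists>g. poly_approx \<beta> g \<and> integrable halfline (\<lambda>x. (f x - g x)\<^sup>2 * laguerre_weight \<beta> 0 x) \<and>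
        (LINT x|halfline. (f x - g x)\<^sup>2 * laguerre_weight \<beta> 0 x) < \<epsilon>"
      using approx[of k] k unfolding D_def by (intro exI[of _ "\<lambda>x. E x * T k x"]) simp
  qed
  moreover have "f = (\<lambda>x. x ^ n * exp (- (real (Suc j) * (\<beta> / 4)) * x))"
    by (simp add: fun_eq_iff f_def E_def s_def algebra_simps flip: exp_add)
  ultimately show ?case by simp
qed

text \<open>In the variable \<open>t = exp (-\<beta>x/4)\<close> a function of compact support in \<open>(0,\<infinity>)\<close> becomes a continuous
  function on \<open>[0,1]\<close>, to which the theorem of Weierstrass applies.\<close>

lemma poly_approx_compact_support:
  assumes \<beta>: "\<beta> > 0" and k: "continuous_on {0<..} k" and ab: "0 < a" "a \<le> b"
    and supp: "\<And>x. x \<notin> {a..b} \<Longrightarrow> k x = 0"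
  shows "poly_approx \<beta> k"
proof (rule poly_approx_closed)
  show km: "k \<in> borel_measurable halfline" by (rule measurable_lebesgue_on_continuous[OF k halfline_sets])
  note [measurable] = km
  have em [measurable]: "(\<lambda>x. exp (c * x)) \<in> borel_measurable halfline" for c :: real
    by (intro measurable_lebesgue_on_continuous continuous_intros halfline_sets)
  fix \<epsilon> :: real assume "\<epsilon> > 0"
  define s where "s = \<beta> / 4"
  have s: "s > 0" using \<beta> by (simp add: s_def)
  define \<delta> where "\<delta> = exp (- s * (b + 1))"
  have "\<delta> > 0" by (simp add: \<delta>_def)
  \<comment> \<open>The cut at \<open>\<delta>\<close> avoids the logarithm of \<open>0\<close>, the cut at \<open>a/2\<close> the end point \<open>0\<close>; both lie where \<open>k\<close> vanishes.\<close>
  define \<phi> where "\<phi> t = k (max (a / 2) (- ln (max t \<delta>) / s))" for t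
  have \<phi>: "continuous_on {0..1} \<phi>"
    unfolding \<phi>_def
    by (rule continuous_on_compose2[OF k]) (use s ab \<open>\<delta> > 0\<close> in \<open>auto intro!: continuous_intros simp: less_max_iff_disj\<close>)
  have k\<phi>: "\<phi> (exp (- s * x)) = k x" if "x > 0" for x
  proof (cases "x \<le> b + 1")
    case True
    then have "max (exp (- s * x)) \<delta> = exp (- s * x)" using s by (simp add: \<delta>_def max_def)
    then have "\<phi> (exp (- s * x)) = k (max (a / 2) x)" using s by (simp add: \<phi>_def)
    moreover have "k (max (a / 2) x) = k x"
    proof (cases "a / 2 \<le> x")
      case False
      then have "k (a / 2) = 0" "k x = 0" using ab by (auto intro!: supp)
      then show ?thesis using False by (simp add: max_def)
    qed (simp add: max_def)
    ultimately show ?thesis by simp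
  next
    case False
    then have "max (exp (- s * x)) \<delta> = \<delta>" using s by (simp add: \<delta>_def max_def)
    then have "\<phi> (exp (- s * x)) = k (max (a / 2) (b + 1))" using s by (simp add: \<phi>_def \<delta>_def)
    moreover have "k (max (a / 2) (b + 1)) = 0" "k x = 0" using False ab by (auto intro!: supp)
    ultimately show ?thesis by simp
  qed
  define K where "K = (LINT x|halfline. exp (- \<beta> * x))"
  have "K \<ge> 0" by (simp add: K_def)
  define e where "e = sqrt (\<epsilon> / (K + 1))"
  have e: "e > 0" "e\<^sup>2 * K < \<epsilon>"
  proof -
    show "e > 0" using \<open>\<epsilon> > 0\<close> \<open>K \<ge> 0\<close> by (simp add: e_def)
    have "e\<^sup>2 * K = \<epsilon> * (K / (K + 1))" using \<open>\<epsilon> > 0\<close> \<open>K \<ge> 0\<close> by (simp add: e_def)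
    also have "\<dots> < \<epsilon> * 1" using \<open>\<epsilon> > 0\<close> \<open>K \<ge> 0\<close> by (intro mult_strict_left_mono) auto
    finally show "e\<^sup>2 * K < \<epsilon>" by simp
  qed
  obtain P where P: "real_polynomial_function P" "\<And>t. t \<in> {0..1} \<Longrightarrow> \<bar>\<phi> t - P t\<bar> < e"
    using Stone_Weierstrass_real_polynomial_function[OF compact_Icc \<phi> e(1)] by blast
  obtain c M where c: "P = (\<lambda>t. \<Sum>i\<le>M. c i * t ^ i)"
    using P(1) unfolding real_polynomial_function_iff_sum by blast
  define g where "g x = P (exp (- s * x))" for x
  have g_sum: "g = (\<lambda>x. \<Sum>i\<le>(M::nat). c i * (x ^ 0 * exp (- (real i * (\<beta> / 4)) * x)))"
    unfolding g_def c s_def by (simp add: exp_of_nat_mult[symmetric] mult_ac)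
  have g: "poly_approx \<beta> g"
    unfolding g_sum by (intro poly_approx_sum poly_approx_cmult poly_approx_exp \<beta>) simp
  then have [measurable]: "g \<in> borel_measurable halfline" unfolding poly_approx_def by blast
  have le: "(k x - g x)\<^sup>2 * laguerre_weight \<beta> 0 x \<le> e\<^sup>2 * exp (- \<beta> * x)" if "x > 0" for x
  proof -
    have "\<bar>k x - g x\<bar> < e" using P(2)[of "exp (- s * x)"] k\<phi>[OF that] s that by (simp add: g_def)
    then have "\<bar>k x - g x\<bar>\<^sup>2 \<le> e\<^sup>2" by (intro power_mono) auto
    then show ?thesis by (simp add: laguerre_weight_def)
  qed
  have i: "integrable halfline (\<lambda>x. (k x - g x)\<^sup>2 * laguerre_weight \<beta> 0 x)"
  proof (rule integrable_halfline_exp_bound[OF _ \<beta>])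
    show "(\<lambda>x. (k x - g x)\<^sup>2 * laguerre_weight \<beta> 0 x) \<in> borel_measurable halfline" by measurable
    fix x :: real assume "x > 0"
    then show "\<bar>(k x - g x)\<^sup>2 * laguerre_weight \<beta> 0 x\<bar> \<le> e\<^sup>2 * exp (- \<beta> * x)"
      using le[of x] laguerre_weight_nonneg[of x \<beta> 0] by simp
  qed
  have "(LINT x|halfline. (k x - g x)\<^sup>2 * laguerre_weight \<beta> 0 x) \<le> (LINT x|halfline. e\<^sup>2 * exp (- \<beta> * x))"
    using i integrable_exp_halfline[OF \<beta>] le by (intro integral_mono) auto
  also have "\<dots> < \<epsilon>" using e(2) by (simp add: K_def)
  finally show "\<exists>g. poly_approx \<beta> g \<and> integrable halfline (\<lambda>x. (k x - g x)\<^sup>2 * laguerre_weight \<beta> 0 x) \<and>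
        (LINT x|halfline. (k x - g x)\<^sup>2 * laguerre_weight \<beta> 0 x) < \<epsilon>"
    using g i by blast
qed

text \<open>Continuous functions suffice here, because every function to be approximated has a derivative;
  the cut-off replaces a density theorem for \<open>L\<^sup>2\<close>.\<close>

lemma poly_approx_continuous:
  assumes \<beta>: "\<beta> > 0" and f: "continuous_on {0<..} f"
    and i: "integrable halfline (\<lambda>x. (f x)\<^sup>2 * laguerre_weight \<beta> 0 x)"
  shows "poly_approx \<beta> f"
proof (rule poly_approx_closed)
  show fm: "f \<in> borel_measurable halfline" by (rule measurable_lebesgue_on_continuous[OF f halfline_sets])
  have cc: "continuous_on S (cutoff n)" for S n by (rule smooth_continuous[OF smooth_cutoff])
  have [measurable]: "cutoff n \<in> borel_measurable halfline" for n
    by (intro measurable_lebesgue_on_continuous cc halfline_sets)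
  note [measurable] = fm
  have le: "\<bar>(f x - f x * cutoff n x)\<^sup>2 * laguerre_weight \<beta> 0 x\<bar> \<le> (f x)\<^sup>2 * laguerre_weight \<beta> 0 x" if "x > 0" for n x
  proof -
    have eq: "(f x - f x * cutoff n x)\<^sup>2 = (f x)\<^sup>2 * (1 - cutoff n x)\<^sup>2"
      by (simp add: power2_eq_square algebra_simps)
    have "(1 - cutoff n x)\<^sup>2 \<le> 1" using cutoff_bounds[of n x] by (intro power_le_one) auto
    then have "(f x)\<^sup>2 * (1 - cutoff n x)\<^sup>2 * laguerre_weight \<beta> 0 x \<le> (f x)\<^sup>2 * laguerre_weight \<beta> 0 x"
      using that by (intro mult_right_mono laguerre_weight_nonneg) (simp_all add: mult_left_le)
    then show ?thesis using that by (simp add: eq laguerre_weight_nonneg)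
  qed
  have ii: "integrable halfline (\<lambda>x. (f x - f x * cutoff n x)\<^sup>2 * laguerre_weight \<beta> 0 x)" for n
  proof (rule Bochner_Integration.integrable_bound[OF i])
    show "AE x in halfline. norm ((f x - f x * cutoff n x)\<^sup>2 * laguerre_weight \<beta> 0 x) \<le> norm ((f x)\<^sup>2 * laguerre_weight \<beta> 0 x)"
    proof (rule AE_I2)
      fix x assume "x \<in> space halfline"
      then show "norm ((f x - f x * cutoff n x)\<^sup>2 * laguerre_weight \<beta> 0 x) \<le> norm ((f x)\<^sup>2 * laguerre_weight \<beta> 0 x)"
        using le[of x n] by simp
    qed
  qed measurable
  have "(\<lambda>n. LINT x|halfline. (f x - f x * cutoff n x)\<^sup>2 * laguerre_weight \<beta> 0 x) \<longlonglongrightarrow> (LINT x|halfline. 0)"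
  proof (rule integral_dominated_convergence[OF _ _ i])
    show "AE x in halfline. (\<lambda>n. (f x - f x * cutoff n x)\<^sup>2 * laguerre_weight \<beta> 0 x) \<longlonglongrightarrow> 0"
    proof (rule AE_I2)
      fix x assume "x \<in> space halfline"
      then have "(\<lambda>n. (f x - f x * cutoff n x)\<^sup>2 * laguerre_weight \<beta> 0 x) \<longlonglongrightarrow> (f x - f x * 1)\<^sup>2 * laguerre_weight \<beta> 0 x"
        by (intro tendsto_intros cutoff_tendsto) simp
      then show "(\<lambda>n. (f x - f x * cutoff n x)\<^sup>2 * laguerre_weight \<beta> 0 x) \<longlonglongrightarrow> 0" by simp
    qed
  qed (use le in auto)
  then have lim: "(\<lambda>n. LINT x|halfline. (f x - f x * cutoff n x)\<^sup>2 * laguerre_weight \<beta> 0 x) \<longlonglongrightarrow> 0" by simp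
  fix \<epsilon> :: real assume "\<epsilon> > 0"
  then have "eventually (\<lambda>n. (LINT x|halfline. (f x - f x * cutoff n x)\<^sup>2 * laguerre_weight \<beta> 0 x) < \<epsilon>) sequentially"
    using lim by (auto intro: order_tendstoD)
  then have "eventually (\<lambda>n. (LINT x|halfline. (f x - f x * cutoff n x)\<^sup>2 * laguerre_weight \<beta> 0 x) < \<epsilon> \<and> n \<ge> 1) sequentially"
    using eventually_ge_at_top[of 1] by eventually_elim simp
  then obtain n where n: "(LINT x|halfline. (f x - f x * cutoff n x)\<^sup>2 * laguerre_weight \<beta> 0 x) < \<epsilon>" "n \<ge> 1"
    by (auto simp: eventually_sequentially)
  have "poly_approx \<beta> (\<lambda>x. f x * cutoff n x)"
  proof (rule poly_approx_compact_support[OF \<beta>, of _ "1 / real (Suc n)" "real n"])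
    show "continuous_on {0<..} (\<lambda>x. f x * cutoff n x)" by (intro continuous_intros f cc)
    have "1 / real (Suc n) \<le> 1" by simp
    also have "1 \<le> real n" using n(2) by simp
    finally show "1 / real (Suc n) \<le> real n" .
    show "0 < 1 / real (Suc n)" by simp
    show "f x * cutoff n x = 0" if "x \<notin> {1 / real (Suc n)..real n}" for x
      using cutoff_eq_0[OF that] by simp
  qed
  then show "\<exists>g. poly_approx \<beta> g \<and> integrable halfline (\<lambda>x. (f x - g x)\<^sup>2 * laguerre_weight \<beta> 0 x) \<and>
        (LINT x|halfline. (f x - g x)\<^sup>2 * laguerre_weight \<beta> 0 x) < \<epsilon>"
    using ii n by blast
qed

section \<open>Approximation by Laguerre functions\<close>

text \<open>Parseval's identity without completeness of \<open>L\<^sup>2\<close>: a polynomial \<open>q\<close> close to \<open>h\<^sub>0\<close> bounds the part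
  of the expansion beyond degree \<open>N\<close> by finitely many coefficients, and these are the coefficients
  of the \<open>m\<close>-th derivative, divided by the product in the bound. Bessel's inequality for that derivative
  finishes the proof.\<close>

lemma (in laguerre_chain) laguerre_approximation:
  assumes N: "m \<le> N + 1"
  shows "\<exists>p. degree p \<le> N \<and> integrable halfline (\<lambda>x. (h 0 x - poly p x)\<^sup>2 * laguerre_weight \<beta> 0 x) \<and>
    (LINT x|halfline. (h 0 x - poly p x)\<^sup>2 * laguerre_weight \<beta> 0 x)
      \<le> (LINT x|halfline. (h m x)\<^sup>2 * laguerre_weight \<beta> m x) / (\<Prod>i<m. \<beta> * (real (N + 1) - real i))"
proof (cases "m = 0")
  case True
  then show ?thesis using h_integrable[of 0] by (intro exI[of _ 0]) simp
next
  case False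
  have h0: "h 0 \<in> borel_measurable halfline" "integrable halfline (\<lambda>x. (h 0 x)\<^sup>2 * laguerre_weight \<beta> 0 x)"
    and hm: "h m \<in> borel_measurable halfline" "integrable halfline (\<lambda>x. (h m x)\<^sup>2 * laguerre_weight \<beta> m x)"
    using h_measurable h_integrable by auto
  have "continuous_on {0<..} (h 0)"
    using primitive_continuous[OF h_primitive[of 0]] False by simp
  then have dense: "poly_approx \<beta> (h 0)" by (rule poly_approx_continuous[OF \<beta> _ h0(2)])
  define nrm where "nrm n = (LINT x|halfline. (poly (laguerre \<beta> n) x)\<^sup>2 * laguerre_weight \<beta> 0 x)" for n
  define cf where "cf n = (LINT x|halfline. h 0 x * poly (laguerre \<beta> n) x * laguerre_weight \<beta> 0 x)" for n
  define H where "H = (LINT x|halfline. (h 0 x)\<^sup>2 * laguerre_weight \<beta> 0 x)"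
  define B where "B = (LINT x|halfline. (h m x)\<^sup>2 * laguerre_weight \<beta> m x)"
  define C where "C n = (\<Prod>i<m. \<beta> * (real n - real i))" for n
  have nrm: "nrm n > 0" for n
  proof -
    have "coeff (laguerre \<beta> n) n \<noteq> 0" using \<beta> by (simp add: coeff_laguerre)
    then have "laguerre \<beta> n \<noteq> 0" by auto
    then show ?thesis unfolding nrm_def by (rule poly_weight_pos[OF \<beta>])
  qed
  have expand: "integrable halfline (\<lambda>x. (h 0 x - poly (\<Sum>n\<in>S. smult (a n) (laguerre \<beta> n)) x)\<^sup>2 * laguerre_weight \<beta> 0 x)
      \<and> (LINT x|halfline. (h 0 x - poly (\<Sum>n\<in>S. smult (a n) (laguerre \<beta> n)) x)\<^sup>2 * laguerre_weight \<beta> 0 x)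
        = H + (\<Sum>n\<in>S. (a n)\<^sup>2 * nrm n - 2 * a n * cf n)" if "finite S" for S a
  proof -
    have eq: "poly (\<Sum>n\<in>S. smult (a n) (laguerre \<beta> n)) x = (\<Sum>n\<in>S. a n * poly (laguerre \<beta> n) x)" for x
      by (simp add: poly_sum)
    show ?thesis unfolding eq H_def nrm_def cf_def
      by (rule orthogonal_expansion[OF that h0(1) poly_measurable_halfline laguerre_weight_measurable _ h0(2)])
        (use laguerre_orthogonal[OF \<beta>, of _ _ 0] integrable_poly_weight(2)[OF \<beta>] in \<open>auto simp: laguerre_weight_nonneg\<close>)
  qed
  define p where "p = (\<Sum>n\<in>{..N}. smult (cf n / nrm n) (laguerre \<beta> n))"
  have "degree p \<le> N"
    unfolding p_def by (intro degree_sum_le) (auto intro: order_trans[OF degree_smult_le] order_trans[OF degree_laguerre])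
  have square: "(cf n / nrm n)\<^sup>2 * nrm n - 2 * (cf n / nrm n) * cf n = - ((cf n)\<^sup>2 / nrm n)" for n
    using nrm[of n] by (simp add: power2_eq_square field_simps)
  have c: "C (N + 1) > 0" unfolding C_def using \<beta> N by (intro prod_pos) auto
  have p_int: "integrable halfline (\<lambda>x. (h 0 x - poly p x)\<^sup>2 * laguerre_weight \<beta> 0 x)"
    and p_eq: "(LINT x|halfline. (h 0 x - poly p x)\<^sup>2 * laguerre_weight \<beta> 0 x) = H - (\<Sum>n\<le>N. (cf n)\<^sup>2 / nrm n)"
    using expand[of "{..N}" "\<lambda>n. cf n / nrm n"] unfolding p_def[symmetric] square by (simp_all add: sum_negf)
  have Bessel: "(\<Sum>n\<in>{N<..M}. (cf n)\<^sup>2 / nrm n) \<le> B / C (N + 1)" for M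
  proof -
    let ?d = "\<lambda>n. poly ((pderiv ^^ m) (laguerre \<beta> n))"
    have nd: "(LINT x|halfline. (?d n x)\<^sup>2 * laguerre_weight \<beta> m x) = C n * nrm n" for n
      using laguerre_inner_shift[OF \<beta>, of m n n] by (simp add: C_def nrm_def power2_eq_square)
    have cm: "(LINT x|halfline. h m x * ?d n x * laguerre_weight \<beta> m x) = C n * cf n" for n
      using coefficient_shift[of m n] by (simp add: C_def cf_def)
    have "0 \<le> (LINT x|halfline. (h m x - (\<Sum>n\<in>{N<..M}. (cf n / nrm n) * ?d n x))\<^sup>2 * laguerre_weight \<beta> m x)"
      by (intro integral_nonneg_AE AE_I2) (simp add: laguerre_weight_nonneg)
    also have "\<dots> = B + (\<Sum>n\<in>{N<..M}. (cf n / nrm n)\<^sup>2 * (C n * nrm n) - 2 * (cf n / nrm n) * (C n * cf n))"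
      unfolding B_def nd[symmetric] cm[symmetric]
      by (rule orthogonal_expansion[THEN conjunct2, OF _ hm(1) poly_measurable_halfline laguerre_weight_measurable _ hm(2)])
        (use laguerre_orthogonal[OF \<beta>] integrable_poly_weight(2)[OF \<beta>] in \<open>auto simp: laguerre_weight_nonneg\<close>)
    also have "(\<Sum>n\<in>{N<..M}. (cf n / nrm n)\<^sup>2 * (C n * nrm n) - 2 * (cf n / nrm n) * (C n * cf n))
        = - (\<Sum>n\<in>{N<..M}. C n * ((cf n)\<^sup>2 / nrm n))"
      unfolding sum_negf[symmetric]
    proof (intro sum.cong refl)
      fix n
      have "(cf n / nrm n)\<^sup>2 * (C n * nrm n) - 2 * (cf n / nrm n) * (C n * cf n)
          = C n * ((cf n / nrm n)\<^sup>2 * nrm n - 2 * (cf n / nrm n) * cf n)" by (simp add: algebra_simps)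
      then show "(cf n / nrm n)\<^sup>2 * (C n * nrm n) - 2 * (cf n / nrm n) * (C n * cf n) = - (C n * ((cf n)\<^sup>2 / nrm n))"
        unfolding square by simp
    qed
    finally have "(\<Sum>n\<in>{N<..M}. C n * ((cf n)\<^sup>2 / nrm n)) \<le> B" by simp
    moreover have "(\<Sum>n\<in>{N<..M}. C (N + 1) * ((cf n)\<^sup>2 / nrm n)) \<le> (\<Sum>n\<in>{N<..M}. C n * ((cf n)\<^sup>2 / nrm n))"
    proof (intro sum_mono mult_right_mono)
      fix n assume "n \<in> {N<..M}"
      then show "C (N + 1) \<le> C n" unfolding C_def using \<beta> N by (intro prod_mono) auto
      show "0 \<le> (cf n)\<^sup>2 / nrm n" using nrm[of n] by simp
    qed
    ultimately have "C (N + 1) * (\<Sum>n\<in>{N<..M}. (cf n)\<^sup>2 / nrm n) \<le> B" by (simp add: sum_distrib_left)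
    then show ?thesis using c by (simp add: pos_le_divide_eq mult.commute)
  qed
  have "H - (\<Sum>n\<le>N. (cf n)\<^sup>2 / nrm n) \<le> B / C (N + 1)"
  proof (rule field_le_epsilon)
    fix \<epsilon> :: real assume "\<epsilon> > 0"
    then obtain q where q: "(LINT x|halfline. (h 0 x - poly q x)\<^sup>2 * laguerre_weight \<beta> 0 x) < \<epsilon>"
      using dense unfolding poly_approx_def by blast
    define M where "M = max (degree q) N"
    obtain a where a: "q = (\<Sum>n\<le>M. smult (a n) (laguerre \<beta> n))"
      using laguerre_span[OF \<beta>, of q M] by (auto simp: M_def)
    have lower: "- ((cf n)\<^sup>2 / nrm n) \<le> (a n)\<^sup>2 * nrm n - 2 * a n * cf n" for n
    proof -
      have "(a n)\<^sup>2 * nrm n - 2 * a n * cf n + (cf n)\<^sup>2 / nrm n = (a n * nrm n - cf n)\<^sup>2 / nrm n"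
        using nrm[of n] by (simp add: power2_eq_square field_simps)
      also have "\<dots> \<ge> 0" using nrm[of n] by simp
      finally show ?thesis by simp
    qed
    have "- (\<Sum>n\<le>M. (cf n)\<^sup>2 / nrm n) \<le> (\<Sum>n\<le>M. (a n)\<^sup>2 * nrm n - 2 * a n * cf n)"
      unfolding sum_negf[symmetric] by (intro sum_mono lower)
    then have "H - (\<Sum>n\<le>M. (cf n)\<^sup>2 / nrm n) < \<epsilon>"
      using expand[of "{..M}" a] q unfolding a[symmetric] by simp
    moreover have "(\<Sum>n\<le>M. (cf n)\<^sup>2 / nrm n) = (\<Sum>n\<le>N. (cf n)\<^sup>2 / nrm n) + (\<Sum>n\<in>{N<..M}. (cf n)\<^sup>2 / nrm n)"
    proof -
      have "{..M} = {..N} \<union> {N<..M}" by (auto simp: M_def)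
      then show ?thesis by (simp only:) (rule sum.union_disjoint; auto)
    qed
    ultimately show "H - (\<Sum>n\<le>N. (cf n)\<^sup>2 / nrm n) \<le> B / C (N + 1) + \<epsilon>" using Bessel[of M] by simp
  qed
  then show ?thesis
    using \<open>degree p \<le> N\<close> p_int p_eq unfolding B_def C_def by (intro exI[of _ p]) simp
qed

text \<open>Conjugation by \<open>exp (b x)\<close>, \<open>b = \<beta>/2\<close>, turns the derivative into \<open>D g = g' + b g\<close>
  and the weight \<open>x\<^sup>j exp (-\<beta>x)\<close> into \<open>x\<^sup>j\<close>.\<close>

lemma twisted_approximation:
  fixes G :: "nat \<Rightarrow> real \<Rightarrow> real"
  assumes b: "b > 0"
    and Gm: "\<And>j. j \<le> m \<Longrightarrow> G j \<in> borel_measurable halfline"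
    and Gp: "\<And>j. j < m \<Longrightarrow> primitive (G j) (\<lambda>x. G (Suc j) x - b * G j x)"
    and Gi: "\<And>j. j \<le> m \<Longrightarrow> integrable halfline (\<lambda>x. (G j x)\<^sup>2 * x ^ j)"
    and N: "m \<le> N + 1"
  shows "\<exists>p. degree p \<le> N \<and> integrable halfline (\<lambda>x. (G 0 x - expoly b p x)\<^sup>2) \<and>
    (LINT x|halfline. (G 0 x - expoly b p x)\<^sup>2)
      \<le> (LINT x|halfline. (G m x)\<^sup>2 * x ^ m) / (\<Prod>i<m. (2 * b) * (real (N + 1) - real i))"
proof -
  define h where "h j x = exp (b * x) * G j x" for j x
  have em [measurable]: "(\<lambda>x. exp (b * x)) \<in> borel_measurable halfline"
    by (intro measurable_lebesgue_on_continuous continuous_intros halfline_sets)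
  have h_sq: "(h j x)\<^sup>2 * laguerre_weight (2 * b) j x = (G j x)\<^sup>2 * x ^ j" for j x
  proof -
    have "exp (b * x) * exp (b * x) * exp (- (2 * b) * x) = 1" by (simp flip: exp_add)
    then have "(exp (b * x))\<^sup>2 * exp (- (2 * b) * x) = 1" by (simp add: power2_eq_square)
    moreover have "(h j x)\<^sup>2 * laguerre_weight (2 * b) j x
        = ((exp (b * x))\<^sup>2 * exp (- (2 * b) * x)) * ((G j x)\<^sup>2 * x ^ j)"
      by (simp only: h_def laguerre_weight_def power_mult_distrib mult_ac)
    ultimately show ?thesis by simp
  qed
  interpret laguerre_chain "2 * b" m h
  proof
    show "h j \<in> borel_measurable halfline" if "j \<le> m" for j
      using Gm[OF that] unfolding h_def by measurable
    show "primitive (h j) (h (Suc j))" if "j < m" for j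
    proof -
      have P: "primitive (\<lambda>x. exp (b * x)) (\<lambda>x. b * exp (b * x))"
        by (rule primitive_C1) (auto intro!: derivative_eq_intros continuous_intros)
      show ?thesis
        by (rule primitive_cong[OF primitive_mult[OF P Gp[OF that]]])
          (simp_all add: h_def algebra_simps)
    qed
    show "integrable halfline (\<lambda>x. (h j x)\<^sup>2 * laguerre_weight (2 * b) j x)" if "j \<le> m" for j
      unfolding h_sq by (rule Gi[OF that])
  qed (use b in simp)
  obtain p where p: "degree p \<le> N" "integrable halfline (\<lambda>x. (h 0 x - poly p x)\<^sup>2 * laguerre_weight (2 * b) 0 x)"
    "(LINT x|halfline. (h 0 x - poly p x)\<^sup>2 * laguerre_weight (2 * b) 0 x)
      \<le> (LINT x|halfline. (h m x)\<^sup>2 * laguerre_weight (2 * b) m x) / (\<Prod>i<m. (2 * b) * (real (N + 1) - real i))"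
    using laguerre_approximation[OF N] by blast
  have "(h 0 x - poly p x)\<^sup>2 * laguerre_weight (2 * b) 0 x = (G 0 x - expoly b p x)\<^sup>2" for x
  proof -
    have e: "exp (- b * x) * exp (b * x) = 1" by (simp flip: exp_add)
    have "G 0 x - expoly b p x = (exp (- b * x) * exp (b * x)) * G 0 x - exp (- b * x) * poly p x"
      unfolding e by (simp add: expoly_def)
    also have "\<dots> = exp (- b * x) * (h 0 x - poly p x)"
      by (simp add: h_def algebra_simps)
    finally have "(G 0 x - expoly b p x)\<^sup>2 = (exp (- b * x))\<^sup>2 * (h 0 x - poly p x)\<^sup>2"
      by (simp add: power_mult_distrib)
    moreover have "(exp (- b * x))\<^sup>2 = laguerre_weight (2 * b) 0 x"
      by (simp add: laguerre_weight_def power2_eq_square flip: exp_add)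
    ultimately show ?thesis by simp
  qed
  then show ?thesis using p unfolding h_sq by auto
qed

lemma polynomial_antiderivative:
  fixes p :: "real poly"
  assumes "degree p \<le> N"
  shows "\<exists>q. pderiv q = p \<and> degree q \<le> N + 1 \<and> poly q 0 = \<eta>"
proof -
  define q where "q = [:\<eta>:] + (\<Sum>i\<le>N. monom (coeff p i / real (Suc i)) (Suc i))"
  have "pderiv q = (\<Sum>i\<le>N. monom (coeff p i) i)"
    unfolding q_def by (induction N) (simp_all add: pderiv_add pderiv_monom pderiv_pCons del: of_nat_Suc flip: add.assoc)
  also have "\<dots> = p" using assms by (intro poly_as_sum_of_monoms')
  finally have "pderiv q = p" .
  moreover have "degree q \<le> N + 1"
    unfolding q_def by (intro degree_add_le degree_sum_le) (auto intro: order_trans[OF degree_monom_le])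
  moreover have "poly q 0 = \<eta>" by (simp add: q_def poly_sum poly_monom)
  ultimately show ?thesis by blast
qed

text \<open>The mixed term of \<open>\<parallel>E' + b E\<parallel>\<^sup>2\<close> is a boundary value of \<open>E\<^sup>2\<close>.\<close>

lemma twisted_norm:
  assumes E: "primitive E E'" and E'm: "E' \<in> borel_measurable halfline"
    and i: "integrable halfline (\<lambda>x. (E x)\<^sup>2)" "integrable halfline (\<lambda>x. (E' x)\<^sup>2)"
    and E0: "(E \<longlongrightarrow> 0) (at_right 0)"
  shows "(LINT x|halfline. (E' x + b * E x)\<^sup>2) = (LINT x|halfline. (E' x)\<^sup>2) + b\<^sup>2 * (LINT x|halfline. (E x)\<^sup>2)"
proof -
  have ii: "integrable halfline (\<lambda>x. E' x * E x)"
    by (rule integrable_product_of_squares[OF E'm primitive_measurable[OF E] i(2,1)])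
  have "(LINT x|halfline. E' x * E x + E x * E' x) = 0"
  proof (rule integral_primitive_eq_0_trace[OF primitive_mult[OF E E]])
    show "integrable halfline (\<lambda>x. E' x * E x + E x * E' x)" using ii by (simp add: mult.commute)
    show "integrable halfline (\<lambda>x. E x * E x)" using i(1) by (simp add: power2_eq_square)
    show "((\<lambda>x. E x * E x) \<longlongrightarrow> 0) (at_right 0)" using tendsto_mult[OF E0 E0] by simp
  qed
  then have zero: "(LINT x|halfline. E' x * E x) = 0" using ii by (simp add: mult.commute)
  have "(LINT x|halfline. (E' x + b * E x)\<^sup>2) = (LINT x|halfline. (E' x)\<^sup>2 + b\<^sup>2 * (E x)\<^sup>2 + 2 * b * (E' x * E x))"
    by (intro Bochner_Integration.integral_cong refl) (simp add: power2_eq_square algebra_simps)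
  then show ?thesis using i ii zero by simp
qed

lemma integrable_square_diff:
  fixes u v :: "'a \<Rightarrow> real"
  assumes "u \<in> borel_measurable M" "v \<in> borel_measurable M"
    "integrable M (\<lambda>x. (u x)\<^sup>2)" "integrable M (\<lambda>x. (v x)\<^sup>2)"
  shows "integrable M (\<lambda>x. (u x - v x)\<^sup>2)"
  using integrable_square_add[of u M "\<lambda>x. - v x"] assms by simp

lemma expoly_tendsto_0: "(expoly b q \<longlongrightarrow> poly q 0) (at_right 0)"
proof -
  have "continuous (at_right 0) (expoly b q)"
    using expoly_continuous[of UNIV b q] by (simp add: continuous_on_eq_continuous_at continuous_at_imp_continuous_at_within)
  then show ?thesis by (simp add: continuous_within expoly_def)
qed

text \<open>The best approximation \<open>exp (-b x) p\<close> of \<open>G 0 = D V\<close> is \<open>D (exp (-b x) q)\<close> for each antiderivative \<open>q\<close> of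
  \<open>p\<close>, and the constant of integration is free to match the boundary value.\<close>

lemma energy_approximation:
  fixes G :: "nat \<Rightarrow> real \<Rightarrow> real"
  assumes b: "b > 0"
    and V: "primitive V V'" "V' \<in> borel_measurable halfline" "(V \<longlongrightarrow> \<eta>) (at_right 0)"
    and Vi: "integrable halfline (\<lambda>x. (V x)\<^sup>2)" "integrable halfline (\<lambda>x. (V' x)\<^sup>2)"
    and Gm: "\<And>j. j \<le> m \<Longrightarrow> G j \<in> borel_measurable halfline"
    and Gp: "\<And>j. j < m \<Longrightarrow> primitive (G j) (\<lambda>x. G (Suc j) x - b * G j x)"
    and Gi: "\<And>j. j \<le> m \<Longrightarrow> integrable halfline (\<lambda>x. (G j x)\<^sup>2 * x ^ j)"
    and G0: "G 0 = (\<lambda>x. V' x + b * V x)"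
    and N: "m \<le> N + 1"
  shows "\<exists>q. degree q \<le> N + 1 \<and> poly q 0 = \<eta> \<and>
    (LINT x|halfline. (V' x - expoly b (pderiv q - smult b q) x)\<^sup>2) + b\<^sup>2 * (LINT x|halfline. (V x - expoly b q x)\<^sup>2)
      \<le> (LINT x|halfline. (G m x)\<^sup>2 * x ^ m) / (\<Prod>i<m. (2 * b) * (real (N + 1) - real i))"
proof -
  obtain p where p: "degree p \<le> N" "(LINT x|halfline. (G 0 x - expoly b p x)\<^sup>2)
      \<le> (LINT x|halfline. (G m x)\<^sup>2 * x ^ m) / (\<Prod>i<m. (2 * b) * (real (N + 1) - real i))"
    using twisted_approximation[OF b Gm Gp Gi N] by blast
  obtain q where q: "pderiv q = p" "degree q \<le> N + 1" "poly q 0 = \<eta>"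
    using polynomial_antiderivative[OF p(1)] by blast
  let ?E = "\<lambda>x. V x - expoly b q x" and ?E' = "\<lambda>x. V' x - expoly b (pderiv q - smult b q) x"
  have "(LINT x|halfline. (?E' x + b * ?E x)\<^sup>2) = (LINT x|halfline. (?E' x)\<^sup>2) + b\<^sup>2 * (LINT x|halfline. (?E x)\<^sup>2)"
  proof (rule twisted_norm)
    show "primitive ?E ?E'" by (rule primitive_diff[OF V(1) primitive_expoly])
    show "?E' \<in> borel_measurable halfline" using V(2) by measurable
    show "integrable halfline (\<lambda>x. (?E x)\<^sup>2)" "integrable halfline (\<lambda>x. (?E' x)\<^sup>2)"
      by (intro integrable_square_diff Vi V(2) primitive_measurable[OF V(1)] expoly_measurable integrable_expoly_square b)+
    show "(?E \<longlongrightarrow> 0) (at_right 0)" using tendsto_diff[OF V(3) expoly_tendsto_0[of b q]] q(3) by simp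
  qed
  moreover have "?E' x + b * ?E x = G 0 x - expoly b p x" for x
    unfolding G0 by (simp add: expoly_def q(1) algebra_simps)
  ultimately show ?thesis using p(2) q(2,3) by (intro exI[of _ q]) simp
qed

section \<open>The dual problem\<close>

definition exp_decay :: "real \<Rightarrow> (real \<Rightarrow> real) \<Rightarrow> bool" where
  "exp_decay c f \<longleftrightarrow> f \<in> borel_measurable halfline \<and> (\<exists>C. \<forall>x>0. \<bar>f x\<bar> \<le> C * exp (- c * x))"

lemma exp_decay_measurable: "exp_decay c f \<Longrightarrow> f \<in> borel_measurable halfline"
  unfolding exp_decay_def by blast

lemma exp_decay_add:
  assumes "exp_decay c f" "exp_decay c g"
  shows "exp_decay c (\<lambda>x. f x + g x)"
proof -
  obtain C C' where CC: "\<And>x. x > 0 \<Longrightarrow> \<bar>f x\<bar> \<le> C * exp (- c * x)" "\<And>x. x > 0 \<Longrightarrow> \<bar>g x\<bar> \<le> C' * exp (- c * x)"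
    using assms unfolding exp_decay_def by blast
  have "\<bar>f x + g x\<bar> \<le> (C + C') * exp (- c * x)" if "x > 0" for x
    using CC[OF that] abs_triangle_ineq[of "f x" "g x"] unfolding distrib_right by linarith
  then show ?thesis using assms unfolding exp_decay_def by (intro conjI borel_measurable_add) blast+
qed

lemma exp_decay_cmult:
  assumes "exp_decay c f"
  shows "exp_decay c (\<lambda>x. k * f x)"
proof -
  obtain C where C: "\<And>x. x > 0 \<Longrightarrow> \<bar>f x\<bar> \<le> C * exp (- c * x)"
    using assms unfolding exp_decay_def by blast
  have "\<bar>k * f x\<bar> \<le> (\<bar>k\<bar> * C) * exp (- c * x)" if "x > 0" for x
    using mult_left_mono[OF C[OF that], of "\<bar>k\<bar>"] by (simp add: abs_mult mult.assoc)
  moreover have "(\<lambda>x. k * f x) \<in> borel_measurable halfline"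
    using exp_decay_measurable[OF assms] by measurable
  ultimately show ?thesis unfolding exp_decay_def by blast
qed

lemma exp_decay_diff:
  assumes "exp_decay c f" "exp_decay c g"
  shows "exp_decay c (\<lambda>x. f x - g x)"
  using exp_decay_add[OF assms(1) exp_decay_cmult[OF assms(2), of "-1"]] by simp

lemma exp_decay_product:
  assumes c: "c > 0" and f: "exp_decay c f" and g: "exp_decay c g"
  shows "integrable halfline (\<lambda>x. f x * g x * x ^ k)"
proof -
  obtain C C' where CC: "\<And>x. x > 0 \<Longrightarrow> \<bar>f x\<bar> \<le> C * exp (- c * x)" "\<And>x. x > 0 \<Longrightarrow> \<bar>g x\<bar> \<le> C' * exp (- c * x)"
    using f g unfolding exp_decay_def by blast
  note [measurable] = exp_decay_measurable[OF f] exp_decay_measurable[OF g]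
  show ?thesis
  proof (rule Bochner_Integration.integrable_bound)
    show "integrable halfline (\<lambda>x. C * C' * expoly (2 * c) (monom 1 k) x)"
      using integrable_expoly[of "2 * c"] c by simp
    show "AE x in halfline. norm (f x * g x * x ^ k) \<le> norm (C * C' * expoly (2 * c) (monom 1 k) x)"
    proof (rule AE_I2)
      fix x assume "x \<in> space halfline"
      then have x: "x > 0" by simp
      have "\<bar>f x\<bar> * \<bar>g x\<bar> \<le> (C * exp (- c * x)) * (C' * exp (- c * x))"
        using CC[OF x] order_trans[OF abs_ge_zero CC(1)[OF x]] by (intro mult_mono) auto
      then have "\<bar>f x\<bar> * \<bar>g x\<bar> * x ^ k \<le> (C * exp (- c * x)) * (C' * exp (- c * x)) * x ^ k"
        using x by (intro mult_right_mono) auto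
      also have "(C * exp (- c * x)) * (C' * exp (- c * x)) * x ^ k = C * C' * expoly (2 * c) (monom 1 k) x"
        by (simp add: expoly_def poly_monom mult_ac flip: exp_add)
      finally have "\<bar>f x\<bar> * \<bar>g x\<bar> * x ^ k \<le> \<bar>C * C' * expoly (2 * c) (monom 1 k) x\<bar>"
        by linarith
      moreover have "norm (f x * g x * x ^ k) = \<bar>f x\<bar> * \<bar>g x\<bar> * x ^ k" using x by (simp add: abs_mult)
      ultimately show "norm (f x * g x * x ^ k) \<le> norm (C * C' * expoly (2 * c) (monom 1 k) x)"
        by (simp only: real_norm_def)
    qed
  qed measurable
qed

lemma exp_decay_supported:
  assumes "F \<in> borel_measurable halfline" and le: "\<And>x. \<bar>F x\<bar> \<le> M" and supp: "\<And>x. x \<ge> T \<Longrightarrow> F x = 0"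
    and c: "c > 0"
  shows "exp_decay c F"
proof -
  have M: "M \<ge> 0" using order_trans[OF abs_ge_zero le] .
  have "\<bar>F x\<bar> \<le> (M * exp (c * T)) * exp (- c * x)" if "x > 0" for x
  proof (cases "x \<ge> T")
    case True
    then have "\<bar>F x\<bar> = 0" using supp by simp
    then show ?thesis using M by (simp only:) simp
  next
    case False
    then have "1 \<le> exp (c * T + - c * x)" using c by simp
    then have "M * 1 \<le> M * exp (c * T + - c * x)" using M by (intro mult_left_mono)
    then show ?thesis using le[of x] unfolding exp_add by simp
  qed
  then show ?thesis using assms(1) unfolding exp_decay_def by blast
qed

text \<open>Variation of constants. The right-hand side vanishes near both ends, so the solution is explicit
  there and every integral below converges.\<close>

lemma dual_solution:
  assumes \<gamma>: "\<gamma> > 0" and \<delta>: "0 < \<delta>" "\<delta> \<le> T" and Fm: "F \<in> borel_measurable halfline"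
    and le: "\<And>x. \<bar>F x\<bar> \<le> M" and supp: "\<And>x. x \<notin> {\<delta><..<T} \<Longrightarrow> F x = 0"
  shows "\<exists>z z'. primitive z z' \<and> primitive z' (\<lambda>x. \<gamma> * z x - F x) \<and> (z \<longlongrightarrow> 0) (at_right 0) \<and>
    exp_decay (sqrt \<gamma>) z \<and> exp_decay (sqrt \<gamma>) z'"
proof -
  define \<kappa> where "\<kappa> = sqrt \<gamma>"
  have \<kappa>: "\<kappa> > 0" "\<kappa> * \<kappa> = \<gamma>" using \<gamma> by (simp_all add: \<kappa>_def)
  have li: "locally_integrable (\<lambda>x. k x * F x)" if k: "continuous_on {0<..} k" for k
    unfolding locally_integrable_def
  proof (intro allI impI)
    fix a b :: real assume a: "0 < a"
    have kc: "continuous_on {a..b} k" by (rule continuous_on_subset[OF k]) (use a in auto)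
    have "integrable (lebesgue_on {a..b}) k" by (rule continuous_imp_integrable_real[OF kc])
    moreover have "F \<in> borel_measurable (lebesgue_on {a..b})"
    proof -
      have "{a..b} \<subseteq> {0<..}" using a by auto
      then show ?thesis by (rule measurable_restrict_mono[OF Fm])
    qed
    ultimately show "integrable (lebesgue_on {a..b}) (\<lambda>x. k x * F x)"
      by (rule integrable_mult_bounded(1)) (rule le)
  qed
  have cs: "continuous_on {0<..} (\<lambda>x. sinh (\<kappa> * x))" by (intro continuous_intros)
  have ce: "continuous_on {0<..} (\<lambda>x. - exp (- \<kappa> * x))" by (intro continuous_intros)
  obtain A0 where A0: "primitive A0 (\<lambda>x. sinh (\<kappa> * x) * F x)"
    using exists_primitive[OF li[OF cs]] by blast
  obtain B0 where B0: "primitive B0 (\<lambda>x. - exp (- \<kappa> * x) * F x)"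
    using exists_primitive[OF li[OF ce]] by blast
  define A where "A x = A0 x - A0 \<delta>" for x
  define B where "B x = B0 x - B0 T" for x
  have A: "primitive A (\<lambda>x. sinh (\<kappa> * x) * F x)"
    using primitive_diff[OF A0 primitive_const[of "A0 \<delta>"]] by (simp add: A_def[abs_def])
  have B: "primitive B (\<lambda>x. - exp (- \<kappa> * x) * F x)"
    using primitive_diff[OF B0 primitive_const[of "B0 T"]] by (simp add: B_def[abs_def])
  have const: "P x = P y" if P: "primitive P (\<lambda>x. k x * F x)" and xy: "0 < x" "x \<le> y" "y \<le> \<delta> \<or> T \<le> x" for P k x y
  proof -
    have "(LINT t|lebesgue_on {x..y}. k t * F t) = (LINT t|lebesgue_on {x..y}. 0)"
      using xy by (intro Bochner_Integration.integral_cong) (auto intro!: supp)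
    then show ?thesis using primitiveD(2)[OF P xy(1,2)] by simp
  qed
  have bounded: "\<exists>C. \<forall>x>0. \<bar>P x\<bar> \<le> C" if P: "primitive P (\<lambda>x. k x * F x)" for P k
  proof -
    have "continuous_on {\<delta>..T} P" by (rule continuous_on_subset[OF primitive_continuous[OF P]]) (use \<delta> in auto)
    then obtain C where C: "\<And>x. x \<in> {\<delta>..T} \<Longrightarrow> \<bar>P x\<bar> \<le> C" using continuous_on_Icc_bounded by blast
    have "\<bar>P x\<bar> \<le> C" if "x > 0" for x
    proof -
      consider "x \<le> \<delta>" | "x \<in> {\<delta>..T}" | "T \<le> x" by fastforce
      then show ?thesis
      proof cases
        case 1
        then have "P x = P \<delta>" using const[OF P, of x \<delta>] that by simp
        then show ?thesis using C[of \<delta>] \<delta> by simp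
      next
        case 3
        then have "P T = P x" using const[OF P, of T x] \<delta> by simp
        then show ?thesis using C[of T] \<delta> by simp
      qed (rule C)
    qed
    then show ?thesis by blast
  qed
  obtain CA where CA: "\<And>x. x > 0 \<Longrightarrow> \<bar>A x\<bar> \<le> CA" using bounded[OF A] by blast
  obtain CB where CB: "\<And>x. x > 0 \<Longrightarrow> \<bar>B x\<bar> \<le> CB" using bounded[OF B] by blast
  have BT: "B x = 0" if "x \<ge> T" for x
    using const[OF B, of T x] that \<delta> by (simp add: B_def)
  have A\<delta>: "A x = 0" if "0 < x" "x \<le> \<delta>" for x
    using const[OF A, of x \<delta>] that by (simp add: A_def)
  \<comment> \<open>\<open>sinh (\<kappa>x)\<close> vanishes at \<open>0\<close> and \<open>exp (-\<kappa>x)\<close> at infinity; together they form Green's function.\<close>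
  define z where "z x = (1 / \<kappa>) * (exp (- \<kappa> * x) * A x + sinh (\<kappa> * x) * B x)" for x
  define z' where "z' x = - exp (- \<kappa> * x) * A x + cosh (\<kappa> * x) * B x" for x
  have Pe: "primitive (\<lambda>x. exp (- \<kappa> * x)) (\<lambda>x. - \<kappa> * exp (- \<kappa> * x))"
    and Ps: "primitive (\<lambda>x. sinh (\<kappa> * x)) (\<lambda>x. \<kappa> * cosh (\<kappa> * x))"
    and Pc: "primitive (\<lambda>x. cosh (\<kappa> * x)) (\<lambda>x. \<kappa> * sinh (\<kappa> * x))"
    by (rule primitive_C1; auto intro!: derivative_eq_intros continuous_intros)+
  have e: "exp (- \<kappa> * x) * sinh (\<kappa> * x) + exp (- \<kappa> * x) * cosh (\<kappa> * x) = 1" for x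
  proof -
    have "exp (- \<kappa> * x) * (sinh (\<kappa> * x) + cosh (\<kappa> * x)) = 1"
      unfolding sinh_plus_cosh by (simp flip: exp_add)
    then show ?thesis by (simp add: distrib_left)
  qed
  have "primitive z z'"
    using primitive_cmult[OF primitive_add[OF primitive_mult[OF Pe A] primitive_mult[OF Ps B]], of "1 / \<kappa>"]
    by (rule primitive_cong) (use \<kappa> in \<open>auto simp: z_def z'_def field_simps\<close>)
  moreover have "primitive z' (\<lambda>x. \<gamma> * z x - F x)"
    using primitive_add[OF primitive_cmult[OF primitive_mult[OF Pe A], of "-1"] primitive_mult[OF Pc B]]
  proof (rule primitive_cong)
    fix x :: real assume "x > 0"
    show "- 1 * (exp (- \<kappa> * x) * A x) + cosh (\<kappa> * x) * B x = z' x" by (simp add: z'_def)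
    have "\<gamma> * z x = \<kappa> * (exp (- \<kappa> * x) * A x + sinh (\<kappa> * x) * B x)"
      unfolding \<kappa>(2)[symmetric] z_def using \<kappa>(1) by simp
    moreover have "F x = (exp (- \<kappa> * x) * sinh (\<kappa> * x) + exp (- \<kappa> * x) * cosh (\<kappa> * x)) * F x"
      unfolding e by simp
    ultimately show "- 1 * (- \<kappa> * exp (- \<kappa> * x) * A x + exp (- \<kappa> * x) * (sinh (\<kappa> * x) * F x)) +
        (\<kappa> * sinh (\<kappa> * x) * B x + cosh (\<kappa> * x) * (- exp (- \<kappa> * x) * F x)) = \<gamma> * z x - F x"
      by (simp only: distrib_right) (simp add: algebra_simps)
  qed
  moreover have "(z \<longlongrightarrow> 0) (at_right 0)"
  proof -
    have "((\<lambda>x. (1 / \<kappa>) * (sinh (\<kappa> * x) * B \<delta>)) \<longlongrightarrow> (1 / \<kappa>) * (sinh (\<kappa> * 0) * B \<delta>)) (at_right 0)"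
      by (intro tendsto_intros)
    moreover have "eventually (\<lambda>x. (1 / \<kappa>) * (sinh (\<kappa> * x) * B \<delta>) = z x) (at_right 0)"
      unfolding eventually_at_right[OF zero_less_one]
    proof (intro exI[of _ \<delta>] conjI \<delta>(1) allI impI)
      fix x :: real assume x: "0 < x" "x < \<delta>"
      then show "(1 / \<kappa>) * (sinh (\<kappa> * x) * B \<delta>) = z x"
        using A\<delta>[of x] const[OF B, of x \<delta>] by (simp add: z_def)
    qed
    ultimately show ?thesis by (simp add: Lim_transform_eventually)
  qed
  moreover have decay: "\<bar>exp (- \<kappa> * x) * A x\<bar> + exp (\<kappa> * x) * \<bar>B x\<bar> \<le> (CA + CB * exp (2 * \<kappa> * T)) * exp (- \<kappa> * x)" if x: "x > 0" for x
  proof -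
    have CB0: "CB \<ge> 0" using order_trans[OF abs_ge_zero CB[OF x]] .
    have "\<bar>exp (- \<kappa> * x) * A x\<bar> \<le> CA * exp (- \<kappa> * x)" using CA[OF x] by (simp add: abs_mult mult.commute)
    moreover have "exp (\<kappa> * x) * \<bar>B x\<bar> \<le> CB * exp (2 * \<kappa> * T) * exp (- \<kappa> * x)"
    proof (cases "x \<ge> T")
      case True then show ?thesis using BT CB0 by simp
    next
      case False
      then have "\<kappa> * x \<le> \<kappa> * T" using \<kappa> by (intro mult_left_mono) auto
      then have "exp (\<kappa> * x) \<le> exp (2 * \<kappa> * T + - \<kappa> * x)" unfolding exp_le_cancel_iff by (simp add: algebra_simps)
      then have "exp (\<kappa> * x) * \<bar>B x\<bar> \<le> exp (2 * \<kappa> * T + - \<kappa> * x) * CB"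
        using CB[OF x] by (intro mult_mono) auto
      then show ?thesis unfolding exp_add by (simp only: mult_ac)
    qed
    ultimately show ?thesis unfolding distrib_right by linarith
  qed
  have hyp: "\<bar>sinh (\<kappa> * x)\<bar> \<le> exp (\<kappa> * x)" "\<bar>cosh (\<kappa> * x)\<bar> \<le> exp (\<kappa> * x)" if "x > 0" for x
  proof -
    have g: "\<bar>(r - q) / 2\<bar> \<le> r \<and> \<bar>(r + q) / 2\<bar> \<le> r" if "0 < q" "q \<le> r" for q r :: real
      using that by (auto simp: abs_if field_simps)
    have "0 \<le> \<kappa> * x" using \<kappa> that by simp
    then have p: "exp (- (\<kappa> * x)) > 0" "exp (- (\<kappa> * x)) \<le> exp (\<kappa> * x)" by (simp, simp only: exp_le_cancel_iff)
    show "\<bar>sinh (\<kappa> * x)\<bar> \<le> exp (\<kappa> * x)" "\<bar>cosh (\<kappa> * x)\<bar> \<le> exp (\<kappa> * x)"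
      unfolding sinh_field_def cosh_field_def using g[OF p] by blast+
  qed
  have hB: "\<bar>sinh (\<kappa> * x) * B x\<bar> \<le> exp (\<kappa> * x) * \<bar>B x\<bar>" "\<bar>cosh (\<kappa> * x) * B x\<bar> \<le> exp (\<kappa> * x) * \<bar>B x\<bar>" if "x > 0" for x
    unfolding abs_mult using hyp[OF that] by (auto intro: mult_right_mono)
  have z'd: "exp_decay \<kappa> z'"
    unfolding exp_decay_def
  proof (intro conjI exI allI impI)
    show "z' \<in> borel_measurable halfline" by (rule primitive_measurable[OF \<open>primitive z' _\<close>])
    fix x :: real assume x: "x > 0"
    have "\<bar>z' x\<bar> \<le> \<bar>exp (- \<kappa> * x) * A x\<bar> + \<bar>cosh (\<kappa> * x) * B x\<bar>"
      unfolding z'_def using abs_triangle_ineq[of "- exp (- \<kappa> * x) * A x"] by (simp only: mult_minus_left abs_minus)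
    then show "\<bar>z' x\<bar> \<le> (CA + CB * exp (2 * \<kappa> * T)) * exp (- \<kappa> * x)" using decay[OF x] hB(2)[OF x] by linarith
  qed
  have zd: "exp_decay \<kappa> (\<lambda>x. exp (- \<kappa> * x) * A x + sinh (\<kappa> * x) * B x)"
    unfolding exp_decay_def
  proof (intro conjI exI allI impI)
    show "(\<lambda>x. exp (- \<kappa> * x) * A x + sinh (\<kappa> * x) * B x) \<in> borel_measurable halfline"
      by (rule primitive_measurable[OF primitive_add[OF primitive_mult[OF Pe A] primitive_mult[OF Ps B]]])
    fix x :: real assume x: "x > 0"
    show "\<bar>exp (- \<kappa> * x) * A x + sinh (\<kappa> * x) * B x\<bar> \<le> (CA + CB * exp (2 * \<kappa> * T)) * exp (- \<kappa> * x)"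
      using decay[OF x] hB(1)[OF x] abs_triangle_ineq[of "exp (- \<kappa> * x) * A x" "sinh (\<kappa> * x) * B x"] by linarith
  qed
  have "exp_decay \<kappa> z" using exp_decay_cmult[OF zd, of "1 / \<kappa>"] by (simp add: z_def[abs_def])
  ultimately show ?thesis using z'd unfolding \<kappa>_def by blast
qed

text \<open>Testing \<open>- z'' + \<gamma> z = F\<close> with \<open>x z\<close>: the boundary terms vanish, and so does the integral of \<open>z z'\<close>, which
  leaves the integrals of \<open>x z'\<^sup>2 + \<gamma> x z\<^sup>2\<close> and of \<open>x F z\<close> equal.\<close>

lemma dual_estimates:
  assumes \<gamma>: "\<gamma> > 0" and c: "c > 0"
    and z: "primitive z z'" "primitive z' (\<lambda>x. \<gamma> * z x - F x)" "(z \<longlongrightarrow> 0) (at_right 0)"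
    and d: "exp_decay c z" "exp_decay c z'" "exp_decay c F"
  defines "S \<equiv> (LINT x|halfline. (F x)\<^sup>2 * x)"
  shows "\<gamma>\<^sup>2 * (LINT x|halfline. (z x)\<^sup>2 * x) \<le> S" "\<gamma> * (LINT x|halfline. (z' x)\<^sup>2 * x) \<le> S"
proof -
  note P = exp_decay_product[OF c]
  have zz': "integrable halfline (\<lambda>x. z x * z' x)" using P[OF d(1,2), of 0] by simp
  have i: "integrable halfline (\<lambda>x. (z x)\<^sup>2 * x)" "integrable halfline (\<lambda>x. (z' x)\<^sup>2 * x)"
    "integrable halfline (\<lambda>x. (F x)\<^sup>2 * x)" "integrable halfline (\<lambda>x. F x * z x * x)"
    using P[OF d(1,1), of 1] P[OF d(2,2), of 1] P[OF d(3,3), of 1] P[OF d(3,1), of 1] by (simp_all add: power2_eq_square)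
  define U where "U = (LINT x|halfline. (z x)\<^sup>2 * x)"
  define Y where "Y = (LINT x|halfline. (z' x)\<^sup>2 * x)"
  define R where "R = (LINT x|halfline. F x * z x * x)"
  have nonneg: "U \<ge> 0" "Y \<ge> 0" "S \<ge> 0"
    unfolding U_def Y_def S_def by (intro integral_nonneg_AE AE_I2; simp)+
  have zero: "(LINT x|halfline. z x * z' x) = 0"
  proof -
    have "(LINT x|halfline. z' x * z x + z x * z' x) = 0"
    proof (rule integral_primitive_eq_0_trace[OF primitive_mult[OF z(1) z(1)]])
      show "integrable halfline (\<lambda>x. z' x * z x + z x * z' x)" using zz' by (simp add: mult.commute)
      show "integrable halfline (\<lambda>x. z x * z x)" using P[OF d(1,1), of 0] by simp
      show "((\<lambda>x. z x * z x) \<longlongrightarrow> 0) (at_right 0)" using tendsto_mult[OF z(3) z(3)] by simp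
    qed
    then show ?thesis using zz' by (simp add: mult.commute)
  qed
  have PX: "primitive (\<lambda>x. x) (\<lambda>x. 1)"
    by (rule primitive_C1) (auto intro!: derivative_eq_intros continuous_intros)
  have W: "primitive (\<lambda>x. x * (z x * z' x)) (\<lambda>x. 1 * (z x * z' x) + x * (z' x * z' x + z x * (\<gamma> * z x - F x)))"
    by (rule primitive_mult[OF PX primitive_mult[OF z(1,2)]])
  have w_eq: "(\<lambda>x. 1 * (z x * z' x) + x * (z' x * z' x + z x * (\<gamma> * z x - F x)))
      = (\<lambda>x. z x * z' x + (z' x)\<^sup>2 * x + \<gamma> * ((z x)\<^sup>2 * x) - F x * z x * x)"
    by (simp add: fun_eq_iff power2_eq_square algebra_simps)
  have "integrable halfline (\<lambda>x. x * (z x * z' x) / x) = integrable halfline (\<lambda>x. z x * z' x)"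
    by (intro Bochner_Integration.integrable_cong) auto
  then have Wx: "integrable halfline (\<lambda>x. x * (z x * z' x) / x)" using zz' by simp
  have "(LINT x|halfline. z x * z' x + (z' x)\<^sup>2 * x + \<gamma> * ((z x)\<^sup>2 * x) - F x * z x * x) = 0"
    using integral_primitive_eq_0[OF W _ Wx] zz' i unfolding w_eq by simp
  then have eq: "Y + \<gamma> * U = R" using zz' i zero by (simp add: U_def Y_def R_def)
  have CS: "R\<^sup>2 \<le> S * U"
    unfolding R_def S_def U_def
    by (rule weighted_Cauchy_Schwarz(2)) (use exp_decay_measurable d i id_measurable_halfline in auto)
  have "\<gamma> * U \<ge> 0" using \<gamma> nonneg by simp
  then have le: "\<gamma> * U \<le> R" "Y \<le> R" using eq nonneg by linarith+
  have "(\<gamma> * U)\<^sup>2 \<le> R\<^sup>2" using le(1) \<open>\<gamma> * U \<ge> 0\<close> by (rule power_mono)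
  then have "(\<gamma>\<^sup>2 * U) * U \<le> S * U" using CS by (simp add: power2_eq_square mult_ac)
  then show U: "\<gamma>\<^sup>2 * U \<le> S"
    using nonneg by (cases "U = 0") (auto dest: mult_right_le_imp_le simp: less_le)
  have "Y\<^sup>2 \<le> R\<^sup>2" using le(2) nonneg(2) by (rule power_mono)
  then have "\<gamma>\<^sup>2 * Y\<^sup>2 \<le> \<gamma>\<^sup>2 * (S * U)" using CS by (intro mult_left_mono) auto
  also have "\<dots> = S * (\<gamma>\<^sup>2 * U)" by simp
  also have "\<dots> \<le> S * S" using U nonneg by (intro mult_left_mono)
  finally have "(\<gamma> * Y)\<^sup>2 \<le> S\<^sup>2" by (simp add: power2_eq_square mult_ac)
  then show "\<gamma> * Y \<le> S" using nonneg by (rule_tac power2_le_imp_le)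
qed

text \<open>The equation expresses \<open>z''\<close>, hence \<open>D\<^sup>2 z\<close>, by \<open>z\<close>, \<open>z'\<close> and \<open>F\<close>. With \<open>t = b\<^sup>2/\<gamma>\<close> the three terms together
  contribute \<open>3 ((1 + t)\<^sup>2 + 4 t + 1) \<le> 9 (1 + t)\<^sup>2\<close>.\<close>

lemma dual_approximation:
  assumes \<gamma>: "\<gamma> > 0" and b: "b > 0" and c: "c > 0"
    and z: "primitive z z'" "primitive z' (\<lambda>x. \<gamma> * z x - F x)" "(z \<longlongrightarrow> 0) (at_right 0)"
    and d: "exp_decay c z" "exp_decay c z'" "exp_decay c F"
  defines "S \<equiv> (LINT x|halfline. (F x)\<^sup>2 * x)"
  shows "\<exists>q. degree q \<le> N + 1 \<and> poly q 0 = 0 \<and>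
    (LINT x|halfline. (z' x - expoly b (pderiv q - smult b q) x)\<^sup>2) + b\<^sup>2 * (LINT x|halfline. (z x - expoly b q x)\<^sup>2)
      \<le> 9 * (1 + b\<^sup>2 / \<gamma>)\<^sup>2 * S / (2 * b * real (N + 1))"
proof -
  define G where "G j x = (if j = (0::nat) then z' x + b * z x else (\<gamma> + b\<^sup>2) * z x + 2 * b * z' x - F x)" for j x
  have G: "G 0 = (\<lambda>x. z' x + b * z x)" "G 1 = (\<lambda>x. (\<gamma> + b\<^sup>2) * z x + 2 * b * z' x - F x)"
    by (simp_all add: G_def[abs_def])
  have Gd: "exp_decay c (G j)" for j
    unfolding G_def by (cases "j = 0") (simp_all add: exp_decay_add exp_decay_diff exp_decay_cmult d)
  note P = exp_decay_product[OF c]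
  have Gi: "integrable halfline (\<lambda>x. (G j x)\<^sup>2 * x ^ k)" for j k
    using P[OF Gd Gd] by (simp add: power2_eq_square)
  have Gp: "primitive (G j) (\<lambda>x. G (Suc j) x - b * G j x)" if "j < 1" for j
    using primitive_add[OF z(2) primitive_cmult[OF z(1), of b]]
    by (rule primitive_cong) (use that in \<open>simp_all add: G_def algebra_simps power2_eq_square\<close>)
  have sq: "integrable halfline (\<lambda>x. (z x)\<^sup>2)" "integrable halfline (\<lambda>x. (z' x)\<^sup>2)"
    using P[OF d(1,1), of 0] P[OF d(2,2), of 0] by (simp_all add: power2_eq_square)
  have ex: "\<exists>q. degree q \<le> N + 1 \<and> poly q 0 = 0 \<and>
    (LINT x|halfline. (z' x - expoly b (pderiv q - smult b q) x)\<^sup>2) + b\<^sup>2 * (LINT x|halfline. (z x - expoly b q x)\<^sup>2)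
      \<le> (LINT x|halfline. (G 1 x)\<^sup>2 * x ^ 1) / (\<Prod>i<1. (2 * b) * (real (N + 1) - real i))"
    by (rule energy_approximation[OF b z(1) exp_decay_measurable[OF d(2)] z(3) sq exp_decay_measurable[OF Gd] Gp Gi G(1)])
      simp_all
  have i: "integrable halfline (\<lambda>x. (z x)\<^sup>2 * x)" "integrable halfline (\<lambda>x. (z' x)\<^sup>2 * x)" "integrable halfline (\<lambda>x. (F x)\<^sup>2 * x)"
    using P[OF d(1,1), of 1] P[OF d(2,2), of 1] P[OF d(3,3), of 1] by (simp_all add: power2_eq_square)
  define U where "U = (LINT x|halfline. (z x)\<^sup>2 * x)"
  define Y where "Y = (LINT x|halfline. (z' x)\<^sup>2 * x)"
  have est: "\<gamma>\<^sup>2 * U \<le> S" "\<gamma> * Y \<le> S" unfolding S_def U_def Y_def by (rule dual_estimates[OF \<gamma> c z d])+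
  have S: "S \<ge> 0" unfolding S_def by (intro integral_nonneg_AE AE_I2) simp
  have sq3: "(p + q - s)\<^sup>2 \<le> 3 * (p\<^sup>2 + q\<^sup>2 + s\<^sup>2)" for p q s :: real
  proof -
    have "0 \<le> (p - q)\<^sup>2 + (p + s)\<^sup>2 + (q + s)\<^sup>2" by simp
    then show ?thesis by (simp add: power2_eq_square algebra_simps)
  qed
  have "(LINT x|halfline. (G 1 x)\<^sup>2 * x ^ 1)
      \<le> (LINT x|halfline. 3 * (\<gamma> + b\<^sup>2)\<^sup>2 * ((z x)\<^sup>2 * x) + 12 * b\<^sup>2 * ((z' x)\<^sup>2 * x) + 3 * ((F x)\<^sup>2 * x))"
  proof (rule integral_mono[OF Gi])
    show "integrable halfline (\<lambda>x. 3 * (\<gamma> + b\<^sup>2)\<^sup>2 * ((z x)\<^sup>2 * x) + 12 * b\<^sup>2 * ((z' x)\<^sup>2 * x) + 3 * ((F x)\<^sup>2 * x))"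
      using i by simp
    fix x assume "x \<in> space halfline"
    then have "(G 1 x)\<^sup>2 * x \<le> (3 * (((\<gamma> + b\<^sup>2) * z x)\<^sup>2 + (2 * b * z' x)\<^sup>2 + (F x)\<^sup>2)) * x"
      unfolding G by (intro mult_right_mono sq3) simp
    also have "(3 * (((\<gamma> + b\<^sup>2) * z x)\<^sup>2 + (2 * b * z' x)\<^sup>2 + (F x)\<^sup>2)) * x
        = 3 * (\<gamma> + b\<^sup>2)\<^sup>2 * ((z x)\<^sup>2 * x) + 12 * b\<^sup>2 * ((z' x)\<^sup>2 * x) + 3 * ((F x)\<^sup>2 * x)"
      by (simp only: power_mult_distrib) (simp add: algebra_simps)
    finally show "(G 1 x)\<^sup>2 * x ^ 1 \<le> 3 * (\<gamma> + b\<^sup>2)\<^sup>2 * ((z x)\<^sup>2 * x) + 12 * b\<^sup>2 * ((z' x)\<^sup>2 * x) + 3 * ((F x)\<^sup>2 * x)"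
      by simp
  qed
  also have "\<dots> = 3 * (\<gamma> + b\<^sup>2)\<^sup>2 * U + 12 * b\<^sup>2 * Y + 3 * S" using i by (simp add: U_def Y_def S_def)
  also have "\<dots> \<le> 9 * (1 + b\<^sup>2 / \<gamma>)\<^sup>2 * S"
  proof -
    define t where "t = b\<^sup>2 / \<gamma>"
    have t: "t \<ge> 0" "b\<^sup>2 = t * \<gamma>" using \<gamma> by (simp_all add: t_def)
    have "(\<gamma> + b\<^sup>2)\<^sup>2 * U = (1 + t)\<^sup>2 * (\<gamma>\<^sup>2 * U)" unfolding t(2) by (simp add: power2_eq_square algebra_simps)
    also have "\<dots> \<le> (1 + t)\<^sup>2 * S" using est(1) by (intro mult_left_mono) auto
    finally have 1: "(\<gamma> + b\<^sup>2)\<^sup>2 * U \<le> (1 + t)\<^sup>2 * S" .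
    have "b\<^sup>2 * Y = t * (\<gamma> * Y)" unfolding t(2) by simp
    also have "\<dots> \<le> t * S" using est(2) t(1) by (intro mult_left_mono)
    finally have 2: "b\<^sup>2 * Y \<le> t * S" .
    have "0 \<le> (1 - t)\<^sup>2" by simp
    then have "4 * t \<le> (1 + t)\<^sup>2" by (simp add: power2_eq_square algebra_simps)
    then have 3: "4 * t * S \<le> (1 + t)\<^sup>2 * S" using S by (intro mult_right_mono)
    have "1 \<le> (1 + t)\<^sup>2" using t(1) by (simp add: one_le_power)
    then have 4: "1 * S \<le> (1 + t)\<^sup>2 * S" using S by (intro mult_right_mono)
    have "3 * (\<gamma> + b\<^sup>2)\<^sup>2 * U + 12 * b\<^sup>2 * Y + 3 * S = 3 * ((\<gamma> + b\<^sup>2)\<^sup>2 * U) + 12 * (b\<^sup>2 * Y) + 3 * S" by simp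
    also have "\<dots> \<le> 9 * ((1 + t)\<^sup>2 * S)" using 1 2 3 4 by linarith
    finally show ?thesis unfolding t_def by (simp only: mult.assoc)
  qed
  finally have bound: "(LINT x|halfline. (G 1 x)\<^sup>2 * x ^ 1) \<le> 9 * (1 + b\<^sup>2 / \<gamma>)\<^sup>2 * S" .
  have "(LINT x|halfline. (G 1 x)\<^sup>2 * x ^ 1) / (\<Prod>i<1. (2 * b) * (real (N + 1) - real i))
      \<le> 9 * (1 + b\<^sup>2 / \<gamma>)\<^sup>2 * S / (2 * b * real (N + 1))"
    using divide_right_mono[OF bound, of "2 * b * real (N + 1)"] b by simp
  with ex show ?thesis by (meson order_trans)
qed

section \<open>Galerkin error estimates\<close>

text \<open>The derivatives are arguments of their own, as they exist as integrands only.\<close>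

definition energy :: "real \<Rightarrow> (real \<Rightarrow> real) \<Rightarrow> (real \<Rightarrow> real) \<Rightarrow> (real \<Rightarrow> real) \<Rightarrow> (real \<Rightarrow> real) \<Rightarrow> real" where
  "energy \<gamma> f f' g g' = (LINT x|halfline. f' x * g' x) + \<gamma> * (LINT x|halfline. f x * g x)"

definition expoly' :: "real \<Rightarrow> real poly \<Rightarrow> real \<Rightarrow> real" where
  "expoly' b p = expoly b (pderiv p - smult b p)"

lemma L2w_0_diff: "f \<in> L2w 0 \<Longrightarrow> g \<in> L2w 0 \<Longrightarrow> (\<lambda>x. f x - g x) \<in> L2w 0"
  unfolding L2w_0_iff by (auto intro: integrable_square_diff)

lemma L2w_0_product: "f \<in> L2w 0 \<Longrightarrow> g \<in> L2w 0 \<Longrightarrow> integrable halfline (\<lambda>x. f x * g x)"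
  unfolding L2w_0_iff by (auto intro: integrable_product_of_squares)

lemma L2w_0_expoly: "b > 0 \<Longrightarrow> expoly b p \<in> L2w 0" "b > 0 \<Longrightarrow> expoly' b p \<in> L2w 0"
  unfolding L2w_0_iff expoly'_def by (simp_all add: integrable_expoly_square)

lemma L2w_0_exp_decay: "c > 0 \<Longrightarrow> exp_decay c f \<Longrightarrow> f \<in> L2w 0"
  unfolding L2w_0_iff using exp_decay_product[of c f f 0] exp_decay_measurable by (simp add: power2_eq_square)

lemma energy_commute: "energy \<gamma> f f' g g' = energy \<gamma> g g' f f'"
  unfolding energy_def by (simp add: mult.commute)

lemma energy_diff:
  assumes "f \<in> L2w 0" "f' \<in> L2w 0" "g \<in> L2w 0" "g' \<in> L2w 0" "h \<in> L2w 0" "h' \<in> L2w 0"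
  shows "energy \<gamma> f f' (\<lambda>x. g x - h x) (\<lambda>x. g' x - h' x) = energy \<gamma> f f' g g' - energy \<gamma> f f' h h'"
  using assms by (simp add: energy_def right_diff_distrib L2w_0_product)

lemma energy_self: "energy \<gamma> f f' f f' = (LINT x|halfline. (f' x)\<^sup>2) + \<gamma> * (LINT x|halfline. (f x)\<^sup>2)"
  by (simp add: energy_def power2_eq_square)

lemma energy_self_nonneg: "\<gamma> \<ge> 0 \<Longrightarrow> 0 \<le> energy \<gamma> f f' f f'"
  unfolding energy_self by simp

lemma energy_Cauchy_Schwarz:
  assumes \<gamma>: "\<gamma> \<ge> 0" and L: "f \<in> L2w 0" "f' \<in> L2w 0" "g \<in> L2w 0" "g' \<in> L2w 0"
  shows "(energy \<gamma> f f' g g')\<^sup>2 \<le> energy \<gamma> f f' f f' * energy \<gamma> g g' g g'"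
proof -
  define p where "p = (LINT x|halfline. f' x * g' x)"
  define q where "q = (LINT x|halfline. f x * g x)"
  define A where "A = (LINT x|halfline. (f' x)\<^sup>2)"
  define B where "B = (LINT x|halfline. (f x)\<^sup>2)"
  define C where "C = (LINT x|halfline. (g' x)\<^sup>2)"
  define D where "D = (LINT x|halfline. (g x)\<^sup>2)"
  have nonneg: "A \<ge> 0" "B \<ge> 0" "C \<ge> 0" "D \<ge> 0" by (simp_all add: A_def B_def C_def D_def)
  have p: "p\<^sup>2 \<le> A * C" and q: "q\<^sup>2 \<le> B * D"
    using L unfolding p_def q_def A_def B_def C_def D_def L2w_0_iff by (auto intro: Cauchy_Schwarz_integral)
  have "(2 * (p * q))\<^sup>2 \<le> (A * D + B * C)\<^sup>2"
  proof -
    have "p\<^sup>2 * q\<^sup>2 \<le> (A * C) * (B * D)" using p q nonneg by (intro mult_mono) auto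
    moreover have "0 \<le> (A * D - B * C)\<^sup>2" by simp
    ultimately show ?thesis by (simp add: power2_eq_square algebra_simps)
  qed
  then have pq: "2 * (p * q) \<le> A * D + B * C" using nonneg by (rule_tac power2_le_imp_le) auto
  have "(p + \<gamma> * q)\<^sup>2 = p\<^sup>2 + \<gamma> * (2 * (p * q)) + \<gamma>\<^sup>2 * q\<^sup>2" by (simp add: power2_eq_square algebra_simps)
  also have "\<dots> \<le> A * C + \<gamma> * (A * D + B * C) + \<gamma>\<^sup>2 * (B * D)"
    using p q pq \<gamma> by (intro add_mono mult_left_mono) auto
  also have "\<dots> = (A + \<gamma> * B) * (C + \<gamma> * D)" by (simp add: power2_eq_square algebra_simps)
  finally show ?thesis
    unfolding energy_self unfolding energy_def p_def q_def A_def B_def C_def D_def .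
qed

lemma energy_le_twisted:
  assumes "\<gamma> > 0" "b > 0"
  shows "energy \<gamma> f f' f f' \<le> (1 + \<gamma> / b\<^sup>2) * ((LINT x|halfline. (f' x)\<^sup>2) + b\<^sup>2 * (LINT x|halfline. (f x)\<^sup>2))"
proof -
  define A B where "A = (LINT x|halfline. (f' x)\<^sup>2)" and "B = (LINT x|halfline. (f x)\<^sup>2)"
  have AB: "A \<ge> 0" "B \<ge> 0" by (simp_all add: A_def B_def)
  have "(1 + \<gamma> / b\<^sup>2) * (A + b\<^sup>2 * B) = A + \<gamma> * B + (\<gamma> / b\<^sup>2 * A + b\<^sup>2 * B)"
    using assms by (simp add: field_simps)
  moreover have "0 \<le> \<gamma> / b\<^sup>2 * A + b\<^sup>2 * B" using AB assms by simp
  ultimately show ?thesis unfolding energy_self A_def[symmetric] B_def[symmetric] by simp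
qed

lemma le_if_square_le_mult:
  fixes s k :: real
  assumes "s\<^sup>2 \<le> s * k" "0 \<le> s" "0 \<le> k"
  shows "s \<le> k"
  using assms by (cases "s = 0") (auto simp: power2_eq_square)

text \<open>The exact solution enters through a representative \<open>V\<close> with derivative \<open>V'\<close>, the discrete solution through
  its polynomial, and the two problems only through Galerkin orthogonality.\<close>

locale galerkin_error =
  fixes b \<gamma> \<eta> :: real and V V' :: "real \<Rightarrow> real" and p :: "real poly" and N :: nat
  assumes b: "b > 0" and \<gamma>: "\<gamma> > 0"
    and V: "primitive V V'" "V \<in> L2w 0" "V' \<in> L2w 0" "(V \<longlongrightarrow> \<eta>) (at_right 0)"
    and p: "degree p \<le> N" "poly p 0 = \<eta>"
    and orth: "\<And>q. degree q \<le> N \<Longrightarrow> poly q 0 = 0 \<Longrightarrow>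
      energy \<gamma> (\<lambda>x. V x - expoly b p x) (\<lambda>x. V' x - expoly' b p x) (expoly b q) (expoly' b q) = 0"
begin

definition E :: "real \<Rightarrow> real" where "E x = V x - expoly b p x"
definition E' :: "real \<Rightarrow> real" where "E' x = V' x - expoly' b p x"

lemma E_primitive: "primitive E E'"
  unfolding E_def[abs_def] E'_def[abs_def] expoly'_def by (rule primitive_diff[OF V(1) primitive_expoly])

lemma E_L2: "E \<in> L2w 0" "E' \<in> L2w 0"
  unfolding E_def[abs_def] E'_def[abs_def] by (intro L2w_0_diff V L2w_0_expoly b)+

lemma E_tendsto_0: "(E \<longlongrightarrow> 0) (at_right 0)"
  using tendsto_diff[OF V(4) expoly_tendsto_0[of b p]] p(2) by (simp add: E_def[abs_def])

lemma galerkin_orthogonality: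
  "degree q \<le> N \<Longrightarrow> poly q 0 = 0 \<Longrightarrow> energy \<gamma> E E' (expoly b q) (expoly' b q) = 0"
  using orth unfolding E_def[abs_def] E'_def[abs_def] by blast

lemma cea:
  assumes q: "degree q \<le> N" "poly q 0 = \<eta>"
  shows "energy \<gamma> E E' E E' \<le> energy \<gamma> (\<lambda>x. V x - expoly b q x) (\<lambda>x. V' x - expoly' b q x)
    (\<lambda>x. V x - expoly b q x) (\<lambda>x. V' x - expoly' b q x)"
proof -
  let ?R = "\<lambda>x. V x - expoly b q x" and ?R' = "\<lambda>x. V' x - expoly' b q x"
  have R: "?R \<in> L2w 0" "?R' \<in> L2w 0" by (intro L2w_0_diff V L2w_0_expoly b)+
  have zero: "energy \<gamma> E E' (expoly b (p - q)) (expoly' b (p - q)) = 0"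
    using p q by (intro galerkin_orthogonality degree_diff_le) auto
  have "energy \<gamma> E E' (\<lambda>x. ?R x - expoly b (p - q) x) (\<lambda>x. ?R' x - expoly' b (p - q) x) = energy \<gamma> E E' ?R ?R'"
    using energy_diff[OF E_L2 R L2w_0_expoly[OF b, of "p - q"]] zero by simp
  moreover have "(\<lambda>x. ?R x - expoly b (p - q) x) = E" "(\<lambda>x. ?R' x - expoly' b (p - q) x) = E'"
    by (simp_all add: fun_eq_iff E_def E'_def expoly'_def expoly_def pderiv_diff algebra_simps)
  ultimately have "energy \<gamma> E E' E E' = energy \<gamma> E E' ?R ?R'" by simp
  then have "(energy \<gamma> E E' E E')\<^sup>2 \<le> energy \<gamma> E E' E E' * energy \<gamma> ?R ?R' ?R ?R'"
    using energy_Cauchy_Schwarz[OF _ E_L2 R, of \<gamma>] \<gamma> by simp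
  then show ?thesis
    by (rule le_if_square_le_mult; intro energy_self_nonneg less_imp_le[OF \<gamma>])
qed

text \<open>Let \<open>z\<close> solve the dual problem with the data \<open>E/x\<close>, restricted to a compact interval. The left-hand side
  is the energy product of \<open>E\<close> with \<open>z\<close>; by orthogonality only the approximation error of \<open>z\<close> counts, and this
  is bounded by the square root of the left-hand side itself.\<close>

lemma dual_bound:
  assumes N: "N \<ge> 1" and \<delta>: "0 < \<delta>" "\<delta> \<le> T"
  shows "(LINT x|halfline. indicator {\<delta><..<T} x * ((E x)\<^sup>2 / x))
    \<le> 9 * (1 + \<gamma> / b\<^sup>2) * (1 + b\<^sup>2 / \<gamma>)\<^sup>2 / (2 * b * real N) * energy \<gamma> E E' E E'"
proof -
  define F where "F x = indicator {\<delta><..<T} x * (E x / x)" for x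
  have "continuous_on {\<delta>..T} (\<lambda>x. E x / x)"
    using \<delta> by (intro continuous_intros continuous_on_subset[OF primitive_continuous[OF E_primitive]]) auto
  then obtain M where M: "\<And>x. x \<in> {\<delta>..T} \<Longrightarrow> \<bar>E x / x\<bar> \<le> M" using continuous_on_Icc_bounded by blast
  have F_le: "\<bar>F x\<bar> \<le> max M 0" for x
  proof (cases "x \<in> {\<delta><..<T}")
    case True
    then show ?thesis using M[of x] by (simp add: F_def)
  qed (simp add: F_def)
  have F_supp: "F x = 0" if "x \<notin> {\<delta><..<T}" for x using that by (simp add: F_def)
  have [measurable]: "E \<in> borel_measurable halfline" "E' \<in> borel_measurable halfline"
    using E_L2 unfolding L2w_0_iff by auto
  have [measurable]: "indicator {\<delta><..<T} \<in> borel_measurable halfline"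
    using \<delta> by (intro borel_measurable_indicator sets_halfline) auto
  have Fm: "F \<in> borel_measurable halfline" unfolding F_def by measurable
  define c where "c = sqrt \<gamma>"
  have c: "c > 0" using \<gamma> by (simp add: c_def)
  obtain z z' where z: "primitive z z'" "primitive z' (\<lambda>x. \<gamma> * z x - F x)" "(z \<longlongrightarrow> 0) (at_right 0)"
    "exp_decay c z" "exp_decay c z'"
    using dual_solution[OF \<gamma> \<delta> Fm F_le F_supp] unfolding c_def by blast
  have Fd: "exp_decay c F"
    by (rule exp_decay_supported[OF Fm F_le _ c, of T]) (rule F_supp, simp)
  define S where "S = (LINT x|halfline. (F x)\<^sup>2 * x)"
  have "S \<ge> 0" unfolding S_def by (intro integral_nonneg_AE AE_I2) simp
  note zL = L2w_0_exp_decay[OF c z(4)] L2w_0_exp_decay[OF c z(5)] L2w_0_exp_decay[OF c Fd]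
  have S_eq: "S = (LINT x|halfline. indicator {\<delta><..<T} x * ((E x)\<^sup>2 / x))"
    unfolding S_def by (intro Bochner_Integration.integral_cong refl)
      (auto simp: F_def indicator_def power2_eq_square field_simps)
  have FE: "(LINT x|halfline. F x * E x) = S"
    unfolding S_def by (intro Bochner_Integration.integral_cong refl)
      (auto simp: F_def indicator_def power2_eq_square field_simps)
  have "energy \<gamma> E E' z z' = S"
  proof -
    have w_eq: "(\<lambda>x. (\<gamma> * z x - F x) * E x + z' x * E' x) = (\<lambda>x. \<gamma> * (E x * z x) - F x * E x + E' x * z' x)"
      by (simp add: fun_eq_iff algebra_simps)
    note i = L2w_0_product[OF E_L2(1) zL(1)] L2w_0_product[OF zL(3) E_L2(1)] L2w_0_product[OF E_L2(2) zL(2)]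
    have "(LINT x|halfline. (\<gamma> * z x - F x) * E x + z' x * E' x) = 0"
    proof (rule integral_primitive_eq_0_trace[OF primitive_mult[OF z(2) E_primitive]])
      show "integrable halfline (\<lambda>x. (\<gamma> * z x - F x) * E x + z' x * E' x)"
        unfolding w_eq using i by simp
      show "integrable halfline (\<lambda>x. z' x * E x)" by (rule L2w_0_product[OF zL(2) E_L2(1)])
      obtain C where C: "\<And>x. x > 0 \<Longrightarrow> \<bar>z' x\<bar> \<le> C * exp (- c * x)"
        using z(5) unfolding exp_decay_def by blast
      show "((\<lambda>x. z' x * E x) \<longlongrightarrow> 0) (at_right 0)"
      proof (rule Lim_null_comparison)
        show "((\<lambda>x. (C * exp (- c * x)) * \<bar>E x\<bar>) \<longlongrightarrow> 0) (at_right 0)"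
          by (rule tendsto_eq_intros E_tendsto_0 refl | simp)+
        show "eventually (\<lambda>x. norm (z' x * E x) \<le> (C * exp (- c * x)) * \<bar>E x\<bar>) (at_right 0)"
          using eventually_at_right_less[of "0::real"]
        proof eventually_elim
          case (elim x)
          then show ?case using mult_right_mono[OF C[of x], of "\<bar>E x\<bar>"] by (simp add: abs_mult)
        qed
      qed
    qed
    then have "\<gamma> * (LINT x|halfline. E x * z x) - (LINT x|halfline. F x * E x) + (LINT x|halfline. E' x * z' x) = 0"
      unfolding w_eq using i by simp
    then show ?thesis unfolding FE energy_def by simp
  qed
  obtain n where n: "N = n + 1" using N by (metis add.commute le_Suc_ex)
  define K where "K = 9 * (1 + b\<^sup>2 / \<gamma>)\<^sup>2 / (2 * b * real N)"
  have "K \<ge> 0" using b by (simp add: K_def)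
  obtain q where q: "degree q \<le> N" "poly q 0 = 0"
    "(LINT x|halfline. (z' x - expoly' b q x)\<^sup>2) + b\<^sup>2 * (LINT x|halfline. (z x - expoly b q x)\<^sup>2) \<le> K * S"
    using dual_approximation[OF \<gamma> b c z Fd, of n] unfolding n[symmetric] S_def[symmetric] expoly'_def K_def by auto
  let ?r = "\<lambda>x. z x - expoly b q x" and ?r' = "\<lambda>x. z' x - expoly' b q x"
  have r: "?r \<in> L2w 0" "?r' \<in> L2w 0" by (intro L2w_0_diff zL L2w_0_expoly b)+
  have "energy \<gamma> E E' ?r ?r' = S"
    using energy_diff[OF E_L2 zL(1,2) L2w_0_expoly[OF b, of q]] \<open>energy \<gamma> E E' z z' = S\<close> galerkin_orthogonality[OF q(1,2)]
    by simp
  then have "S\<^sup>2 \<le> energy \<gamma> E E' E E' * energy \<gamma> ?r ?r' ?r ?r'"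
    using energy_Cauchy_Schwarz[OF _ E_L2 r, of \<gamma>] \<gamma> by simp
  also have "\<dots> \<le> energy \<gamma> E E' E E' * ((1 + \<gamma> / b\<^sup>2) * (K * S))"
  proof (intro mult_left_mono)
    have "energy \<gamma> ?r ?r' ?r ?r' \<le> (1 + \<gamma> / b\<^sup>2) * ((LINT x|halfline. (?r' x)\<^sup>2) + b\<^sup>2 * (LINT x|halfline. (?r x)\<^sup>2))"
      by (rule energy_le_twisted[OF \<gamma> b])
    also have "\<dots> \<le> (1 + \<gamma> / b\<^sup>2) * (K * S)" using q(3) \<gamma> b by (intro mult_left_mono) auto
    finally show "energy \<gamma> ?r ?r' ?r ?r' \<le> (1 + \<gamma> / b\<^sup>2) * (K * S)" .
  qed (use energy_self_nonneg \<gamma> in auto)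
  finally have "S\<^sup>2 \<le> S * ((1 + \<gamma> / b\<^sup>2) * K * energy \<gamma> E E' E E')" by (simp only: mult_ac)
  then have "S \<le> (1 + \<gamma> / b\<^sup>2) * K * energy \<gamma> E E' E E'"
    using \<open>S \<ge> 0\<close>
  proof (rule le_if_square_le_mult)
    show "0 \<le> (1 + \<gamma> / b\<^sup>2) * K * energy \<gamma> E E' E E'"
      using \<open>K \<ge> 0\<close> energy_self_nonneg[of \<gamma> E E'] \<gamma> by simp
  qed
  moreover have "A * (9 * B / D) * e = 9 * A * B / D * e" for A B D e :: real by simp
  ultimately show ?thesis unfolding S_eq K_def by metis
qed

lemma weighted_bound:
  assumes N: "N \<ge> 1"
  defines "K \<equiv> 9 * (1 + \<gamma> / b\<^sup>2) * (1 + b\<^sup>2 / \<gamma>)\<^sup>2 / (2 * b * real N) * energy \<gamma> E E' E E'"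
  shows "integrable halfline (\<lambda>x. (E x)\<^sup>2 / x)" "(LINT x|halfline. (E x)\<^sup>2 / x) \<le> K"
proof -
  have [measurable]: "E \<in> borel_measurable halfline" using E_L2 unfolding L2w_0_iff by auto
  define g where "g n x = indicator {1 / real (Suc n)<..<real (Suc n)} x * ((E x)\<^sup>2 / x)" for n x
  have \<delta>: "0 < 1 / real (Suc n)" "1 / real (Suc n) \<le> real (Suc n)" for n
  proof -
    have "1 / real (Suc n) \<le> 1" by simp
    also have "1 \<le> real (Suc n)" by simp
    finally show "1 / real (Suc n) \<le> real (Suc n)" .
  qed simp
  have gi: "integrable halfline (g n)" for n
  proof (rule Bochner_Integration.integrable_bound)
    show "integrable halfline (\<lambda>x. real (Suc n) * (E x)\<^sup>2)" using E_L2 unfolding L2w_0_iff by simp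
    have "{1 / real (Suc n)<..<real (Suc n)} \<subseteq> {0<..}"
    proof
      fix x assume "x \<in> {1 / real (Suc n)<..<real (Suc n)}"
      then have "1 / real (Suc n) < x" unfolding greaterThanLessThan_iff by blast
      then show "x \<in> {0<..}" using less_trans[OF \<delta>(1)[of n]] unfolding greaterThan_iff by blast
    qed
    then have "indicator {1 / real (Suc n)<..<real (Suc n)} \<in> borel_measurable halfline"
      by (intro borel_measurable_indicator sets_halfline) simp_all
    then show "g n \<in> borel_measurable halfline" unfolding g_def by measurable
    show "AE x in halfline. norm (g n x) \<le> norm (real (Suc n) * (E x)\<^sup>2)"
    proof (rule AE_I2)
      fix x assume "x \<in> space halfline"
      then have x: "x > 0" by simp
      show "norm (g n x) \<le> norm (real (Suc n) * (E x)\<^sup>2)"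
      proof (cases "1 / real (Suc n) < x")
        case True
        then have "1 / x \<le> real (Suc n)" using x by (simp add: field_simps del: of_nat_Suc)
        then have "(1 / x) * (E x)\<^sup>2 \<le> real (Suc n) * (E x)\<^sup>2" by (intro mult_right_mono) auto
        then show ?thesis using x by (auto simp: g_def indicator_def)
      qed (simp add: g_def)
    qed
  qed
  have mono: "g n x \<le> g m x" if "n \<le> m" "x > 0" for n m x
  proof -
    have "1 / real (Suc m) \<le> 1 / real (Suc n)" using that(1) by (intro divide_left_mono) auto
    then have "{1 / real (Suc n)<..<real (Suc n)} \<subseteq> {1 / real (Suc m)<..<real (Suc m)}"
      using that(1) by auto
    then show ?thesis using that(2) unfolding g_def by (intro mult_right_mono) (auto simp: indicator_def)
  qed
  have lim: "(\<lambda>n. g n x) \<longlonglongrightarrow> (E x)\<^sup>2 / x" if x: "x > 0" for x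
  proof -
    have "eventually (\<lambda>n. 1 / real (Suc n) < x) sequentially"
      using LIMSEQ_inverse_real_of_nat x by (intro order_tendstoD(2)[of _ 0]) (simp_all add: inverse_eq_divide)
    moreover have "eventually (\<lambda>n. x \<le> real n) sequentially"
      using filterlim_real_sequentially unfolding filterlim_at_top by blast
    ultimately have "eventually (\<lambda>n. g n x = (E x)\<^sup>2 / x) sequentially"
      by eventually_elim (simp add: g_def)
    then show ?thesis by (rule tendsto_eventually)
  qed
  define s where "s n = (LINT x|halfline. g n x)" for n
  have s_le: "s n \<le> K" for n
    unfolding s_def g_def K_def by (rule dual_bound[OF N \<delta>])
  have "incseq s" unfolding s_def incseq_def
    by (intro allI impI integral_mono gi) (simp add: mono)
  then obtain l where l: "s \<longlonglongrightarrow> l" using incseq_convergent[of s K] s_le by blast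
  have 1: "AE x in halfline. mono (\<lambda>n. g n x)"
    by (intro AE_I2 monoI mono) auto
  have 2: "AE x in halfline. (\<lambda>n. g n x) \<longlonglongrightarrow> (E x)\<^sup>2 / x"
    by (intro AE_I2 lim) auto
  have 3: "(\<lambda>x. (E x)\<^sup>2 / x) \<in> borel_measurable halfline" by measurable
  have l': "(\<lambda>n. LINT x|halfline. g n x) \<longlonglongrightarrow> l" using l unfolding s_def .
  show "integrable halfline (\<lambda>x. (E x)\<^sup>2 / x)"
    by (rule integrable_monotone_convergence[OF gi 1 2 l' 3])
  have "(LINT x|halfline. (E x)\<^sup>2 / x) = l"
    by (rule integral_monotone_convergence[OF gi 1 2 l' 3])
  also have "l \<le> K" by (rule LIMSEQ_le_const2[OF l]) (use s_le in auto)
  finally show "(LINT x|halfline. (E x)\<^sup>2 / x) \<le> K" .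
qed

end

section \<open>Regular representatives\<close>

lemma AE_eq_continuous:
  fixes f g :: "real \<Rightarrow> real"
  assumes f: "continuous_on {0<..} f" and g: "continuous_on {0<..} g"
    and ae: "AE x in halfline. f x = g x" and x: "x > 0"
  shows "f x = g x"
proof -
  define S where "S = {0<..} \<inter> (\<lambda>x. f x - g x) -` (- {0})"
  have "open S" unfolding S_def
    by (rule continuous_open_preimage) (use f g in \<open>auto intro: continuous_on_diff\<close>)
  have "AE x in lebesgue. x > 0 \<longrightarrow> f x = g x" using ae by (simp add: AE_restrict_space_iff)
  then have "AE x in lebesgue. x \<notin> S" by eventually_elim (auto simp: S_def)
  moreover have "S \<in> sets lebesgue" using \<open>open S\<close> by (simp add: borel_open)
  ultimately have "S \<in> null_sets lebesgue" by (subst AE_iff_null_sets)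
  then have "S = {}" using \<open>open S\<close> open_not_negligible negligible_iff_null_sets by blast
  then show ?thesis using x by (auto simp: S_def)
qed

lemma primitive_AE_cong:
  assumes F: "primitive F f" and g: "g \<in> borel_measurable halfline" and ae: "AE x in halfline. f x = g x"
  shows "primitive F g"
  unfolding primitive_def
proof (intro allI impI)
  fix a b :: real assume ab: "0 < a" "a \<le> b"
  have sub: "{a..b} \<subseteq> {0<..}" using ab by auto
  have gm: "g \<in> borel_measurable (lebesgue_on {a..b})" by (rule measurable_restrict_mono[OF g sub])
  have "AE x in lebesgue. x > 0 \<longrightarrow> f x = g x" using ae by (simp add: AE_restrict_space_iff)
  then have "AE x in lebesgue. x \<in> {a..b} \<longrightarrow> f x = g x" by eventually_elim (use ab in auto)
  then have ae': "AE x in lebesgue_on {a..b}. f x = g x" by (simp add: AE_restrict_space_iff)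
  note f = primitiveD[OF F ab]
  have "integrable (lebesgue_on {a..b}) g" by (rule integrable_cong_AE_imp[OF f(1) gm]) (use ae' in auto)
  moreover have "(LINT x|lebesgue_on {a..b}. g x) = (LINT x|lebesgue_on {a..b}. f x)"
    by (rule integral_cong_AE[OF gm borel_measurable_integrable[OF f(1)]]) (use ae' in auto)
  ultimately show "integrable (lebesgue_on {a..b}) g \<and> (LINT x|lebesgue_on {a..b}. g x) = F b - F a"
    using f(2) by simp
qed

lemma inner_L2_cong_AE:
  assumes "u \<in> borel_measurable halfline" "v \<in> borel_measurable halfline" "w \<in> borel_measurable halfline"
    "AE x in halfline. u x = v x"
  shows "inner_L2 u w = inner_L2 v w"
proof -
  note [measurable] = assms(1-3)
  show ?thesis unfolding inner_L2_def
  proof (rule integral_cong_AE)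
    show "AE x in halfline. u x * w x = v x * w x" using assms(4) by eventually_elim simp
  qed measurable
qed

lemma has_weak_deriv_cong_AE:
  assumes "has_weak_deriv 1 v g" "locally_integrable u" "AE x in halfline. v x = u x"
  shows "has_weak_deriv 1 u g"
  unfolding has_weak_deriv_def
proof (intro conjI allI impI)
  show "locally_integrable g" using assms(1) unfolding has_weak_deriv_def by blast
  fix \<phi> assume \<phi>: "test_function \<phi>"
  have "continuous_on {0<..} (deriv \<phi>)"
    by (rule test_function_deriv(3)[OF test_function_deriv(1)[OF \<phi>]])
  then have "deriv \<phi> \<in> borel_measurable halfline" by (rule measurable_lebesgue_on_continuous) simp
  then have "inner_L2 v (deriv \<phi>) = inner_L2 u (deriv \<phi>)"
    using has_weak_deriv_measurable(1)[OF assms(1)] locally_integrable_measurable[OF assms(2)] assms(3)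
    by (intro inner_L2_cong_AE)
  then show "inner_L2 u ((deriv ^^ 1) \<phi>) = (- 1) ^ 1 * inner_L2 g \<phi>"
    using assms(1) \<phi> unfolding has_weak_deriv_def by simp
qed (rule assms(2))

lemma has_weak_deriv_diff:
  assumes "has_weak_deriv 1 u f" "has_weak_deriv 1 v g"
  shows "has_weak_deriv 1 (\<lambda>x. u x - v x) (\<lambda>x. f x - g x)"
proof -
  have l: "locally_integrable u" "locally_integrable f" "locally_integrable v" "locally_integrable g"
    using assms unfolding has_weak_deriv_def by auto
  show ?thesis unfolding has_weak_deriv_def
  proof (intro conjI allI impI locally_integrable_diff l)
    fix \<phi> assume \<phi>: "test_function \<phi>"
    note t = test_function_deriv(1)[OF \<phi>]
    have w: "inner_L2 u (deriv \<phi>) = - inner_L2 f \<phi>" "inner_L2 v (deriv \<phi>) = - inner_L2 g \<phi>"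
      using assms \<phi> unfolding has_weak_deriv_def by auto
    have d: "inner_L2 (\<lambda>x. h x - k x) \<psi> = inner_L2 h \<psi> - inner_L2 k \<psi>"
      if "locally_integrable h" "locally_integrable k" "test_function \<psi>" for h k \<psi>
      using integrable_times_test[OF that(1,3)] integrable_times_test[OF that(2,3)]
      by (simp add: inner_L2_def left_diff_distrib)
    show "inner_L2 (\<lambda>x. u x - v x) ((deriv ^^ 1) \<phi>) = (- 1) ^ 1 * inner_L2 (\<lambda>x. f x - g x) \<phi>"
      using d[OF l(1,3) t] d[OF l(2,4) \<phi>] w by simp
  qed
qed

text \<open>The representative \<open>V\<close> of \<open>u\<close> is prescribed, as it carries the boundary value.\<close>

lemma sobolev_primitives:
  assumes u: "u \<in> sobolev r \<alpha>" and r: "r \<ge> 1"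
    and V: "continuous_on {0<..} V" "AE x in halfline. V x = u x"
  shows "\<exists>a. a 0 = V \<and> (\<forall>k<r. primitive (a k) (a (Suc k))) \<and>
    (\<forall>k\<le>r. a k \<in> borel_measurable halfline \<and> (AE x in halfline. a k x = weak_deriv k u x))"
proof -
  have wd: "has_weak_deriv k u (weak_deriv k u)" if "k \<le> r" for k
    using u that weak_deriv_AE(1) unfolding sobolev_def by blast
  have "\<exists>P. primitive P (weak_deriv (Suc k) u) \<and> (AE x in halfline. P x = weak_deriv k u x)" if "k < r" for k
    by (rule has_weak_deriv_imp_primitive[OF has_weak_deriv_step[OF wd wd]]) (use that in auto)
  then obtain P where P: "\<And>k. k < r \<Longrightarrow> primitive (P k) (weak_deriv (Suc k) u)"
    "\<And>k. k < r \<Longrightarrow> AE x in halfline. P k x = weak_deriv k u x" by metis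
  define a where "a k = (if k = 0 then V else if k < r then P k else weak_deriv k u)" for k
  have ul: "locally_integrable u" using wd[of 0] unfolding has_weak_deriv_def by blast
  have w0: "AE x in halfline. weak_deriv 0 u x = u x" by (rule weak_deriv_AE(2)[OF has_weak_deriv_self[OF ul]])
  have a_AE: "AE x in halfline. a k x = weak_deriv k u x" if kr: "k \<le> r" for k
  proof -
    consider "k = 0" | "k \<noteq> 0" "k < r" | "k \<noteq> 0" "k = r" using kr unfolding le_less by blast
    then show ?thesis
    proof cases
      case 1
      then have "a k = V" by (simp add: a_def)
      have "AE x in halfline. V x = weak_deriv 0 u x" using V(2) w0 by eventually_elim simp
      then show ?thesis using 1 \<open>a k = V\<close> by simp
    next
      case 2
      then have "a k = P k" by (simp add: a_def)
      then show ?thesis using P(2)[OF 2(2)] by simp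
    next
      case 3 then show ?thesis by (simp add: a_def)
    qed
  qed
  have a_meas: "a k \<in> borel_measurable halfline" if kr: "k \<le> r" for k
  proof -
    consider "k = 0" | "k \<noteq> 0" "k < r" | "k \<noteq> 0" "k = r" using kr unfolding le_less by blast
    then show ?thesis
    proof cases
      case 1 then show ?thesis using measurable_lebesgue_on_continuous[OF V(1)] by (simp add: a_def)
    next
      case 2 then show ?thesis using primitive_measurable[OF P(1)] by (simp add: a_def)
    next
      case 3 then show ?thesis using has_weak_deriv_measurable(2)[OF wd] by (simp add: a_def)
    qed
  qed
  have "primitive (a k) (a (Suc k))" if k: "k < r" for k
  proof -
    have ae: "AE x in halfline. weak_deriv (Suc k) u x = a (Suc k) x"
      using a_AE[OF Suc_leI[OF k]] by eventually_elim simp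
    have P': "primitive (P k) (a (Suc k))"
      by (rule primitive_AE_cong[OF P(1)[OF k] a_meas ae]) (use k in simp)
    have eq: "P k x = a k x" if "x > 0" for x
    proof (cases "k = 0")
      case True
      have ae0: "AE x in halfline. P 0 x = V x"
        using P(2)[OF k] V(2) w0 unfolding True by eventually_elim simp
      have "0 < r" using k True by simp
      have "P 0 x = V x"
        by (rule AE_eq_continuous[OF primitive_continuous[OF P(1)[OF \<open>0 < r\<close>]] V(1) ae0 that])
      then show ?thesis by (simp add: True a_def)
    qed (use k in \<open>simp add: a_def\<close>)
    show ?thesis by (rule primitive_cong[OF P']) (use eq in auto)
  qed
  then show ?thesis using a_AE a_meas by (intro exI[of _ a]) (simp add: a_def)
qed

text \<open>Near \<open>0\<close> the Cauchy-Schwarz inequality bounds \<open>(f 1 - f x)\<^sup>2\<close> by a multiple of \<open>(1/x)\<^sup>j\<close>, so that \<open>(f x)\<^sup>2 x\<^sup>j\<close> is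
  bounded there; at infinity \<open>x\<^sup>m\<close> is the stronger weight.\<close>

lemma weight_transfer:
  assumes f: "primitive f f'" and f'm: "f' \<in> borel_measurable halfline" and j: "1 \<le> j" "j \<le> m"
    and i': "integrable halfline (\<lambda>x. (f' x)\<^sup>2 * x ^ Suc j)" and i: "integrable halfline (\<lambda>x. (f x)\<^sup>2 * x ^ m)"
  shows "integrable halfline (\<lambda>x. (f x)\<^sup>2 * x ^ j)"
proof -
  define K where "K = (LINT x|halfline. (f' x)\<^sup>2 * x ^ Suc j)"
  have K: "K \<ge> 0" unfolding K_def by (intro integral_nonneg_AE AE_I2) simp
  have near: "(f 1 - f x)\<^sup>2 \<le> K * (1 / x) ^ j" if x: "0 < x" "x \<le> 1" for x
  proof -
    let ?M = "lebesgue_on {x..1}"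
    have sub: "{x..1} \<subseteq> {0<..}" using x by auto
    have [measurable]: "f' \<in> borel_measurable ?M" by (rule measurable_restrict_mono[OF f'm sub])
    define s where "s t = sqrt (t ^ Suc j)" for t :: real
    have sc: "continuous_on {x..1} s" "continuous_on {x..1} (\<lambda>t. 1 / s t)"
      unfolding s_def using x by (auto intro!: continuous_intros)
    then have [measurable]: "s \<in> borel_measurable ?M" "(\<lambda>t. 1 / s t) \<in> borel_measurable ?M"
      by (auto intro!: measurable_lebesgue_on_continuous)
    have s: "s t > 0" "(s t)\<^sup>2 = t ^ Suc j" "(1 / s t)\<^sup>2 = (1 / t) ^ Suc j" if "t \<in> {x..1}" for t
      using that x by (simp_all add: s_def power_divide)
    have u: "integrable ?M (\<lambda>t. (f' t)\<^sup>2 * t ^ Suc j)" by (rule integrable_halfline_Icc[OF i' x(1)])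
    have "integrable ?M (\<lambda>t. (f' t * s t)\<^sup>2) = integrable ?M (\<lambda>t. (f' t)\<^sup>2 * t ^ Suc j)"
      by (intro Bochner_Integration.integrable_cong refl) (simp add: power_mult_distrib s del: power_Suc)
    then have u': "integrable ?M (\<lambda>t. (f' t * s t)\<^sup>2)" using u by simp
    have v': "integrable ?M (\<lambda>t. (1 / s t)\<^sup>2)"
      by (intro continuous_imp_integrable_real continuous_on_power sc(2))
    have P: "primitive (\<lambda>t. - (1 / real j) * (1 / t) ^ j) (\<lambda>t. (1 / t) ^ Suc j)"
    proof (rule primitive_C1)
      show "continuous_on {0<..} (\<lambda>t::real. (1 / t) ^ Suc j)" by (intro continuous_intros) auto
      fix t :: real assume "t > 0"
      obtain k where k: "j = Suc k" using j(1) by (cases j) auto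
      have "((\<lambda>t. 1 / t) has_real_derivative - ((1 / t) * (1 / t))) (at t)"
        using \<open>t > 0\<close> by (auto intro!: derivative_eq_intros simp: power2_eq_square)
      from DERIV_cmult[OF DERIV_power[OF this, of j], of "- (1 / real j)"]
      show "((\<lambda>t. - (1 / real j) * (1 / t) ^ j) has_real_derivative (1 / t) ^ Suc j) (at t)"
        by (rule DERIV_cong) (simp add: k del: of_nat_Suc)
    qed
    have "(LINT t|?M. (1 / s t)\<^sup>2) = (LINT t|?M. (1 / t) ^ Suc j)"
      by (intro Bochner_Integration.integral_cong refl) (simp add: s del: power_Suc)
    also have "\<dots> = (1 / real j) * (1 / x) ^ j - 1 / real j" using primitiveD(2)[OF P x] by simp
    also have "\<dots> \<le> 1 * (1 / x) ^ j"
    proof -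
      have "(1 / real j) * (1 / x) ^ j \<le> 1 * (1 / x) ^ j" using j(1) x by (intro mult_right_mono) auto
      then show ?thesis using j(1) by (smt (verit) divide_nonneg_nonneg of_nat_0_le_iff)
    qed
    finally have v_le: "(LINT t|?M. (1 / s t)\<^sup>2) \<le> (1 / x) ^ j" by simp
    have "(LINT t|?M. (f' t * s t)\<^sup>2) = (LINT t|?M. (f' t)\<^sup>2 * t ^ Suc j)"
      by (intro Bochner_Integration.integral_cong refl) (simp add: power_mult_distrib s del: power_Suc)
    also have "\<dots> = (LINT t|halfline. indicator {x..1} t * ((f' t)\<^sup>2 * t ^ Suc j))"
      by (rule lebesgue_on_Icc_halfline(2)[OF x(1)])
    also have "\<dots> \<le> K" unfolding K_def
    proof (rule integral_mono[OF _ i'])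
      show "integrable halfline (\<lambda>t. indicator {x..1} t * ((f' t)\<^sup>2 * t ^ Suc j))"
        by (rule lebesgue_on_Icc_halfline(1)[OF x(1), THEN iffD1, OF u])
      show "indicator {x..1} t * ((f' t)\<^sup>2 * t ^ Suc j) \<le> (f' t)\<^sup>2 * t ^ Suc j" if "t \<in> space halfline" for t
        using that by (auto simp: indicator_def)
    qed
    finally have u_le: "(LINT t|?M. (f' t * s t)\<^sup>2) \<le> K" .
    have "f 1 - f x = (LINT t|?M. f' t)" using primitiveD(2)[OF f x] by simp
    also have "\<dots> = (LINT t|?M. (f' t * s t) * (1 / s t))"
    proof (intro Bochner_Integration.integral_cong refl)
      fix t assume "t \<in> space ?M"
      then have "s t \<noteq> 0" using s(1)[of t] by simp
      then show "f' t = (f' t * s t) * (1 / s t)" by simp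
    qed
    finally have "(f 1 - f x)\<^sup>2 = (LINT t|?M. (f' t * s t) * (1 / s t))\<^sup>2" by simp
    also have "\<dots> \<le> (LINT t|?M. (f' t * s t)\<^sup>2) * (LINT t|?M. (1 / s t)\<^sup>2)"
      by (rule Cauchy_Schwarz_integral[OF _ _ u' v']) measurable
    also have "\<dots> \<le> K * (1 / x) ^ j"
      using u_le v_le K by (intro mult_mono) auto
    finally show ?thesis .
  qed
  define C where "C = 2 * (f 1)\<^sup>2 + 2 * K"
  have C: "C \<ge> 0" using K by (simp add: C_def)
  note [measurable] = primitive_measurable[OF f]
  show ?thesis
  proof (rule Bochner_Integration.integrable_bound)
    show "integrable halfline (\<lambda>x. C * exp 1 * exp (- 1 * x) + (f x)\<^sup>2 * x ^ m)"
      using i integrable_exp_halfline[of 1] by simp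
    show "AE x in halfline. norm ((f x)\<^sup>2 * x ^ j) \<le> norm (C * exp 1 * exp (- 1 * x) + (f x)\<^sup>2 * x ^ m)"
    proof (rule AE_I2)
      fix x assume "x \<in> space halfline"
      then have x: "x > 0" by simp
      have nn: "0 \<le> C * exp 1 * exp (- 1 * x)" "0 \<le> (f x)\<^sup>2 * x ^ m" using C x by auto
      have "(f x)\<^sup>2 * x ^ j \<le> C * exp 1 * exp (- 1 * x) + (f x)\<^sup>2 * x ^ m"
      proof (cases "x \<le> 1")
        case True
        have "0 \<le> (f 1 + (f 1 - f x))\<^sup>2" by simp
        then have "(f x)\<^sup>2 \<le> 2 * (f 1)\<^sup>2 + 2 * (f 1 - f x)\<^sup>2"
          by (simp add: power2_eq_square algebra_simps)
        also have "\<dots> \<le> 2 * (f 1)\<^sup>2 + 2 * (K * (1 / x) ^ j)" using near[OF x True] by simp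
        finally have "(f x)\<^sup>2 * x ^ j \<le> (2 * (f 1)\<^sup>2 + 2 * (K * (1 / x) ^ j)) * x ^ j"
          using x by (intro mult_right_mono) auto
        also have "\<dots> = 2 * (f 1)\<^sup>2 * x ^ j + 2 * K * ((1 / x) ^ j * x ^ j)" by (simp add: algebra_simps)
        also have "(1 / x) ^ j * x ^ j = 1" using x by (simp add: power_divide)
        also have "2 * (f 1)\<^sup>2 * x ^ j + 2 * K * 1 \<le> 2 * (f 1)\<^sup>2 * 1 + 2 * K * 1"
          using x True by (intro add_right_mono mult_left_mono power_le_one) auto
        finally have "(f x)\<^sup>2 * x ^ j \<le> C" by (simp add: C_def)
        moreover have "C * 1 \<le> C * (exp 1 * exp (- 1 * x))"
          using C True by (intro mult_left_mono) (simp_all flip: exp_add)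
        ultimately show ?thesis using nn by simp
      next
        case False
        then have "x ^ j \<le> x ^ m" using j(2) by (intro power_increasing) auto
        then have "(f x)\<^sup>2 * x ^ j \<le> (f x)\<^sup>2 * x ^ m" by (intro mult_left_mono) auto
        then show ?thesis using nn by linarith
      qed
      moreover have "0 \<le> (f x)\<^sup>2 * x ^ j" using x by simp
      ultimately show "norm ((f x)\<^sup>2 * x ^ j) \<le> norm (C * exp 1 * exp (- 1 * x) + (f x)\<^sup>2 * x ^ m)"
        using nn by (simp only: real_norm_def abs_of_nonneg add_nonneg_nonneg)
    qed
  qed measurable
qed

section \<open>Powers of the twisted derivative\<close>

text \<open>If \<open>a (Suc \<nu>)\<close> is the derivative of \<open>a \<nu>\<close>, this is \<open>D\<^sup>n (a 0)\<close> for \<open>D v = v' + b v\<close>.\<close>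

definition twist :: "real \<Rightarrow> nat \<Rightarrow> (nat \<Rightarrow> real \<Rightarrow> real) \<Rightarrow> real \<Rightarrow> real" where
  "twist b n a x = (\<Sum>\<nu>\<le>n. real (n choose \<nu>) * b ^ (n - \<nu>) * a \<nu> x)"

lemma twist_Suc: "twist b (Suc n) a x = twist b n (\<lambda>\<nu>. a (Suc \<nu>)) x + b * twist b n a x"
proof -
  have "b * twist b n a x = (\<Sum>\<nu>\<le>n. real (n choose \<nu>) * b ^ (Suc n - \<nu>) * a \<nu> x)"
    unfolding twist_def sum_distrib_left by (intro sum.cong refl) (simp add: Suc_diff_le)
  also have "\<dots> = (\<Sum>\<nu>\<le>Suc n. real (n choose \<nu>) * b ^ (Suc n - \<nu>) * a \<nu> x)" by simp
  also have "\<dots> = b ^ Suc n * a 0 x + (\<Sum>\<nu>\<le>n. real (n choose Suc \<nu>) * b ^ (n - \<nu>) * a (Suc \<nu>) x)"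
    by (subst sum.atMost_Suc_shift) simp
  finally have 1: "b * twist b n a x = b ^ Suc n * a 0 x + (\<Sum>\<nu>\<le>n. real (n choose Suc \<nu>) * b ^ (n - \<nu>) * a (Suc \<nu>) x)" .
  have "twist b (Suc n) a x = b ^ Suc n * a 0 x + (\<Sum>\<nu>\<le>n. real (Suc n choose Suc \<nu>) * b ^ (n - \<nu>) * a (Suc \<nu>) x)"
    unfolding twist_def by (subst sum.atMost_Suc_shift) simp
  also have "(\<Sum>\<nu>\<le>n. real (Suc n choose Suc \<nu>) * b ^ (n - \<nu>) * a (Suc \<nu>) x)
      = twist b n (\<lambda>\<nu>. a (Suc \<nu>)) x + (\<Sum>\<nu>\<le>n. real (n choose Suc \<nu>) * b ^ (n - \<nu>) * a (Suc \<nu>) x)"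
    unfolding twist_def sum.distrib[symmetric] by (intro sum.cong refl) (simp add: algebra_simps)
  finally show ?thesis using 1 by simp
qed

lemma primitive_sum:
  assumes "finite S" "\<And>i. i \<in> S \<Longrightarrow> primitive (F i) (f i)"
  shows "primitive (\<lambda>x. \<Sum>i\<in>S. F i x) (\<lambda>x. \<Sum>i\<in>S. f i x)"
  using assms
proof (induction S rule: finite_induct)
  case empty
  show ?case using primitive_const[of 0] by simp
qed (simp add: primitive_add)

lemma twist_primitive:
  assumes "\<And>k. k \<le> n \<Longrightarrow> primitive (a k) (a (Suc k))"
  shows "primitive (twist b n a) (\<lambda>x. twist b (Suc n) a x - b * twist b n a x)"
proof -
  have "primitive (\<lambda>x. \<Sum>\<nu>\<le>n. (real (n choose \<nu>) * b ^ (n - \<nu>)) * a \<nu> x)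
      (\<lambda>x. \<Sum>\<nu>\<le>n. (real (n choose \<nu>) * b ^ (n - \<nu>)) * a (Suc \<nu>) x)"
    by (intro primitive_sum primitive_cmult assms) auto
  then show ?thesis
    by (rule primitive_cong) (simp_all add: twist_Suc, simp_all add: twist_def)
qed

lemma twist_measurable:
  assumes "\<And>k. k \<le> n \<Longrightarrow> a k \<in> borel_measurable halfline"
  shows "twist b n a \<in> borel_measurable halfline"
  unfolding twist_def[abs_def] using assms by (intro borel_measurable_sum borel_measurable_times) auto

lemma twist_integrable:
  assumes m: "\<And>k. k \<le> n \<Longrightarrow> a k \<in> borel_measurable halfline"
    and i: "\<And>k. k \<le> n \<Longrightarrow> integrable halfline (\<lambda>x. (a k x)\<^sup>2 * x ^ j)"
  shows "integrable halfline (\<lambda>x. (twist b n a x)\<^sup>2 * x ^ j)"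
proof -
  define c where "c \<nu> = real (n choose \<nu>) * b ^ (n - \<nu>)" for \<nu>
  define C where "C = (\<Sum>\<nu>\<le>n. (c \<nu>)\<^sup>2)"
  have tm [measurable]: "twist b n a \<in> borel_measurable halfline" by (rule twist_measurable[OF m])
  show ?thesis
  proof (rule Bochner_Integration.integrable_bound)
    show "integrable halfline (\<lambda>x. C * (\<Sum>\<nu>\<le>n. (a \<nu> x)\<^sup>2 * x ^ j))"
      by (intro integrable_mult_right Bochner_Integration.integrable_sum i) simp
    show "(\<lambda>x. (twist b n a x)\<^sup>2 * x ^ j) \<in> borel_measurable halfline" by measurable
    show "AE x in halfline. norm ((twist b n a x)\<^sup>2 * x ^ j) \<le> norm (C * (\<Sum>\<nu>\<le>n. (a \<nu> x)\<^sup>2 * x ^ j))"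
    proof (rule AE_I2)
      fix x assume "x \<in> space halfline"
      then have x: "x > 0" by simp
      have "(twist b n a x)\<^sup>2 \<le> C * (\<Sum>\<nu>\<le>n. (a \<nu> x)\<^sup>2)"
        unfolding twist_def C_def c_def by (rule Cauchy_Schwarz_ineq_sum)
      then have "(twist b n a x)\<^sup>2 * x ^ j \<le> C * (\<Sum>\<nu>\<le>n. (a \<nu> x)\<^sup>2) * x ^ j" using x by (intro mult_right_mono) auto
      also have "\<dots> = C * (\<Sum>\<nu>\<le>n. (a \<nu> x)\<^sup>2 * x ^ j)" by (simp add: sum_distrib_right)
      finally have "(twist b n a x)\<^sup>2 * x ^ j \<le> C * (\<Sum>\<nu>\<le>n. (a \<nu> x)\<^sup>2 * x ^ j)" .
      moreover have "0 \<le> (twist b n a x)\<^sup>2 * x ^ j" using x by simp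
      ultimately show "norm ((twist b n a x)\<^sup>2 * x ^ j) \<le> norm (C * (\<Sum>\<nu>\<le>n. (a \<nu> x)\<^sup>2 * x ^ j))"
        unfolding real_norm_def by linarith
    qed
  qed
qed

text \<open>The Cauchy-Schwarz inequality with the binomial coefficients as weights; their sum is \<open>2\<^sup>n\<close>.\<close>

lemma twist_square_le:
  assumes "b \<ge> 0"
  shows "(twist b n a x)\<^sup>2 \<le> 2 ^ n * (\<Sum>\<nu>\<le>n. real (n choose \<nu>) * b ^ (2 * n - 2 * \<nu>) * (a \<nu> x)\<^sup>2)"
proof -
  have "twist b n a x = (\<Sum>\<nu>\<le>n. sqrt (real (n choose \<nu>)) * (sqrt (real (n choose \<nu>)) * b ^ (n - \<nu>) * a \<nu> x))"
    unfolding twist_def by (intro sum.cong refl) (simp flip: mult.assoc)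
  then have "(twist b n a x)\<^sup>2 \<le> (\<Sum>\<nu>\<le>n. (sqrt (real (n choose \<nu>)))\<^sup>2) * (\<Sum>\<nu>\<le>n. (sqrt (real (n choose \<nu>)) * b ^ (n - \<nu>) * a \<nu> x)\<^sup>2)"
    by (simp only: Cauchy_Schwarz_ineq_sum)
  also have "(\<Sum>\<nu>\<le>n. (sqrt (real (n choose \<nu>)))\<^sup>2) = 2 ^ n"
    using arg_cong[OF choose_row_sum[of n], of real] by simp
  also have "(\<Sum>\<nu>\<le>n. (sqrt (real (n choose \<nu>)) * b ^ (n - \<nu>) * a \<nu> x)\<^sup>2)
      = (\<Sum>\<nu>\<le>n. real (n choose \<nu>) * b ^ (2 * n - 2 * \<nu>) * (a \<nu> x)\<^sup>2)"
  proof (intro sum.cong refl)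
    fix \<nu>
    have "(b ^ (n - \<nu>))\<^sup>2 = b ^ (2 * n - 2 * \<nu>)"
      by (simp add: mult.commute diff_mult_distrib flip: power_mult)
    then show "(sqrt (real (n choose \<nu>)) * b ^ (n - \<nu>) * a \<nu> x)\<^sup>2 = real (n choose \<nu>) * b ^ (2 * n - 2 * \<nu>) * (a \<nu> x)\<^sup>2"
      by (simp add: power_mult_distrib)
  qed
  finally show ?thesis .
qed

section \<open>The error of the spectral scheme\<close>

text \<open>The space in the theorem has the same weight \<open>x\<^bsup>r-1\<^esup>\<close> for all derivatives, whereas the Laguerre expansion
  needs \<open>x\<^sup>j\<close> for the lower ones, which is larger near \<open>0\<close>; these bounds follow downwards from \<open>j = r - 1\<close>.\<close>

lemma chain_square_integrable:
  assumes prim: "\<And>k. k < r \<Longrightarrow> primitive (a k) (a (Suc k))"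
    and meas: "\<And>k. k \<le> r \<Longrightarrow> a k \<in> borel_measurable halfline"
    and top: "\<And>k. k \<le> r \<Longrightarrow> integrable halfline (\<lambda>x. (a k x)\<^sup>2 * x ^ (r - 1))"
    and j: "1 \<le> j" "j \<le> r - 1" and k: "k \<le> Suc j"
  shows "integrable halfline (\<lambda>x. (a k x)\<^sup>2 * x ^ j)"
proof -
  have "\<forall>k\<le>Suc j. integrable halfline (\<lambda>x. (a k x)\<^sup>2 * x ^ j)"
    using j(2)
  proof (induction j rule: inc_induct)
    case base
    then show ?case using top j by auto
  next
    case (step n)
    show ?case
    proof (intro allI impI)
      fix k assume k: "k \<le> Suc n"
      have kr: "k < r" using k step.hyps by linarith
      show "integrable halfline (\<lambda>x. (a k x)\<^sup>2 * x ^ n)"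
      proof (rule weight_transfer[OF prim[OF kr]])
        show "a (Suc k) \<in> borel_measurable halfline" using meas kr by simp
        show "1 \<le> n" "n \<le> r - 1" using step.hyps j by auto
        show "integrable halfline (\<lambda>x. (a (Suc k) x)\<^sup>2 * x ^ Suc n)" using step.IH k by blast
        show "integrable halfline (\<lambda>x. (a k x)\<^sup>2 * x ^ (r - 1))" using top kr by simp
      qed
    qed
  qed
  then show ?thesis using k by blast
qed

lemma powr_minus_one_weight:
  assumes "r \<ge> 1" "x > 0"
  shows "x powr (real r - 1) = x ^ (r - 1)"
proof -
  have eq: "real r - 1 = real (r - 1)" using assms(1) by (simp add: of_nat_diff)
  show ?thesis unfolding eq using assms(2) by (rule powr_realpow)
qed

lemma normw_representative:
  assumes r: "r \<ge> 1" and m: "g \<in> borel_measurable halfline" "w \<in> borel_measurable halfline"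
    and ae: "AE x in halfline. g x = w x"
  shows "(normw (real r - 1) w)\<^sup>2 = (LINT x|halfline. (g x)\<^sup>2 * x ^ (r - 1))"
    and "w \<in> L2w (real r - 1) \<Longrightarrow> integrable halfline (\<lambda>x. (g x)\<^sup>2 * x ^ (r - 1))"
proof -
  note [measurable] = m
  have ae': "AE x in halfline. (w x)\<^sup>2 * x powr (real r - 1) = (g x)\<^sup>2 * x ^ (r - 1)"
  proof -
    have "AE x in halfline. x > 0" by (intro AE_I2) simp
    with ae show ?thesis by eventually_elim (simp add: powr_minus_one_weight[OF r])
  qed
  have gm: "(\<lambda>x. (g x)\<^sup>2 * x ^ (r - 1)) \<in> borel_measurable halfline" by measurable
  have wm: "(\<lambda>x. (w x)\<^sup>2 * x powr (real r - 1)) \<in> borel_measurable halfline" by measurable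
  show "(normw (real r - 1) w)\<^sup>2 = (LINT x|halfline. (g x)\<^sup>2 * x ^ (r - 1))"
    unfolding normw_square by (rule integral_cong_AE[OF wm gm ae'])
  show "integrable halfline (\<lambda>x. (g x)\<^sup>2 * x ^ (r - 1))" if "w \<in> L2w (real r - 1)"
  proof -
    have "integrable halfline (\<lambda>x. (w x)\<^sup>2 * x powr (real r - 1))" using that unfolding L2w_def by blast
    then show ?thesis by (rule integrable_cong_AE_imp[OF _ gm ae'])
  qed
qed

text \<open>For \<open>N \<ge> 2 r\<close> each of the \<open>r - 1\<close> factors \<open>2 b (N - i)\<close> gained by the Laguerre expansion is at least \<open>b N\<close>.
  This costs \<open>2\<^bsup>r-1\<^esup>\<close>, and the binomial formula another \<open>2\<^sup>r\<close>.\<close>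

lemma weighted_energy_approximation:
  fixes a :: "nat \<Rightarrow> real \<Rightarrow> real"
  assumes b: "b > 0" and r: "r \<ge> 1"
    and prim: "\<And>k. k < r \<Longrightarrow> primitive (a k) (a (Suc k))"
    and meas: "\<And>k. k \<le> r \<Longrightarrow> a k \<in> borel_measurable halfline"
    and top: "\<And>k. k \<le> r \<Longrightarrow> integrable halfline (\<lambda>x. (a k x)\<^sup>2 * x ^ (r - 1))"
    and L2: "integrable halfline (\<lambda>x. (a 0 x)\<^sup>2)" "integrable halfline (\<lambda>x. (a 1 x)\<^sup>2)"
    and trace: "(a 0 \<longlongrightarrow> \<eta>) (at_right 0)" and N: "2 * r \<le> N"
  shows "\<exists>q. degree q \<le> N \<and> poly q 0 = \<eta> \<and>
    (LINT x|halfline. (a 1 x - expoly' b q x)\<^sup>2) + b\<^sup>2 * (LINT x|halfline. (a 0 x - expoly b q x)\<^sup>2)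
      \<le> 4 ^ r * (\<Sum>\<nu>\<le>r. real (r choose \<nu>) * b ^ (2 * r - 2 * \<nu>) * (LINT x|halfline. (a \<nu> x)\<^sup>2 * x ^ (r - 1)))
        / (2 * b * real N) ^ (r - 1)"
proof -
  obtain n where n: "N = n + 1" using N r by (cases N) auto
  define m where "m = r - 1"
  have m: "r = Suc m" using r by (simp add: m_def)
  define G where "G j = twist b (Suc j) a" for j
  have Gm: "G j \<in> borel_measurable halfline" if "j \<le> m" for j
    unfolding G_def using that m by (intro twist_measurable meas) auto
  have Gp: "primitive (G j) (\<lambda>x. G (Suc j) x - b * G j x)" if "j < m" for j
    unfolding G_def using that m by (intro twist_primitive prim) auto
  have G0: "G 0 = (\<lambda>x. a 1 x + b * a 0 x)"
    by (simp add: G_def fun_eq_iff twist_def)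
  have Gi: "integrable halfline (\<lambda>x. (G j x)\<^sup>2 * x ^ j)" if "j \<le> m" for j
  proof (cases "j = 0")
    case True
    have "integrable halfline (\<lambda>x. (a 1 x + b * a 0 x)\<^sup>2)"
    proof (rule integrable_square_add)
      show "(\<lambda>x. b * a 0 x) \<in> borel_measurable halfline" using meas[of 0] by measurable
      show "integrable halfline (\<lambda>x. (b * a 0 x)\<^sup>2)" using L2(1) by (simp add: power_mult_distrib)
    qed (use meas r L2 in auto)
    then show ?thesis using True by (simp add: G0)
  next
    case False
    show ?thesis unfolding G_def
    proof (rule twist_integrable)
      fix k assume k: "k \<le> Suc j"
      then show "a k \<in> borel_measurable halfline" using that m by (intro meas) simp
      show "integrable halfline (\<lambda>x. (a k x)\<^sup>2 * x ^ j)"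
        by (rule chain_square_integrable[where a = a and r = r, OF prim meas top]) (use k that m False in auto)
    qed
  qed
  have a01: "primitive (a 0) (a 1)" "a 1 \<in> borel_measurable halfline" using prim[of 0] meas[of 1] r by auto
  have mn: "m \<le> n + 1" using N m n by simp
  obtain q where q: "degree q \<le> N" "poly q 0 = \<eta>"
    "(LINT x|halfline. (a 1 x - expoly' b q x)\<^sup>2) + b\<^sup>2 * (LINT x|halfline. (a 0 x - expoly b q x)\<^sup>2)
      \<le> (LINT x|halfline. (G m x)\<^sup>2 * x ^ m) / (\<Prod>i<m. (2 * b) * (real N - real i))"
    using energy_approximation[where G = G and m = m and N = n, OF b a01 trace L2 Gm Gp Gi G0 mn]
    unfolding expoly'_def n[symmetric] by blast
  define J where "J \<nu> = (LINT x|halfline. (a \<nu> x)\<^sup>2 * x ^ m)" for \<nu>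
  define Q where "Q = (\<Sum>\<nu>\<le>r. real (r choose \<nu>) * b ^ (2 * r - 2 * \<nu>) * J \<nu>)"
  have J: "J \<nu> \<ge> 0" for \<nu> unfolding J_def by (intro integral_nonneg_AE AE_I2) simp
  then have "Q \<ge> 0" unfolding Q_def using b by (intro sum_nonneg mult_nonneg_nonneg) auto
  have top': "integrable halfline (\<lambda>x. (a k x)\<^sup>2 * x ^ m)" if "k \<le> r" for k using top[OF that] by (simp add: m_def)
  have "(LINT x|halfline. (G m x)\<^sup>2 * x ^ m)
      \<le> (LINT x|halfline. 2 ^ r * (\<Sum>\<nu>\<le>r. real (r choose \<nu>) * b ^ (2 * r - 2 * \<nu>) * ((a \<nu> x)\<^sup>2 * x ^ m)))"
  proof (rule integral_mono)
    show "integrable halfline (\<lambda>x. (G m x)\<^sup>2 * x ^ m)" by (rule Gi) simp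
    show "integrable halfline (\<lambda>x. 2 ^ r * (\<Sum>\<nu>\<le>r. real (r choose \<nu>) * b ^ (2 * r - 2 * \<nu>) * ((a \<nu> x)\<^sup>2 * x ^ m)))"
      by (intro integrable_mult_right Bochner_Integration.integrable_sum top') simp
    fix x assume "x \<in> space halfline"
    then have "(G m x)\<^sup>2 * x ^ m \<le> (2 ^ r * (\<Sum>\<nu>\<le>r. real (r choose \<nu>) * b ^ (2 * r - 2 * \<nu>) * (a \<nu> x)\<^sup>2)) * x ^ m"
      unfolding G_def m[symmetric] using b by (intro mult_right_mono twist_square_le) auto
    also have "\<dots> = 2 ^ r * (\<Sum>\<nu>\<le>r. real (r choose \<nu>) * b ^ (2 * r - 2 * \<nu>) * ((a \<nu> x)\<^sup>2 * x ^ m))"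
      by (simp only: sum_distrib_right mult.assoc)
    finally show "(G m x)\<^sup>2 * x ^ m \<le> 2 ^ r * (\<Sum>\<nu>\<le>r. real (r choose \<nu>) * b ^ (2 * r - 2 * \<nu>) * ((a \<nu> x)\<^sup>2 * x ^ m))" .
  qed
  also have "\<dots> = 2 ^ r * Q"
  proof -
    have "(LINT x|halfline. (\<Sum>\<nu>\<le>r. real (r choose \<nu>) * b ^ (2 * r - 2 * \<nu>) * ((a \<nu> x)\<^sup>2 * x ^ m)))
        = (\<Sum>\<nu>\<le>r. LINT x|halfline. real (r choose \<nu>) * b ^ (2 * r - 2 * \<nu>) * ((a \<nu> x)\<^sup>2 * x ^ m))"
      by (intro Bochner_Integration.integral_sum integrable_mult_right top') simp
    then show ?thesis unfolding Q_def J_def by simp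
  qed
  finally have num: "(LINT x|halfline. (G m x)\<^sup>2 * x ^ m) \<le> 2 ^ r * Q" .
  have Npos: "real N > 0" using N r by simp
  have den: "(b * real N) ^ m \<le> (\<Prod>i<m. (2 * b) * (real N - real i))"
  proof -
    have "(\<Prod>i<m. b * real N) \<le> (\<Prod>i<m. (2 * b) * (real N - real i))"
    proof (rule prod_mono)
      fix i assume "i \<in> {..<m}"
      then have "2 * i \<le> N" using N m by simp
      then have "real N \<le> 2 * (real N - real i)" by simp
      then have "b * real N \<le> b * (2 * (real N - real i))" using b by (intro mult_left_mono) auto
      then show "0 \<le> b * real N \<and> b * real N \<le> (2 * b) * (real N - real i)" using b Npos by simp
    qed
    then show ?thesis by simp
  qed
  have "(LINT x|halfline. (G m x)\<^sup>2 * x ^ m) / (\<Prod>i<m. (2 * b) * (real N - real i)) \<le> (2 ^ r * Q) / (b * real N) ^ m"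
    using num den b Npos \<open>Q \<ge> 0\<close> by (intro frac_le) auto
  also have "\<dots> = 2 ^ r * 2 ^ m * Q / (2 * b * real N) ^ m"
    using b Npos by (simp add: power_mult_distrib field_simps)
  also have "\<dots> \<le> 4 ^ r * Q / (2 * b * real N) ^ m"
  proof (intro divide_right_mono mult_right_mono)
    have "(2::real) ^ r * 2 ^ m \<le> 2 ^ r * 2 ^ r" using m by (intro mult_left_mono power_increasing) auto
    then show "(2::real) ^ r * 2 ^ m \<le> 4 ^ r" by (simp flip: power_mult_distrib)
  qed (use b Npos \<open>Q \<ge> 0\<close> in auto)
  finally have bound: "(LINT x|halfline. (G m x)\<^sup>2 * x ^ m) / (\<Prod>i<m. (2 * b) * (real N - real i))
      \<le> 4 ^ r * Q / (2 * b * real N) ^ m" .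
  from q(1,2) order_trans[OF q(3) bound] show ?thesis unfolding Q_def J_def m_def by blast
qed

lemma norm_r_square:
  assumes r: "r \<ge> 1"
    and meas: "\<And>k. k \<le> r \<Longrightarrow> a k \<in> borel_measurable halfline" "\<And>k. k \<le> r \<Longrightarrow> weak_deriv k u \<in> borel_measurable halfline"
    and ae: "\<And>k. k \<le> r \<Longrightarrow> AE x in halfline. a k x = weak_deriv k u x"
    and \<beta>: "\<beta> > 0"
  shows "(norm_r r \<beta> u)\<^sup>2 = (\<Sum>\<nu>\<le>r. real (r choose \<nu>) * (\<beta> / 2) ^ (2 * r - 2 * \<nu>) * (LINT x|halfline. (a \<nu> x)\<^sup>2 * x ^ (r - 1)))"
proof -
  have "(norm_r r \<beta> u)\<^sup>2 = (\<Sum>\<nu>\<le>r. real (r choose \<nu>) *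
      (\<beta> ^ (2 * r - 2 * \<nu>) / 2 ^ (2 * r - 2 * \<nu>)) * (normw (real r - 1) (weak_deriv \<nu> u))\<^sup>2)"
    unfolding norm_r_def using \<beta> by (intro real_sqrt_pow2 sum_nonneg mult_nonneg_nonneg) auto
  also have "\<dots> = (\<Sum>\<nu>\<le>r. real (r choose \<nu>) * (\<beta> / 2) ^ (2 * r - 2 * \<nu>) * (LINT x|halfline. (a \<nu> x)\<^sup>2 * x ^ (r - 1)))"
    by (intro sum.cong refl) (use normw_representative(1)[OF r meas ae] in \<open>simp add: power_divide\<close>)
  finally show ?thesis .
qed

text \<open>The second bound is the square root of the duality bound with the first one inserted; the factor
  \<open>1 + \<gamma>/b\<^sup>2\<close> that occurs twice before the root is at most \<open>(1 + \<surd>\<gamma>/b)\<^sup>2\<close>.\<close>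

lemma (in galerkin_error) error_estimates:
  assumes best: "degree q \<le> N" "poly q 0 = \<eta>"
    "(LINT x|halfline. (V' x - expoly' b q x)\<^sup>2) + b\<^sup>2 * (LINT x|halfline. (V x - expoly b q x)\<^sup>2)
      \<le> 4 ^ r * R\<^sup>2 / (2 * b * real N) ^ (r - 1)"
    and r: "r \<ge> 1" and N: "N \<ge> 1" and R: "R \<ge> 0"
  shows "energy \<gamma> E E' E E' \<le> 3 * 4 ^ r * (1 + \<gamma> / b\<^sup>2) * (2 * b * real N) powr (1 - real r) * R\<^sup>2"
    and "integrable halfline (\<lambda>x. (E x)\<^sup>2 / x)"
    and "sqrt (LINT x|halfline. (E x)\<^sup>2 / x)
      \<le> 3 * 4 ^ r * (1 + b\<^sup>2 / \<gamma>) * (1 + sqrt \<gamma> / b)\<^sup>2 * (2 * b * real N) powr (- real r / 2) * R"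
proof -
  define M where "M = 2 * b * real N"
  have M: "M > 0" using b N by (simp add: M_def)
  define A where "A = 1 + \<gamma> / b\<^sup>2"
  define B where "B = 1 + b\<^sup>2 / \<gamma>"
  have AB: "A \<ge> 1" "B \<ge> 1" using \<gamma> b by (simp_all add: A_def B_def)
  have powr1: "M powr (1 - real r) = 1 / M ^ (r - 1)"
  proof -
    have "1 - real r = - real (r - 1)" using r by (simp add: of_nat_diff)
    then show ?thesis using M by (simp only: powr_minus_divide powr_realpow)
  qed
  have "energy \<gamma> E E' E E' \<le> A * ((LINT x|halfline. (V' x - expoly' b q x)\<^sup>2) + b\<^sup>2 * (LINT x|halfline. (V x - expoly b q x)\<^sup>2))"
    unfolding A_def using cea[OF best(1,2)] energy_le_twisted[OF \<gamma> b] by (rule order_trans)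
  also have "\<dots> \<le> A * (4 ^ r * R\<^sup>2 / M ^ (r - 1))"
    using best(3) AB unfolding M_def by (intro mult_left_mono) auto
  finally have en: "energy \<gamma> E E' E E' \<le> A * (4 ^ r * R\<^sup>2 / M ^ (r - 1))" .
  also have "\<dots> \<le> 3 * (A * (4 ^ r * R\<^sup>2 / M ^ (r - 1)))"
  proof -
    have "0 \<le> A * (4 ^ r * R\<^sup>2 / M ^ (r - 1))" using AB M by simp
    then show ?thesis by linarith
  qed
  also have "\<dots> = 3 * 4 ^ r * A * M powr (1 - real r) * R\<^sup>2" unfolding powr1 by simp
  finally show "energy \<gamma> E E' E E' \<le> 3 * 4 ^ r * (1 + \<gamma> / b\<^sup>2) * (2 * b * real N) powr (1 - real r) * R\<^sup>2"
    unfolding A_def M_def .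
  show "integrable halfline (\<lambda>x. (E x)\<^sup>2 / x)" by (rule weighted_bound(1)[OF N])
  have half: "(M powr (- real r / 2))\<^sup>2 = 1 / (M ^ (r - 1) * M)"
  proof -
    have "(M powr (- real r / 2))\<^sup>2 = M powr (- real r)"
      by (simp add: power2_eq_square flip: powr_add)
    also have "\<dots> = 1 / M ^ r" using M by (simp add: powr_minus_divide powr_realpow)
    also have "M ^ r = M ^ (r - 1) * M" using r by (metis power_minus_mult less_le_trans zero_less_one)
    finally show ?thesis .
  qed
  have "(LINT x|halfline. (E x)\<^sup>2 / x) \<le> 9 * A * B\<^sup>2 / M * energy \<gamma> E E' E E'"
    using weighted_bound(2)[OF N] unfolding A_def B_def M_def .
  also have "\<dots> \<le> 9 * A * B\<^sup>2 / M * (A * (4 ^ r * R\<^sup>2 / M ^ (r - 1)))"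
    using en AB M by (intro mult_left_mono) auto
  also have "\<dots> = 9 * 4 ^ r * A\<^sup>2 * B\<^sup>2 * (1 / (M ^ (r - 1) * M)) * R\<^sup>2"
    by (simp add: power2_eq_square mult_ac)
  also have "\<dots> = (3 * 2 ^ r * A * B * M powr (- real r / 2) * R)\<^sup>2"
  proof -
    have "((2::real) ^ r)\<^sup>2 = 4 ^ r" by (simp add: power2_eq_square flip: power_mult_distrib)
    then show ?thesis unfolding half[symmetric] power_mult_distrib by simp
  qed
  finally have le: "(LINT x|halfline. (E x)\<^sup>2 / x) \<le> (3 * 2 ^ r * A * B * M powr (- real r / 2) * R)\<^sup>2" .
  have "sqrt (LINT x|halfline. (E x)\<^sup>2 / x) \<le> sqrt ((3 * 2 ^ r * A * B * M powr (- real r / 2) * R)\<^sup>2)"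
    using le by (rule real_sqrt_le_mono)
  also have "\<dots> = 3 * 2 ^ r * A * B * M powr (- real r / 2) * R"
    unfolding real_sqrt_abs using AB R by (intro abs_of_nonneg mult_nonneg_nonneg) auto
  also have "\<dots> \<le> 3 * 4 ^ r * (1 + sqrt \<gamma> / b)\<^sup>2 * B * M powr (- real r / 2) * R"
  proof -
    have "A \<le> (1 + sqrt \<gamma> / b)\<^sup>2"
      using \<gamma> b by (simp add: A_def power2_sum power_divide)
    moreover have "(3 * 2 ^ r :: real) \<le> 3 * 4 ^ r" by (simp add: power_mono)
    ultimately show ?thesis using AB R by (intro mult_right_mono mult_mono) auto
  qed
  finally show "sqrt (LINT x|halfline. (E x)\<^sup>2 / x)
      \<le> 3 * 4 ^ r * (1 + b\<^sup>2 / \<gamma>) * (1 + sqrt \<gamma> / b)\<^sup>2 * (2 * b * real N) powr (- real r / 2) * R"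
    unfolding B_def M_def by (simp only: mult_ac)
qed

theorem theorem2:
  fixes r :: nat
  assumes "r \<ge> 1"
  shows "\<exists>c::real. c > 0 \<and>
    (\<forall>(\<beta>::real) (\<gamma>::real) (\<eta>::real) (f :: (real \<Rightarrow> real) \<Rightarrow> real) (u :: real \<Rightarrow> real).
       \<beta> > 0 \<longrightarrow> \<gamma> > 0 \<longrightarrow> f \<in> H10_dual \<longrightarrow> weak_solution \<gamma> \<eta> f u \<longrightarrow>
       u \<in> sobolev r (real r - 1) \<longrightarrow>
       (\<forall>\<^sub>F N in sequentially. \<forall>uN. scheme_solution \<beta> \<gamma> \<eta> f N uN \<longrightarrow>
          (normw 0 (weak_deriv 1 (\<lambda>x. u x - uN x)))\<^sup>2 + \<gamma> * (normw 0 (\<lambda>x. u x - uN x))\<^sup>2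
            \<le> c * (1 + 4 * \<gamma> / \<beta>\<^sup>2) * (\<beta> * real N) powr (1 - real r) * (norm_r r \<beta> u)\<^sup>2 \<and>
          (\<lambda>x. u x - uN x) \<in> L2w (-1) \<and>
          normw (-1) (\<lambda>x. u x - uN x)
            \<le> c * (1 + \<beta>\<^sup>2 / (4 * \<gamma>)) * (1 + 2 * sqrt \<gamma> / \<beta>)\<^sup>2
                * (\<beta> * real N) powr (- real r / 2) * norm_r r \<beta> u))"
proof (intro exI[of _ "3 * 4 ^ r"] conjI allI impI)
  show "(0::real) < 3 * 4 ^ r" by simp
  fix \<beta> \<gamma> \<eta> :: real and f :: "(real \<Rightarrow> real) \<Rightarrow> real" and u :: "real \<Rightarrow> real"
  assume \<beta>: "\<beta> > 0" and \<gamma>: "\<gamma> > 0" and f: "f \<in> H10_dual" and ws: "weak_solution \<gamma> \<eta> f u"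
    and ur: "u \<in> sobolev r (real r - 1)"
  define b where "b = \<beta> / 2"
  have bb: "b > 0" "2 * b = \<beta>" using \<beta> by (simp_all add: b_def)
  obtain V where Vf: "continuous_on {0..} V" "AE x in halfline. V x = u x" "V 0 = \<eta>"
    using ws unfolding weak_solution_def has_trace_0_def by blast
  have Vc: "continuous_on {0<..} V" by (rule continuous_on_subset[OF Vf(1)]) auto
  obtain a where a: "a 0 = V" "\<And>k. k < r \<Longrightarrow> primitive (a k) (a (Suc k))"
    "\<And>k. k \<le> r \<Longrightarrow> a k \<in> borel_measurable halfline" "\<And>k. k \<le> r \<Longrightarrow> AE x in halfline. a k x = weak_deriv k u x"
    using sobolev_primitives[OF ur assms Vc Vf(2)] by blast
  have wd: "has_weak_deriv k u (weak_deriv k u) \<and> weak_deriv k u \<in> borel_measurable halfline \<and> weak_deriv k u \<in> L2w \<alpha>"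
    if us: "u \<in> sobolev s \<alpha>" and ks: "k \<le> s" for k s \<alpha>
  proof -
    obtain g where g: "has_weak_deriv k u g" "g \<in> L2w \<alpha>" using us ks unfolding sobolev_def by blast
    note w = weak_deriv_AE[OF g(1)]
    have m: "weak_deriv k u \<in> borel_measurable halfline" "g \<in> borel_measurable halfline"
      using has_weak_deriv_measurable(2) w(1) g(1) by blast+
    have "AE x in halfline. (g x)\<^sup>2 * x powr \<alpha> = (weak_deriv k u x)\<^sup>2 * x powr \<alpha>"
      using w(2) by eventually_elim simp
    moreover have "(\<lambda>x. (weak_deriv k u x)\<^sup>2 * x powr \<alpha>) \<in> borel_measurable halfline"
      using m(1) by measurable
    ultimately have "integrable halfline (\<lambda>x. (weak_deriv k u x)\<^sup>2 * x powr \<alpha>)"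
      using g(2) unfolding L2w_def by (auto intro: integrable_cong_AE_imp)
    then show ?thesis using w(1) m(1) unfolding L2w_def by blast
  qed
  have uH1: "u \<in> H1" using ws unfolding weak_solution_def by blast
  have um: "locally_integrable u" using wd[OF uH1, of 0] unfolding has_weak_deriv_def by simp
  note u_meas = locally_integrable_measurable[OF um]
  have L2: "a k \<in> L2w 0" if "k \<le> 1" for k
  proof -
    have m: "a k \<in> borel_measurable halfline" "weak_deriv k u \<in> borel_measurable halfline"
      using a(3)[of k] wd[OF uH1 that] that assms by auto
    have "AE x in halfline. (weak_deriv k u x)\<^sup>2 = (a k x)\<^sup>2"
      using a(4)[OF order_trans[OF that assms]] by eventually_elim simp
    moreover have "(\<lambda>x. (a k x)\<^sup>2) \<in> borel_measurable halfline" using m(1) by measurable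
    ultimately show ?thesis
      using wd[OF uH1 that] m unfolding L2w_0_iff by (auto intro: integrable_cong_AE_imp)
  qed
  have VV': "primitive V (a 1)" using a(1) a(2)[of 0] assms by simp
  have u_deriv: "has_weak_deriv 1 u (a 1)"
    by (rule has_weak_deriv_cong_AE[OF has_weak_deriv_primitive[OF VV'] um Vf(2)])
  have V_trace: "(V \<longlongrightarrow> \<eta>) (at_right 0)"
  proof -
    have "(V \<longlongrightarrow> V 0) (at 0 within {0..})" using Vf(1) by (simp add: continuous_on_def)
    then show ?thesis unfolding Vf(3) by (rule tendsto_within_subset) auto
  qed
  have top: "integrable halfline (\<lambda>x. (a k x)\<^sup>2 * x ^ (r - 1))" if "k \<le> r" for k
    using normw_representative(2)[OF assms a(3) _ a(4)] wd[OF ur that] that by blast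
  define R where "R = norm_r r \<beta> u"
  have R: "R \<ge> 0" unfolding R_def norm_r_def using \<beta> by (intro real_sqrt_ge_zero sum_nonneg mult_nonneg_nonneg) auto
  have R_square: "R\<^sup>2 = (\<Sum>\<nu>\<le>r. real (r choose \<nu>) * b ^ (2 * r - 2 * \<nu>) * (LINT x|halfline. (a \<nu> x)\<^sup>2 * x ^ (r - 1)))"
    unfolding R_def b_def by (rule norm_r_square[OF assms a(3) _ a(4) \<beta>]) (use wd[OF ur] in blast)+
  show "\<forall>\<^sub>F N in sequentially. \<forall>uN. scheme_solution \<beta> \<gamma> \<eta> f N uN \<longrightarrow>
          (normw 0 (weak_deriv 1 (\<lambda>x. u x - uN x)))\<^sup>2 + \<gamma> * (normw 0 (\<lambda>x. u x - uN x))\<^sup>2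
            \<le> 3 * 4 ^ r * (1 + 4 * \<gamma> / \<beta>\<^sup>2) * (\<beta> * real N) powr (1 - real r) * (norm_r r \<beta> u)\<^sup>2 \<and>
          (\<lambda>x. u x - uN x) \<in> L2w (-1) \<and>
          normw (-1) (\<lambda>x. u x - uN x)
            \<le> 3 * 4 ^ r * (1 + \<beta>\<^sup>2 / (4 * \<gamma>)) * (1 + 2 * sqrt \<gamma> / \<beta>)\<^sup>2
                * (\<beta> * real N) powr (- real r / 2) * norm_r r \<beta> u"
    using eventually_ge_at_top[of "2 * r"]
  proof (rule eventually_mono, intro allI impI)
    fix N uN assume N: "2 * r \<le> N" and sch: "scheme_solution \<beta> \<gamma> \<eta> f N uN"
    have N1: "N \<ge> 1" using N assms by simp
    obtain p where pf: "uN = expoly b p" "degree p \<le> N"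
      using sch unfolding scheme_solution_def X_eq b_def by blast
    have p0: "poly p 0 = \<eta>" using sch pf(1) unfolding scheme_solution_def by (simp add: expoly_def)
    have uN_deriv: "has_weak_deriv 1 uN (expoly' b p)"
      unfolding pf(1) expoly'_def by (rule has_weak_deriv_primitive[OF primitive_expoly])
    have V_meas: "V \<in> borel_measurable halfline" using a(1) a(3)[of 0] by simp
    interpret galerkin_error b \<gamma> \<eta> V "a 1" p N
    proof
      show "energy \<gamma> (\<lambda>x. V x - expoly b p x) (\<lambda>x. a 1 x - expoly' b p x) (expoly b q) (expoly' b q) = 0"
        if q: "degree q \<le> N" "poly q 0 = 0" for q
      proof -
        have q_deriv: "has_weak_deriv 1 (expoly b q) (expoly' b q)"
          unfolding expoly'_def by (rule has_weak_deriv_primitive[OF primitive_expoly])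
        have "energy_form \<gamma> u (expoly b q) = f (expoly b q)"
          using ws expoly_in_H10[OF bb(1) q(2)] unfolding weak_solution_def by blast
        moreover have "energy_form \<gamma> uN (expoly b q) = f (expoly b q)"
          using sch q unfolding scheme_solution_def X0_eq b_def by blast
        moreover have "energy_form \<gamma> u (expoly b q) = energy \<gamma> V (a 1) (expoly b q) (expoly' b q)"
          using energy_form_eq[OF u_deriv q_deriv] inner_L2_cong_AE[OF V_meas u_meas _ Vf(2), of "expoly b q"]
          by (simp add: energy_def inner_L2_def)
        moreover have "energy_form \<gamma> uN (expoly b q) = energy \<gamma> (expoly b p) (expoly' b p) (expoly b q) (expoly' b q)"
          using energy_form_eq[OF uN_deriv q_deriv] by (simp add: energy_def pf(1))
        moreover have "energy \<gamma> (\<lambda>x. V x - expoly b p x) (\<lambda>x. a 1 x - expoly' b p x) (expoly b q) (expoly' b q)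
          = energy \<gamma> V (a 1) (expoly b q) (expoly' b q) - energy \<gamma> (expoly b p) (expoly' b p) (expoly b q) (expoly' b q)"
          using energy_diff[of "expoly b q" "expoly' b q" V "a 1" "expoly b p" "expoly' b p" \<gamma>]
            L2[of 0] L2[of 1] a(1) L2w_0_expoly[OF bb(1)] by (simp add: energy_commute)
        ultimately show ?thesis by simp
      qed
    qed (use bb \<gamma> VV' L2[of 0] L2[of 1] a(1) V_trace pf p0 in auto)
    obtain q where q: "degree q \<le> N" "poly q 0 = \<eta>"
      "(LINT x|halfline. (a 1 x - expoly' b q x)\<^sup>2) + b\<^sup>2 * (LINT x|halfline. (V x - expoly b q x)\<^sup>2)
        \<le> 4 ^ r * R\<^sup>2 / (2 * b * real N) ^ (r - 1)"
      using weighted_energy_approximation[of b r a \<eta> N, OF bb(1) assms a(2,3) top _ _ _ N] L2[of 0] L2[of 1] V_trace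
      unfolding a(1) R_square[symmetric] L2w_0_iff by blast
    note est = error_estimates[OF q assms N1 R, unfolded bb(2)]
    have e_AE: "AE x in halfline. E x = u x - uN x"
      using Vf(2) by eventually_elim (simp add: E_def pf(1))
    have e_meas: "(\<lambda>x. u x - uN x) \<in> borel_measurable halfline" "E \<in> borel_measurable halfline"
      using u_meas E_L2(1) pf(1) unfolding L2w_0_iff by auto
    have e_deriv: "has_weak_deriv 1 (\<lambda>x. u x - uN x) E'"
      using has_weak_deriv_diff[OF u_deriv uN_deriv] unfolding E'_def[abs_def] .
    have "(normw 0 (weak_deriv 1 (\<lambda>x. u x - uN x)))\<^sup>2 + \<gamma> * (normw 0 (\<lambda>x. u x - uN x))\<^sup>2 = energy \<gamma> E E' E E'"
      using normw_weak_deriv[OF e_deriv, of 0] normw_cong_AE[OF e_meas(2,1) e_AE, of 0]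
      by (simp add: energy_self normw_0_square[symmetric])
    moreover have "\<gamma> / b\<^sup>2 = 4 * \<gamma> / \<beta>\<^sup>2" "b\<^sup>2 / \<gamma> = \<beta>\<^sup>2 / (4 * \<gamma>)" "sqrt \<gamma> / b = 2 * sqrt \<gamma> / \<beta>"
      by (simp_all add: b_def power_divide)
    moreover have weighted: "AE x in halfline. (E x)\<^sup>2 / x = (u x - uN x)\<^sup>2 * x powr - 1"
    proof -
      have "AE x in halfline. x > 0" by (intro AE_I2) simp
      with e_AE show ?thesis by eventually_elim (simp add: powr_minus_divide)
    qed
    have w_meas: "(\<lambda>x. (u x - uN x)\<^sup>2 * x powr - 1) \<in> borel_measurable halfline"
      "(\<lambda>x. (E x)\<^sup>2 / x) \<in> borel_measurable halfline"
      using e_meas by measurable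
    have "(\<lambda>x. u x - uN x) \<in> L2w (-1)"
      unfolding L2w_def using e_meas(1) integrable_cong_AE_imp[OF est(2) w_meas(1)] weighted by auto
    moreover have "normw (-1) (\<lambda>x. u x - uN x) = sqrt (LINT x|halfline. (E x)\<^sup>2 / x)"
      unfolding normw_def using integral_cong_AE[OF w_meas(2,1) weighted] by simp
    ultimately show "(normw 0 (weak_deriv 1 (\<lambda>x. u x - uN x)))\<^sup>2 + \<gamma> * (normw 0 (\<lambda>x. u x - uN x))\<^sup>2
            \<le> 3 * 4 ^ r * (1 + 4 * \<gamma> / \<beta>\<^sup>2) * (\<beta> * real N) powr (1 - real r) * (norm_r r \<beta> u)\<^sup>2 \<and>
          (\<lambda>x. u x - uN x) \<in> L2w (-1) \<and>
          normw (-1) (\<lambda>x. u x - uN x)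
            \<le> 3 * 4 ^ r * (1 + \<beta>\<^sup>2 / (4 * \<gamma>)) * (1 + 2 * sqrt \<gamma> / \<beta>)\<^sup>2
                * (\<beta> * real N) powr (- real r / 2) * norm_r r \<beta> u"
      using est(1,3) unfolding R_def by simp
  qed
qed

end
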